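(* Let $d\ge 2$ be an integer, $\nu\in[0,+\infty)$, $f\in C^\infty([0,+\infty),\mathbb{H}^\infty_{\Sigma 0})$, $u_0\in\mathbb{H}^\infty_{\Sigma 0}$, and let $u\in C^\infty([0,T),\mathbb{H}^\infty_{\Sigma 0})$ ($T\in(0,+\infty]$) be the maximal solution of the Navier-Stokes Cauchy problem $$\frac{du}{dt}=\nu\Delta u+\mathscr{P}(u,u)+f,\qquad u(0)=u_0 .$$ Let $u_a\in C^1([0,T_a),\mathbb{H}^\infty_{\Sigma 0})$, with $T_a\in(0,+\infty]$, be any approximate solution of this problem and, for each real $p>d/2+1$, let $\epsilon_p$, $\delta_p$, $\mathcal{D}_p$ be, respectively, a differential error estimator, a datum error estimator and a growth estimator of order $p$ for $u_a$. Let $K_n,G_n,G_{pn}$ be constants as in the context. Consider a real $n>d/2+1$, and assume there is a function $\mathscr{R}_n\in C([0,T_c),\mathbb{R})$, with $T_c\in(0,T_a]$, fulfilling the control inequalities $$\frac{d^+\mathscr{R}_n}{dt}\ \ge\ -\nu\mathscr{R}_n+(G_n\mathcal{D}_n+K_n\mathcal{D}_{n+1})\mathscr{R}_n+G_n\mathscr{R}_n^2+\epsilon_n\quad\text{everywhere on }[0,T_c),\qquad \mathscr{R}_n(0)\ge\delta_n$$ (these are fulfilled as equalities by a unique function in $C^1([0,T_c),\mathbb{R})$, for a suitable $T_c$). Then: (i) One has $$T\ge T_c,\qquad \|u(t)-u_a(t)\|_n\le\mathscr{R}_n(t)\quad\text{for all }t\in[0,T_c).$$ In particular, if $T_c=+\infty$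 then $T=+\infty$. (ii) Consider any real $p>n$, and let $\mathscr{R}_p\in C([0,T_c),\mathbb{R})$ be a solution of the linear control inequalities $$\frac{d^+\mathscr{R}_p}{dt}\ \ge\ -\nu\mathscr{R}_p+(G_p\mathcal{D}_p+K_p\mathcal{D}_{p+1}+G_{pn}\mathscr{R}_n)\mathscr{R}_p+\epsilon_p\quad\text{everywhere on }[0,T_c),\qquad \mathscr{R}_p(0)\ge\delta_p .$$ Then $$\|u(t)-u_a(t)\|_p\le\mathscr{R}_p(t)\quad\text{for all }t\in[0,T_c).$$ The linear control inequalities are fulfilled as equalities by a unique function $\mathscr{R}_p\in C^1([0,T_c),\mathbb{R})$, given explicitly for $t\in[0,T_c)$ by $$\mathscr{R}_p(t)=e^{-\nu t+\mathscr{A}_p(t)}\Big(\delta_p+\int_0^t e^{\nu s-\mathscr{A}_p(s)}\epsilon_p(s)\,ds\Big),\qquad \mathscr{A}_p(t):=\int_0^t\big(G_p\mathcal{D}_p(s)+K_p\mathcal{D}_{p+1}(s)+G_{pn}\mathscr{R}_n(s)\big)ds .$$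
   Context: **Spaces.** $\mathbb{T}^d:=(\mathbb{R}/2\pi\mathbb{Z})^d$. Every $\mathbb{R}^d$-valued distribution $v$ on $\mathbb{T}^d$ has a Fourier expansion $v=(2\pi)^{-d/2}\sum_{k\in\mathbb{Z}^d}v_k e^{ik\cdot x}$ with $v_k=\overline{v_{-k}}\in\mathbb{C}^d$. For $n\in\mathbb{R}$, $\mathbb{H}^n_{\Sigma 0}$ is the Sobolev space of those $v$ with zero divergence and zero mean ($k\cdot v_k=0$ for all $k$, $v_0=0$) such that $\sum_{k\ne0}|k|^{2n}|v_k|^2<+\infty$. It carries the inner product $\langle v|w\rangle_n:=\sum_{k\in\mathbb{Z}^d\setminus\{0\}}|k|^{2n}\,\overline{v_k}\cdot w_k$ and the norm $\|v\|_n:=\sqrt{\langle v|v\rangle_n}$. $\mathbb{H}^\infty_{\Sigma 0}:=\bigcap_{p\in\mathbb{R}}\mathbb{H}^p_{\Sigma 0}$ is a Fréchet space with the topology defined by all norms $\|\cdot\|_p$; it coincides with the space of $C^\infty$ vector fields $\mathbb{T}^d\to\mathbb{R}^d$ with zero divergence and zero mean. **Bilinear map.** $\mathscr{P}(v,w):=-\mathfrak{L}(v\cdot\partial w)$, where $(v\cdot\partial w)_r=\sum_{s=1}^d v_s\partial_s w_r$ and $\mathfrak{L}$ is the Leray projection onto divergence free vector fields (in Fourier terms, $(\mathfrak{L}z)_k$ is the orthogonal projection of $z_k$ onto $k^\perp$ in $\mathbb{C}^d$). $\mathscr{P}$ maps $\mathbb{H}^\infty_{\Sigma 0}\times\mathbb{H}^\infty_{\Sigma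 0}$ continuously to $\mathbb{H}^\infty_{\Sigma 0}$. **Constants.** It is known that there are constants $K_n,G_n,G_{pn}\in(0,+\infty)$ (depending also on $d$) such that: - $\|\mathscr{P}(v,w)\|_n\le K_n\|v\|_n\|w\|_{n+1}$ for real $n>d/2$, $v\in\mathbb{H}^n_{\Sigma 0}$, $w\in\mathbb{H}^{n+1}_{\Sigma 0}$; - $|\langle\mathscr{P}(v,w)|w\rangle_n|\le G_n\|v\|_n\|w\|_n^2$ for real $n>d/2+1$, $v\in\mathbb{H}^n_{\Sigma 0}$, $w\in\mathbb{H}^{n+1}_{\Sigma 0}$; - $|\langle\mathscr{P}(v,w)|w\rangle_p|\le\frac12 G_{pn}(\|v\|_p\|w\|_n+\|v\|_n\|w\|_p)\|w\|_p$ for real $p\ge n>d/2+1$, $v\in\mathbb{H}^p_{\Sigma 0}$, $w\in\mathbb{H}^{p+1}_{\Sigma 0}$. Any such constants are fixed, with $G_{nn}=G_n$. **Cauchy problem.** A solution is a function $u\in C^\infty([0,T),\mathbb{H}^\infty_{\Sigma 0})$, for some $T\in(0,+\infty]$ depending on $u$, with $du/dt=\nu\Delta u+\mathscr{P}(u,u)+f$ on $[0,T)$ and $u(0)=u_0$. It is known that there is a unique maximal (not extendable) solution, of which every solution is a restriction. **Approximate solutions and estimators.** An approximate solution is any map $u_a\in C^1([0,T_a),\mathbb{H}^\infty_{\Sigma 0})$, $T_a\in(0,+\infty]$. Its differential error is $e(u_a):=\frac{du_a}{dt}-\nu\Delta u_a-\mathscr{P}(u_a,u_a)-f\in C([0,T_a),\mathbb{H}^\infty_{\Sigma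 0})$; its datum error is $u_a(0)-u_0$. For real $p$, a differential error estimator, a datum error estimator and a growth estimator of order $p$ for $u_a$ are, respectively, a function $\epsilon_p\in C([0,T_a),[0,+\infty))$, a number $\delta_p\in[0,+\infty)$ and a function $\mathcal{D}_p\in C([0,T_a),[0,+\infty))$ such that $\|e(u_a)(t)\|_p\le\epsilon_p(t)$ for $t\in[0,T_a)$, $\|u_a(0)-u_0\|_p\le\delta_p$, and $\|u_a(t)\|_p\le\mathcal{D}_p(t)$ for $t\in[0,T_a)$. **Dini derivative.** For $\varphi:[0,\tau)\to\mathbb{R}$, $\frac{d^+\varphi}{dt}(t):=\limsup_{h\to0^+}\frac{\varphi(t+h)-\varphi(t)}{h}$ (right, upper Dini derivative). *)

theory Defs
  imports "HOL-Analysis.Analysis"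
begin

text \<open>
  A distribution \<open>v\<close> on the torus \<open>(\<real>/2\<pi>\<int>)\<^sup>d\<close> is represented by the family of its
  Fourier coefficients, with the normalisation
  \<open>v = (2\<pi>)\<^bsup>-d/2\<^esup> (\<Sum>k. v\<^sub>k e\<^bsup>i k \<cdot> x\<^esup>)\<close>; the dimension \<open>d\<close> is \<open>CARD('d)\<close>.
  Real-valuedness (\<open>v\<^sub>-\<^sub>k\<close> is the conjugate of \<open>v\<^sub>k\<close>) is imposed in the Sobolev spaces
  below, whose summability condition also implies the polynomial growth of the coefficients.
\<close>

type_synonym 'd field = "int ^ 'd \<Rightarrow> complex ^ 'd"

definition wave :: "int ^ 'd \<Rightarrow> real ^ 'd" where
  "wave k = (\<chi> r. of_int (k $ r))"

definition cwave :: "int ^ 'd \<Rightarrow> complex ^ 'd" where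
  "cwave k = (\<chi> r. of_int (k $ r))"

definition bdot :: "complex ^ 'd \<Rightarrow> complex ^ 'd \<Rightarrow> complex" where
  "bdot a b = (\<Sum>r\<in>UNIV. a $ r * b $ r)"


subsection \<open>Sobolev spaces of divergence free, zero mean fields\<close>

definition sobolev :: "real \<Rightarrow> 'd::finite field set" where
  "sobolev n = {v. (\<forall>k r. v (- k) $ r = cnj (v k $ r)) \<and>
                   (\<forall>k. bdot (cwave k) (v k) = 0) \<and> v 0 = 0 \<and>
                   (\<lambda>k. norm (wave k) powr (2 * n) * (norm (v k))\<^sup>2) summable_on (- {0})}"

definition sob_inner :: "real \<Rightarrow> 'd::finite field \<Rightarrow> 'd field \<Rightarrow> complex" where
  "sob_inner n v w =
     (\<Sum>\<^sub>\<infinity>k\<in>- {0}. of_real (norm (wave k) powr (2 * n)) * bdot (\<chi> r. cnj (v k $ r)) (w k))"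

definition sob_norm :: "real \<Rightarrow> 'd::finite field \<Rightarrow> real" where
  "sob_norm n v = sqrt (Re (sob_inner n v v))"

definition smooth_fields :: "'d::finite field set" where
  "smooth_fields = (\<Inter>p. sobolev p)"

text \<open>The Frechet topology: the open balls of all the norms of real order form a subbasis.\<close>

definition frechet :: "'d::finite field topology" where
  "frechet = topology_generated_by
     {{w \<in> smooth_fields. sob_norm p (\<lambda>k. w k - v k) < r} | p v r. v \<in> smooth_fields \<and> 0 < r}"


subsection \<open>Differential operators and the bilinear map\<close>

definition dpartial :: "'d::finite \<Rightarrow> 'd field \<Rightarrow> 'd field" where
  "dpartial s v = (\<lambda>k. (\<i> * of_int (k $ s)) *s v k)"

definition laplacian :: "'d::finite field \<Rightarrow> 'd field" where
  "laplacian v = (\<lambda>k. \<Sum>s\<in>UNIV. dpartial s (dpartial s v) k)"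

text \<open>Pointwise values of a field whose Fourier series converges absolutely.\<close>

definition field_at :: "'d::finite field \<Rightarrow> real ^ 'd \<Rightarrow> complex ^ 'd" where
  "field_at v x = (2 * pi) powr (- real CARD('d) / 2) *\<^sub>R (\<Sum>\<^sub>\<infinity>k. cis (wave k \<bullet> x) *s v k)"

definition fourier_coeff :: "(real ^ 'd::finite \<Rightarrow> complex) \<Rightarrow> int ^ 'd \<Rightarrow> complex" where
  "fourier_coeff g k = (2 * pi) powr (- real CARD('d) / 2) *\<^sub>R
     (LINT x:cbox 0 (\<chi> r. 2 * pi)|lborel. g x * cis (- (wave k \<bullet> x)))"

text \<open>The field \<open>v \<cdot> \<partial>w\<close>, as a genuine product of functions on the torus.\<close>

definition advect :: "'d::finite field \<Rightarrow> 'd field \<Rightarrow> 'd field" where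
  "advect v w = (\<lambda>k. \<chi> r. fourier_coeff
     (\<lambda>x. \<Sum>s\<in>UNIV. field_at v x $ s * field_at (dpartial s w) x $ r) k)"

text \<open>Orthogonal projection of each coefficient onto \<open>k\<^sup>\<bottom>\<close>; for \<open>k = 0\<close> this is the identity,
  by the convention \<open>x / 0 = 0\<close>.\<close>

definition leray :: "'d::finite field \<Rightarrow> 'd field" where
  "leray z = (\<lambda>k. z k - (bdot (cwave k) (z k) / of_real ((norm (wave k))\<^sup>2)) *s cwave k)"

definition nse_bilin :: "'d::finite field \<Rightarrow> 'd field \<Rightarrow> 'd field" where
  "nse_bilin v w = (\<lambda>k. - leray (advect v w) k)"


subsection \<open>Admissible constants\<close>

definition basic_consts :: "'d::finite itself \<Rightarrow> (real \<Rightarrow> real) \<Rightarrow> bool" where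
  "basic_consts _ K \<longleftrightarrow> (\<forall>n > real CARD('d) / 2. 0 < K n \<and>
     (\<forall>v \<in> sobolev n. \<forall>w \<in> (sobolev (n + 1) :: 'd field set).
        sob_norm n (nse_bilin v w) \<le> K n * sob_norm n v * sob_norm (n + 1) w))"

definition kato_consts :: "'d::finite itself \<Rightarrow> (real \<Rightarrow> real) \<Rightarrow> bool" where
  "kato_consts _ G \<longleftrightarrow> (\<forall>n > real CARD('d) / 2 + 1. 0 < G n \<and>
     (\<forall>v \<in> sobolev n. \<forall>w \<in> (sobolev (n + 1) :: 'd field set).
        norm (sob_inner n (nse_bilin v w) w) \<le> G n * sob_norm n v * (sob_norm n w)\<^sup>2))"

definition tame_kato_consts :: "'d::finite itself \<Rightarrow> (real \<Rightarrow> real \<Rightarrow> real) \<Rightarrow> bool" where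
  "tame_kato_consts _ GG \<longleftrightarrow> (\<forall>n > real CARD('d) / 2 + 1. \<forall>p \<ge> n. 0 < GG p n \<and>
     (\<forall>v \<in> sobolev p. \<forall>w \<in> (sobolev (p + 1) :: 'd field set).
        norm (sob_inner p (nse_bilin v w) w)
          \<le> 1 / 2 * GG p n * (sob_norm p v * sob_norm n w + sob_norm n v * sob_norm p w)
              * sob_norm p w))"


subsection \<open>Functions of time\<close>

definition time_ivl :: "ereal \<Rightarrow> real set" where
  "time_ivl T = {t. 0 \<le> t \<and> ereal t < T}"

text \<open>Derivatives in the Frechet topology; one-sided at an end point of the interval \<open>I\<close>.\<close>

definition has_time_deriv ::
  "real set \<Rightarrow> (real \<Rightarrow> 'd::finite field) \<Rightarrow> 'd field \<Rightarrow> real \<Rightarrow> bool" where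
  "has_time_deriv I u u' t \<longleftrightarrow>
     limitin frechet (\<lambda>s k. (1 / (s - t)) *\<^sub>R (u s k - u t k)) u' (at t within I)"

definition time_deriv :: "real set \<Rightarrow> (real \<Rightarrow> 'd::finite field) \<Rightarrow> real \<Rightarrow> 'd field" where
  "time_deriv I u t = (THE u'. has_time_deriv I u u' t)"

primrec time_Ck :: "nat \<Rightarrow> real set \<Rightarrow> (real \<Rightarrow> 'd::finite field) \<Rightarrow> bool" where
  "time_Ck 0 I u \<longleftrightarrow> continuous_map (top_of_set I) frechet u"
| "time_Ck (Suc m) I u \<longleftrightarrow> continuous_map (top_of_set I) frechet u \<and>
     (\<exists>u'. (\<forall>t\<in>I. has_time_deriv I u (u' t) t) \<and> time_Ck m I u')"

definition time_smooth :: "real set \<Rightarrow> (real \<Rightarrow> 'd::finite field) \<Rightarrow> bool" where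
  "time_smooth I u \<longleftrightarrow> (\<forall>m. time_Ck m I u)"

definition real_C1 :: "real set \<Rightarrow> (real \<Rightarrow> real) \<Rightarrow> bool" where
  "real_C1 I R \<longleftrightarrow> (\<exists>R'. continuous_on I R' \<and>
     (\<forall>t\<in>I. (R has_real_derivative R' t) (at t within I)))"

text \<open>Right, upper Dini derivative, possibly infinite.\<close>

definition dini :: "(real \<Rightarrow> real) \<Rightarrow> real \<Rightarrow> ereal" where
  "dini \<phi> t = Limsup (at_right 0) (\<lambda>h. ereal ((\<phi> (t + h) - \<phi> t) / h))"


text \<open>In the two right-hand sides below, \<open>K\<close>, \<open>G\<close>, \<open>\<epsilon>\<close>, \<open>D\<close> are families indexed by the Sobolev order,
  and \<open>GG p n\<close> is \<open>G\<^sub>p\<^sub>n\<close>.\<close>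

definition control_rhs ::
  "real \<Rightarrow> (real \<Rightarrow> real) \<Rightarrow> (real \<Rightarrow> real) \<Rightarrow> (real \<Rightarrow> real \<Rightarrow> real) \<Rightarrow> (real \<Rightarrow> real \<Rightarrow> real) \<Rightarrow>
   real \<Rightarrow> (real \<Rightarrow> real) \<Rightarrow> real \<Rightarrow> real" where
  "control_rhs \<nu> K G \<epsilon> D n R t =
     - \<nu> * R t + (G n * D n t + K n * D (n + 1) t) * R t + G n * (R t)\<^sup>2 + \<epsilon> n t"

definition lin_control_rhs ::
  "real \<Rightarrow> (real \<Rightarrow> real) \<Rightarrow> (real \<Rightarrow> real) \<Rightarrow> (real \<Rightarrow> real \<Rightarrow> real) \<Rightarrow> (real \<Rightarrow> real \<Rightarrow> real) \<Rightarrow>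
   (real \<Rightarrow> real \<Rightarrow> real) \<Rightarrow> real \<Rightarrow> real \<Rightarrow> (real \<Rightarrow> real) \<Rightarrow> (real \<Rightarrow> real) \<Rightarrow> real \<Rightarrow> real" where
  "lin_control_rhs \<nu> K G GG \<epsilon> D n p Rn R t =
     - \<nu> * R t + (G p * D p t + K p * D (p + 1) t + GG p n * Rn t) * R t + \<epsilon> p t"


subsection \<open>The Cauchy problem, approximate solutions and estimators\<close>

definition nse_solution ::
  "real \<Rightarrow> (real \<Rightarrow> 'd::finite field) \<Rightarrow> 'd field \<Rightarrow> ereal \<Rightarrow> (real \<Rightarrow> 'd field) \<Rightarrow> bool" where
  "nse_solution \<nu> f u0 T u \<longleftrightarrow> 0 < T \<and> time_smooth (time_ivl T) u \<and> u 0 = u0 \<and>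
     (\<forall>t \<in> time_ivl T. has_time_deriv (time_ivl T) u
        (\<lambda>k. \<nu> *\<^sub>R laplacian (u t) k + nse_bilin (u t) (u t) k + f t k) t)"

definition nse_maximal_solution ::
  "real \<Rightarrow> (real \<Rightarrow> 'd::finite field) \<Rightarrow> 'd field \<Rightarrow> ereal \<Rightarrow> (real \<Rightarrow> 'd field) \<Rightarrow> bool" where
  "nse_maximal_solution \<nu> f u0 T u \<longleftrightarrow> nse_solution \<nu> f u0 T u \<and>
     (\<forall>T' u'. nse_solution \<nu> f u0 T' u' \<and> T \<le> T' \<and> (\<forall>t \<in> time_ivl T. u' t = u t) \<longrightarrow> T' = T)"

definition approx_solution :: "ereal \<Rightarrow> (real \<Rightarrow> 'd::finite field) \<Rightarrow> bool" where
  "approx_solution Ta ua \<longleftrightarrow> 0 < Ta \<and> time_Ck 1 (time_ivl Ta) ua"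

definition diff_error ::
  "real \<Rightarrow> (real \<Rightarrow> 'd::finite field) \<Rightarrow> ereal \<Rightarrow> (real \<Rightarrow> 'd field) \<Rightarrow> real \<Rightarrow> 'd field" where
  "diff_error \<nu> f Ta ua t = (\<lambda>k. time_deriv (time_ivl Ta) ua t k - \<nu> *\<^sub>R laplacian (ua t) k
     - nse_bilin (ua t) (ua t) k - f t k)"

definition diff_error_estimator ::
  "real \<Rightarrow> (real \<Rightarrow> 'd::finite field) \<Rightarrow> ereal \<Rightarrow> (real \<Rightarrow> 'd field) \<Rightarrow> real \<Rightarrow> (real \<Rightarrow> real) \<Rightarrow> bool"
  where
  "diff_error_estimator \<nu> f Ta ua p \<epsilon> \<longleftrightarrow> continuous_on (time_ivl Ta) \<epsilon> \<and>
     (\<forall>t \<in> time_ivl Ta. 0 \<le> \<epsilon> t \<and> sob_norm p (diff_error \<nu> f Ta ua t) \<le> \<epsilon> t)"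

definition datum_error_estimator ::
  "'d::finite field \<Rightarrow> (real \<Rightarrow> 'd field) \<Rightarrow> real \<Rightarrow> real \<Rightarrow> bool" where
  "datum_error_estimator u0 ua p \<delta> \<longleftrightarrow> 0 \<le> \<delta> \<and> sob_norm p (\<lambda>k. ua 0 k - u0 k) \<le> \<delta>"

definition growth_estimator ::
  "ereal \<Rightarrow> (real \<Rightarrow> 'd::finite field) \<Rightarrow> real \<Rightarrow> (real \<Rightarrow> real) \<Rightarrow> bool" where
  "growth_estimator Ta ua p D \<longleftrightarrow> continuous_on (time_ivl Ta) D \<and>
     (\<forall>t \<in> time_ivl Ta. 0 \<le> D t \<and> sob_norm p (ua t) \<le> D t)"

end

theory Submission
  imports Defs "HOL-Complex_Analysis.Great_Picard"
begin

text \<open>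
  The difference \<open>w = u - u\<^sub>a\<close> satisfies \<open>w' = \<nu> \<Delta> w + P(u\<^sub>a, w) + P(w, u\<^sub>a) + P(w, w) - e\<close>. Pairing this with \<open>w\<close> and
  using the Kato inequalities shows that the norm of \<open>w\<close> is a subsolution of the control equation, so that it
  stays below every supersolution with a larger initial value, by a comparison principle for the Dini derivative.

  This bounds the norm of order \<open>n\<close> of \<open>u\<close> on \<open>[0, T)\<close> if \<open>T < T\<^sub>c\<close>. To contradict maximality, \<open>u\<close> is
  restarted shortly before \<open>T\<close>: a smooth solution exists for a time that depends only on the norm of order \<open>n\<close>
  of the datum. It is obtained from an explicit Euler scheme for the Galerkin truncation to \<open>|k| \<le> N + 1\<close>, with a
  step so small in terms of \<open>N\<close> that the quadratic error of a step is negligible in every Sobolev norm. The Kato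
  inequality bounds the norm of order \<open>n\<close> of the iterates on the given time interval, the tame inequality then
  bounds all the other norms, and by compactness a subsequence converges coefficientwise, hence in the Frechet
  topology. The limit and the old solution coincide on the overlap by the same energy inequality.
\<close>

subsection \<open>Weighted sequence spaces\<close>

text \<open>The bilinear map loses one derivative and \<open>\<nu> = 0\<close> is allowed, so
  neither a contraction in a fixed Sobolev space nor smoothing by the heat flow is available. What
  helps is that the Kato bounds for pairings lose nothing: truncation drops out of the pairing with
  a truncated field, so the energy bounds are uniform in the cutoff, while the crude bounds on the
  right-hand side, which grow like a power of the cutoff, enter only through the square of the time
  step. The tame bound is linear in the squared norm of order \<open>p\<close> once the norm of
  order \<open>n\<close> is controlled, so all orders survive on one time interval; for the same
  reason (ii) has a linear control inequality. The assumed inequalities bound norms only, and a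
  divergent sum has the default value 0. Smoothness and bilinearity of \<open>nse_bilin\<close>,
  which is defined through integrals of products of functions, therefore come from an explicit
  convolution formula. A norm is not differentiable where it vanishes, and the control functions are
  merely continuous; both facts force one-sided growth bounds in place of derivatives.\<close>

lemma wave_0 [simp]: "wave 0 = 0"
  by (simp add: wave_def vec_eq_iff)

lemma wave_add: "wave (k + l) = wave k + wave l"
  by (simp add: wave_def vec_eq_iff)

lemma wave_minus [simp]: "wave (- k) = - wave k"
  by (simp add: wave_def vec_eq_iff)

lemma wave_diff: "wave (k - l) = wave k - wave l"
  by (simp add: wave_def vec_eq_iff)

lemma norm_wave_ge_1:
  assumes "k \<noteq> 0"
  shows "1 \<le> norm (wave k)"
proof -
  obtain r where r: "k $ r \<noteq> 0"
    using assms by (auto simp: vec_eq_iff)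
  have "1 \<le> \<bar>real_of_int (k $ r)\<bar>" using r by linarith
  also have "\<dots> = \<bar>wave k $ r\<bar>" by (simp add: wave_def)
  also have "\<dots> \<le> norm (wave k)" by (rule component_le_norm_cart)
  finally show ?thesis .
qed

definition sob_weight :: "real \<Rightarrow> int ^ 'd::finite \<Rightarrow> real" where
  "sob_weight p k = norm (wave k) powr (2 * p)"

definition sob_finite :: "real \<Rightarrow> 'd::finite field \<Rightarrow> bool" where
  "sob_finite p v \<longleftrightarrow> (\<lambda>k. sob_weight p k * (norm (v k))\<^sup>2) summable_on (- {0})"

text \<open>A real bilinear form, built on the real inner product of \<open>complex ^ 'd\<close>, so
  that the energy identities avoid complex arithmetic; on fields of finite norm it is the real part
  of \<open>sob_inner\<close>.\<close>

definition sob_ip :: "real \<Rightarrow> 'd::finite field \<Rightarrow> 'd field \<Rightarrow> real" where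
  "sob_ip p v w = (\<Sum>\<^sub>\<infinity>k\<in>- {0}. sob_weight p k * (v k \<bullet> w k))"

definition solenoidal :: "'d::finite field \<Rightarrow> bool" where
  "solenoidal v \<longleftrightarrow> (\<forall>k r. v (- k) $ r = cnj (v k $ r)) \<and> (\<forall>k. bdot (cwave k) (v k) = 0) \<and> v 0 = 0"

lemma sob_weight_nonneg [simp]: "0 \<le> sob_weight p k"
  by (simp add: sob_weight_def)

lemma sobolev_iff: "v \<in> sobolev p \<longleftrightarrow> solenoidal v \<and> sob_finite p v"
  by (auto simp: sobolev_def solenoidal_def sob_finite_def sob_weight_def)

lemma smooth_fields_iff: "v \<in> smooth_fields \<longleftrightarrow> solenoidal v \<and> (\<forall>p. sob_finite p v)"
  by (auto simp: smooth_fields_def sobolev_iff)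

lemma smooth_fields_sobolev: "v \<in> smooth_fields \<Longrightarrow> v \<in> sobolev p"
  by (simp add: smooth_fields_def)

lemma smooth_fields_finite: "v \<in> smooth_fields \<Longrightarrow> sob_finite p v"
  by (simp add: smooth_fields_iff)

lemma sob_ip_summable_abs:
  assumes "sob_finite p v" "sob_finite p w"
  shows "(\<lambda>k. sob_weight p k * (norm (v k) * norm (w k))) summable_on (- {0})"
proof (rule summable_on_comparison_test)
  show "(\<lambda>k. sob_weight p k * (norm (v k))\<^sup>2 + sob_weight p k * (norm (w k))\<^sup>2) summable_on (- {0})"
    using assms by (intro summable_on_add) (auto simp: sob_finite_def)
next
  fix k
  have "2 * (norm (v k) * norm (w k)) \<le> (norm (v k))\<^sup>2 + (norm (w k))\<^sup>2"
    using sum_squares_bound[of "norm (v k)" "norm (w k)"] by (simp add: mult.assoc)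
  moreover have "0 \<le> norm (v k) * norm (w k)" by simp
  ultimately have "norm (v k) * norm (w k) \<le> (norm (v k))\<^sup>2 + (norm (w k))\<^sup>2" by linarith
  then show "sob_weight p k * (norm (v k) * norm (w k))
      \<le> sob_weight p k * (norm (v k))\<^sup>2 + sob_weight p k * (norm (w k))\<^sup>2"
    by (simp add: distrib_left[symmetric] mult_left_mono)
qed auto

lemma sob_ip_summable:
  assumes "sob_finite p v" "sob_finite p w"
  shows "(\<lambda>k. sob_weight p k * (v k \<bullet> w k)) summable_on (- {0})"
proof (rule abs_summable_summable, rule summable_on_comparison_test)
  show "(\<lambda>k. sob_weight p k * (norm (v k) * norm (w k))) summable_on (- {0})"
    by (rule sob_ip_summable_abs[OF assms])
  show "norm (sob_weight p k * (v k \<bullet> w k)) \<le> sob_weight p k * (norm (v k) * norm (w k))" for k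
    by (simp add: abs_mult mult_left_mono Cauchy_Schwarz_ineq2)
qed auto

lemma bdot_cnj_self: "bdot (\<chi> r. cnj (a $ r)) a = of_real ((norm a)\<^sup>2)"
  unfolding power2_norm_eq_inner
  by (simp add: bdot_def inner_vec_def inner_complex_def complex_eq_iff)

lemma Re_bdot_cnj: "Re (bdot (\<chi> r. cnj (a $ r)) b) = a \<bullet> b"
  by (simp add: bdot_def inner_vec_def inner_complex_def)

lemma norm_bdot_le:
  fixes a b :: "complex ^ 'd::finite"
  shows "norm (bdot a b) \<le> real CARD('d) * (norm a * norm b)"
proof -
  have "norm (bdot a b) \<le> (\<Sum>r\<in>UNIV. norm (a $ r) * norm (b $ r))"
    unfolding bdot_def by (rule order_trans[OF norm_sum]) (simp add: norm_mult)
  also have "\<dots> \<le> (\<Sum>r\<in>(UNIV :: 'd set). norm a * norm b)"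
    by (intro sum_mono mult_mono Finite_Cartesian_Product.norm_nth_le) auto
  finally show ?thesis by simp
qed

lemma Re_sob_inner:
  fixes v w :: "'d::finite field"
  assumes "sob_finite p v" "sob_finite p w"
  shows "Re (sob_inner p v w) = sob_ip p v w"
proof -
  let ?g = "\<lambda>k. of_real (sob_weight p k) * bdot (\<chi> r. cnj (v k $ r)) (w k)"
  have "?g summable_on (- {0})"
  proof (rule abs_summable_summable, rule summable_on_comparison_test)
    show "(\<lambda>k. real CARD('d) * (sob_weight p k * (norm (v k) * norm (w k)))) summable_on (- {0})"
      by (rule summable_on_cmult_right[OF sob_ip_summable_abs[OF assms]])
    fix k
    have n: "norm (\<chi> r. cnj (v k $ r)) = norm (v k)"
      by (simp add: norm_vec_def L2_set_def)
    show "norm (?g k) \<le> real CARD('d) * (sob_weight p k * (norm (v k) * norm (w k)))"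
      using mult_left_mono[OF norm_bdot_le[of "\<chi> r. cnj (v k $ r)" "w k"] sob_weight_nonneg[of p k]]
      by (simp add: norm_mult n mult_ac)
  qed auto
  from infsum_Re[OF this] show ?thesis
    by (simp add: sob_inner_def sob_ip_def sob_weight_def Re_bdot_cnj)
qed

text \<open>No summability is assumed: if the sum diverges, the complex and the real infinite sum
  both have the default value 0.\<close>

lemma sob_norm_sq_sum: "(sob_norm p v)\<^sup>2 = (\<Sum>\<^sub>\<infinity>k\<in>- {0}. sob_weight p k * (norm (v k))\<^sup>2)"
  and sob_norm_nonneg [simp]: "0 \<le> sob_norm p v"
proof -
  let ?g = "\<lambda>k. sob_weight p k * (norm (v k))\<^sup>2"
  have "sob_inner p v v = (\<Sum>\<^sub>\<infinity>k\<in>- {0}. of_real (?g k))"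
    by (simp add: sob_inner_def sob_weight_def bdot_cnj_self)
  also have "\<dots> = of_real (\<Sum>\<^sub>\<infinity>k\<in>- {0}. ?g k)"
  proof (cases "?g summable_on (- {0})")
    case True
    then show ?thesis
      by (intro infsumI) (subst has_sum_of_real_iff, rule has_sum_infsum)
  next
    case False
    then have "\<not> (\<lambda>k. complex_of_real (?g k)) summable_on (- {0})"
      using summable_on_Re by fastforce
    with False show ?thesis by (simp add: infsum_not_exists)
  qed
  finally have "Re (sob_inner p v v) = (\<Sum>\<^sub>\<infinity>k\<in>- {0}. ?g k)" by simp
  moreover have "0 \<le> (\<Sum>\<^sub>\<infinity>k\<in>- {0}. ?g k)" by (intro infsum_nonneg) auto
  ultimately show "(sob_norm p v)\<^sup>2 = (\<Sum>\<^sub>\<infinity>k\<in>- {0}. ?g k)" "0 \<le> sob_norm p v"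
    by (simp_all add: sob_norm_def)
qed

lemma sob_norm_sq: "(sob_norm p v)\<^sup>2 = sob_ip p v v"
  by (simp add: sob_norm_sq_sum sob_ip_def power2_norm_eq_inner)

lemma sob_ip_commute: "sob_ip p v w = sob_ip p w v"
  by (simp add: sob_ip_def inner_commute)

lemma sob_finite_scale: "sob_finite p v \<Longrightarrow> sob_finite p (\<lambda>k. c *\<^sub>R v k)"
  using summable_on_cmult_right[of "\<lambda>k. sob_weight p k * (norm (v k))\<^sup>2" "- {0}" "c\<^sup>2"]
  by (simp add: sob_finite_def power_mult_distrib mult_ac)

lemma sob_finite_mono:
  assumes "sob_finite p w" "\<And>k. k \<noteq> 0 \<Longrightarrow> norm (v k) \<le> norm (w k)"
  shows "sob_finite p v"
  unfolding sob_finite_def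
  by (rule summable_on_comparison_test[OF assms(1)[unfolded sob_finite_def]])
     (auto intro!: mult_left_mono power_mono assms)

lemma sob_finite_add:
  assumes "sob_finite p v" "sob_finite p w"
  shows "sob_finite p (\<lambda>k. v k + w k)"
  unfolding sob_finite_def
proof (rule summable_on_comparison_test)
  show "(\<lambda>k. 2 * (sob_weight p k * (norm (v k))\<^sup>2) + 2 * (sob_weight p k * (norm (w k))\<^sup>2)) summable_on (- {0})"
    using assms by (intro summable_on_add summable_on_cmult_right) (auto simp: sob_finite_def)
  fix k
  have "(norm (v k + w k))\<^sup>2 \<le> (norm (v k) + norm (w k))\<^sup>2"
    by (intro power_mono norm_triangle_ineq) auto
  also have "\<dots> \<le> 2 * (norm (v k))\<^sup>2 + 2 * (norm (w k))\<^sup>2"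
    using sum_squares_bound[of "norm (v k)" "norm (w k)"] by (simp add: power2_sum)
  finally show "sob_weight p k * (norm (v k + w k))\<^sup>2
      \<le> 2 * (sob_weight p k * (norm (v k))\<^sup>2) + 2 * (sob_weight p k * (norm (w k))\<^sup>2)"
    using mult_left_mono[of _ _ "sob_weight p k"] by (fastforce simp: algebra_simps)
qed auto

lemma sob_finite_minus: "sob_finite p v \<Longrightarrow> sob_finite p (\<lambda>k. - v k)"
  by (simp add: sob_finite_def)

lemma sob_finite_0 [simp]: "sob_finite p (\<lambda>k. 0)"
  by (simp add: sob_finite_def)

lemma sob_ip_add_left:
  assumes "sob_finite p v" "sob_finite p w" "sob_finite p z"
  shows "sob_ip p (\<lambda>k. v k + w k) z = sob_ip p v z + sob_ip p w z"
  unfolding sob_ip_def inner_add_left distrib_left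
  by (intro infsum_add sob_ip_summable assms)

lemma sob_ip_scale_left: "sob_ip p (\<lambda>k. c *\<^sub>R v k) z = c * sob_ip p v z"
  by (simp add: sob_ip_def infsum_cmult_right'[symmetric] mult_ac)

lemma sob_ip_add_right:
  assumes "sob_finite p v" "sob_finite p w" "sob_finite p z"
  shows "sob_ip p z (\<lambda>k. v k + w k) = sob_ip p z v + sob_ip p z w"
  using sob_ip_add_left[OF assms] by (simp add: sob_ip_commute)

lemma sob_ip_scale_right: "sob_ip p z (\<lambda>k. c *\<^sub>R v k) = c * sob_ip p z v"
  by (metis sob_ip_commute sob_ip_scale_left)

lemma sob_ip_minus_left: "sob_ip p (\<lambda>k. - v k) z = - sob_ip p v z"
  using sob_ip_scale_left[of p "-1" v z] by simp

lemma sob_norm_add_scale_sq: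
  assumes "sob_finite p v" "sob_finite p w"
  shows "(sob_norm p (\<lambda>k. v k + h *\<^sub>R w k))\<^sup>2
       = (sob_norm p v)\<^sup>2 + 2 * h * sob_ip p w v + h\<^sup>2 * (sob_norm p w)\<^sup>2"
proof -
  note f = assms sob_finite_scale[OF assms(2), of h]
    sob_finite_add[OF assms(1) sob_finite_scale[OF assms(2), of h]]
  show ?thesis
    unfolding sob_norm_sq
    by (simp add: sob_ip_add_left sob_ip_add_right f sob_ip_scale_left sob_ip_scale_right
        sob_ip_commute[of p v w] power2_eq_square algebra_simps)
qed

text \<open>Cauchy-Schwarz, from the sign of the quadratic polynomial in \<open>h\<close> given by
  the squared norm of \<open>w + h v\<close>.\<close>

lemma sob_ip_le:
  assumes "sob_finite p v" "sob_finite p w"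
  shows "\<bar>sob_ip p v w\<bar> \<le> sob_norm p v * sob_norm p w"
proof -
  let ?a = "(sob_norm p w)\<^sup>2" and ?b = "sob_ip p v w" and ?c = "(sob_norm p v)\<^sup>2"
  have q: "0 \<le> ?a + 2 * h * ?b + h\<^sup>2 * ?c" for h
    using sob_norm_add_scale_sq[OF assms(2,1), of h] by (metis zero_le_power2)
  have "?b\<^sup>2 \<le> ?a * ?c"
  proof (cases "?c = 0")
    case True
    have "?b = 0"
    proof (rule ccontr)
      assume "?b \<noteq> 0"
      \<comment> \<open>If the quadratic coefficient vanishes, this \<open>h\<close> makes the
        remaining affine function equal to -1.\<close>
      with True q[of "- (?a + 1) / (2 * ?b)"] show False by (simp add: field_simps)
    qed
    with True show ?thesis by simp
  next
    case False
    then have "?c > 0" by simp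
    have "?a + 2 * (- ?b / c) * ?b + (- ?b / c)\<^sup>2 * c = ?a - ?b\<^sup>2 / c" if "c \<noteq> 0" for c
      using that by (simp add: power2_eq_square field_simps)
    from this[OF False] q[of "- ?b / ?c"] have "0 \<le> ?a - ?b\<^sup>2 / ?c" by simp
    with \<open>?c > 0\<close> show ?thesis by (simp add: field_simps)
  qed
  also have "\<dots> = (sob_norm p v * sob_norm p w)\<^sup>2" by (simp add: power_mult_distrib)
  finally show ?thesis
    by (metis abs_le_square_iff abs_of_nonneg mult_nonneg_nonneg sob_norm_nonneg)
qed

lemma sob_norm_scale: "sob_norm p (\<lambda>k. c *\<^sub>R v k) = \<bar>c\<bar> * sob_norm p v"
proof -
  have "(sob_norm p (\<lambda>k. c *\<^sub>R v k))\<^sup>2 = (\<bar>c\<bar> * sob_norm p v)\<^sup>2"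
    by (simp add: sob_norm_sq sob_ip_scale_left sob_ip_scale_right power_mult_distrib
        flip: power2_eq_square mult.assoc)
  then show ?thesis
    by (metis abs_ge_zero abs_of_nonneg mult_nonneg_nonneg power2_eq_iff_nonneg sob_norm_nonneg)
qed

lemma sob_norm_minus: "sob_norm p (\<lambda>k. - v k) = sob_norm p v"
  using sob_norm_scale[of p "-1" v] by simp

lemma sob_norm_minus_commute: "sob_norm p (\<lambda>k. v k - w k) = sob_norm p (\<lambda>k. w k - v k)"
  using sob_norm_minus[of p "\<lambda>k. v k - w k"] by simp

lemma sob_norm_triangle:
  assumes "sob_finite p v" "sob_finite p w"
  shows "sob_norm p (\<lambda>k. v k + w k) \<le> sob_norm p v + sob_norm p w"
proof (rule power2_le_imp_le)
  have "(sob_norm p (\<lambda>k. v k + w k))\<^sup>2 = (sob_norm p v)\<^sup>2 + 2 * sob_ip p w v + (sob_norm p w)\<^sup>2"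
    using sob_norm_add_scale_sq[OF assms, of 1] by simp
  also have "\<dots> \<le> (sob_norm p v + sob_norm p w)\<^sup>2"
    using sob_ip_le[OF assms(2,1)] by (simp add: power2_sum algebra_simps)
  finally show "(sob_norm p (\<lambda>k. v k + w k))\<^sup>2 \<le> (sob_norm p v + sob_norm p w)\<^sup>2" .
qed simp

lemma sob_norm_0 [simp]: "sob_norm p (\<lambda>k. 0) = 0"
  by (simp add: sob_norm_def sob_inner_def bdot_def)

lemma sob_weight_mono: "k \<noteq> 0 \<Longrightarrow> q \<le> p \<Longrightarrow> sob_weight q k \<le> sob_weight p k"
  using norm_wave_ge_1[of k] by (simp add: sob_weight_def powr_mono)

lemma sob_finite_order_mono:
  assumes "sob_finite p v" "q \<le> p"
  shows "sob_finite q v"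
  unfolding sob_finite_def
  by (rule summable_on_comparison_test[OF assms(1)[unfolded sob_finite_def]])
     (auto intro!: mult_right_mono sob_weight_mono assms)

lemma sob_norm_mono:
  assumes "sob_finite p w" "\<And>k. k \<noteq> 0 \<Longrightarrow> norm (v k) \<le> norm (w k)"
  shows "sob_norm p v \<le> sob_norm p w"
proof (rule power2_le_imp_le)
  show "(sob_norm p v)\<^sup>2 \<le> (sob_norm p w)\<^sup>2"
    unfolding sob_norm_sq_sum
    using sob_finite_mono[OF assms] assms(1)
    by (intro infsum_mono mult_left_mono power_mono) (auto simp: sob_finite_def assms)
qed simp

lemma sob_norm_order_mono:
  assumes "sob_finite p v" "q \<le> p"
  shows "sob_norm q v \<le> sob_norm p v"
proof (rule power2_le_imp_le)
  show "(sob_norm q v)\<^sup>2 \<le> (sob_norm p v)\<^sup>2"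
    unfolding sob_norm_sq_sum
    using sob_finite_order_mono[OF assms] assms(1)
    by (intro infsum_mono mult_right_mono sob_weight_mono assms) (auto simp: sob_finite_def)
qed simp

lemma sob_coeff_le:
  assumes "sob_finite p v" "k \<noteq> 0"
  shows "norm (wave k) powr p * norm (v k) \<le> sob_norm p v"
proof (rule power2_le_imp_le)
  have "(norm (wave k) powr p * norm (v k))\<^sup>2 = sob_weight p k * (norm (v k))\<^sup>2"
    unfolding sob_weight_def mult_2 powr_add by (simp add: power2_eq_square mult_ac)
  also have "\<dots> = (\<Sum>j\<in>{k}. sob_weight p j * (norm (v j))\<^sup>2)" by simp
  also have "\<dots> \<le> (\<Sum>\<^sub>\<infinity>k\<in>- {0}. sob_weight p k * (norm (v k))\<^sup>2)"
    using assms by (intro finite_sum_le_infsum) (auto simp: sob_finite_def)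
  finally show "(norm (wave k) powr p * norm (v k))\<^sup>2 \<le> (sob_norm p v)\<^sup>2"
    by (simp add: sob_norm_sq_sum)
qed simp

lemma sob_coeff_le_norm:
  assumes "sob_finite p v" "0 \<le> p" "k \<noteq> 0"
  shows "norm (v k) \<le> sob_norm p v"
proof -
  have "1 * norm (v k) \<le> norm (wave k) powr p * norm (v k)"
    using norm_wave_ge_1[OF assms(3)] assms(2) by (intro mult_right_mono ge_one_powr_ge_zero) auto
  with sob_coeff_le[OF assms(1,3)] show ?thesis by simp
qed

lemma sob_norm_eq_0D:
  assumes "sob_finite p v" "sob_norm p v = 0" "k \<noteq> 0"
  shows "v k = 0"
proof -
  have "norm (wave k) powr p * norm (v k) \<le> 0" using sob_coeff_le[OF assms(1,3)] assms(2) by simp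
  moreover have "0 < norm (wave k) powr p" using norm_wave_ge_1[OF assms(3)] by auto
  ultimately show ?thesis by (simp add: mult_le_0_iff)
qed

lemma solenoidal_add: "solenoidal v \<Longrightarrow> solenoidal w \<Longrightarrow> solenoidal (\<lambda>k. v k + w k)"
  by (simp add: solenoidal_def bdot_def distrib_left sum.distrib)

lemma solenoidal_scale: "solenoidal v \<Longrightarrow> solenoidal (\<lambda>k. c *\<^sub>R v k)"
  by (auto simp: solenoidal_def bdot_def simp flip: scaleR_sum_right)

lemma smooth_fields_add [intro]:
  "v \<in> smooth_fields \<Longrightarrow> w \<in> smooth_fields \<Longrightarrow> (\<lambda>k. v k + w k) \<in> smooth_fields"
  by (simp add: smooth_fields_iff solenoidal_add sob_finite_add)

lemma smooth_fields_scale [intro]: "v \<in> smooth_fields \<Longrightarrow> (\<lambda>k. c *\<^sub>R v k) \<in> smooth_fields"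
  by (simp add: smooth_fields_iff solenoidal_scale sob_finite_scale)

lemma smooth_fields_minus [intro]: "v \<in> smooth_fields \<Longrightarrow> (\<lambda>k. - v k) \<in> smooth_fields"
  using smooth_fields_scale[of v "-1"] by simp

lemma smooth_fields_diff [intro]:
  "v \<in> smooth_fields \<Longrightarrow> w \<in> smooth_fields \<Longrightarrow> (\<lambda>k. v k - w k) \<in> smooth_fields"
  using smooth_fields_add[of v "\<lambda>k. - w k"] by auto

lemma smooth_fields_0 [simp]: "(\<lambda>k. 0) \<in> smooth_fields"
  by (simp add: smooth_fields_iff solenoidal_def bdot_def)

lemma smooth_fields_at_0: "v \<in> smooth_fields \<Longrightarrow> v 0 = 0"
  by (simp add: smooth_fields_iff solenoidal_def)

lemma smooth_fields_eqI:
  assumes "v \<in> smooth_fields" "w \<in> smooth_fields" "sob_norm p (\<lambda>k. v k - w k) = 0"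
  shows "v = w"
proof
  fix k
  show "v k = w k"
    using sob_norm_eq_0D[OF smooth_fields_finite[OF smooth_fields_diff[OF assms(1,2)]] assms(3), of k]
      assms(1,2) by (cases "k = 0") (auto simp: smooth_fields_at_0)
qed

section \<open>Lattice sums, and norms from decay of the coefficients\<close>

lemma sum_inverse_squares_int_bounded:
  obtains C :: real where "0 < C" "\<And>F :: int set. finite F \<Longrightarrow> (\<Sum>j\<in>F. 1 / (1 + (of_int j)\<^sup>2)) \<le> C"
proof
  define s where "s = (\<Sum>n. inverse (real (Suc n) ^ 2))"
  have sm: "summable (\<lambda>n. inverse (real (Suc n) ^ 2))"
    using summable_Suc_iff[of "\<lambda>n. inverse (real n ^ 2)"] inverse_power_summable[of 2, where ?'a = real]
    by simp
  have s0: "0 \<le> s" unfolding s_def by (intro suminf_nonneg sm) auto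
  show "0 < 4 * s + 1" using s0 by simp
  fix F :: "int set" assume "finite F"
  obtain m :: nat where m: "F \<subseteq> {- int m..int m}"
  proof
    show "F \<subseteq> {- int (nat (\<Sum>j\<in>F. \<bar>j\<bar>))..int (nat (\<Sum>j\<in>F. \<bar>j\<bar>))}"
    proof
      fix j assume "j \<in> F"
      then have "\<bar>j\<bar> \<le> (\<Sum>j\<in>F. \<bar>j\<bar>)" using \<open>finite F\<close> by (intro member_le_sum) auto
      then show "j \<in> {- int (nat (\<Sum>j\<in>F. \<bar>j\<bar>))..int (nat (\<Sum>j\<in>F. \<bar>j\<bar>))}" by auto
    qed
  qed
  have le: "1 / (1 + (real i)\<^sup>2) \<le> 2 * inverse (real (Suc i) ^ 2)" for i
  proof -
    have "(real (Suc i))\<^sup>2 \<le> 2 * (1 + (real i)\<^sup>2)"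
      using sum_squares_bound[of "real i" 1] by (simp add: power2_eq_square algebra_simps)
    then show ?thesis by (simp add: field_simps add_pos_nonneg)
  qed
  have "(\<Sum>j\<in>F. 1 / (1 + (of_int j)\<^sup>2)) \<le> (\<Sum>j\<in>int ` {..m} \<union> (\<lambda>i. - int i) ` {..m}. 1 / (1 + (real_of_int j)\<^sup>2))"
  proof (intro sum_mono2)
    show "F \<subseteq> int ` {..m} \<union> (\<lambda>i. - int i) ` {..m}"
    proof
      fix j assume "j \<in> F"
      then have "- int m \<le> j" "j \<le> int m" using m by auto
      then show "j \<in> int ` {..m} \<union> (\<lambda>i. - int i) ` {..m}"
        by (cases j rule: int_cases2) auto
    qed
  qed auto
  also have "\<dots> \<le> (\<Sum>j\<in>int ` {..m}. 1 / (1 + (real_of_int j)\<^sup>2)) + (\<Sum>j\<in>(\<lambda>i. - int i) ` {..m}. 1 / (1 + (real_of_int j)\<^sup>2))"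
    by (subst sum_Un) (auto intro: sum_nonneg)
  also have "\<dots> = 2 * (\<Sum>i\<le>m. 1 / (1 + (real i)\<^sup>2))"
    by (simp add: sum.reindex inj_on_def)
  also have "\<dots> \<le> 2 * (\<Sum>i\<le>m. 2 * inverse (real (Suc i) ^ 2))"
    by (intro mult_left_mono sum_mono le) auto
  also have "\<dots> = 4 * (\<Sum>i\<le>m. inverse (real (Suc i) ^ 2))"
    by (simp add: sum_distrib_left)
  also have "\<dots> \<le> 4 * s"
    unfolding s_def using sum_le_suminf[OF sm, of "{..m}"] by simp
  finally show "(\<Sum>j\<in>F. 1 / (1 + (of_int j)\<^sup>2)) \<le> 4 * s + 1" by simp
qed

text \<open>Since \<open>\<bar>k $ r\<bar> \<le> norm (wave k)\<close> for each coordinate, the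
  summand is dominated by a product of one-dimensional ones. A finite index set lies in the product
  of its coordinate projections, over which the sum of products factorises.\<close>

lemma lattice_summable:
  "(\<lambda>k :: int ^ 'd::finite. 1 / (1 + (norm (wave k))\<^sup>2) ^ CARD('d)) summable_on UNIV"
proof (rule nonneg_bdd_above_summable_on)
  obtain C :: real where C: "0 < C" "\<And>F :: int set. finite F \<Longrightarrow> (\<Sum>j\<in>F. 1 / (1 + (of_int j)\<^sup>2)) \<le> C"
    using sum_inverse_squares_int_bounded by blast
  show "bdd_above (sum (\<lambda>k :: int ^ 'd. 1 / (1 + (norm (wave k))\<^sup>2) ^ CARD('d)) ` {F. F \<subseteq> UNIV \<and> finite F})"
  proof (rule bdd_aboveI2)
    fix F :: "(int ^ 'd) set" assume "F \<in> {F. F \<subseteq> UNIV \<and> finite F}"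
    then have F: "finite F" by simp
    define A where "A = (\<lambda>r. (\<lambda>k. k $ r) ` F)"
    have le: "1 / (1 + (norm (wave k))\<^sup>2) ^ CARD('d) \<le> (\<Prod>r\<in>UNIV. 1 / (1 + (of_int (k $ r))\<^sup>2))"
      for k :: "int ^ 'd"
    proof -
      have "(\<Prod>r\<in>UNIV. (1 + (real_of_int (k $ r))\<^sup>2)) \<le> (\<Prod>r\<in>(UNIV::'d set). (1 + (norm (wave k))\<^sup>2))"
      proof (intro prod_mono conjI)
        fix r
        have "\<bar>wave k $ r\<bar> \<le> norm (wave k)" by (rule component_le_norm_cart)
        then have "\<bar>real_of_int (k $ r)\<bar> \<le> norm (wave k)" by (simp add: wave_def)
        then show "1 + (real_of_int (k $ r))\<^sup>2 \<le> 1 + (norm (wave k))\<^sup>2"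
          using abs_le_square_iff[of "real_of_int (k $ r)" "norm (wave k)"] by simp
      qed auto
      then have "(\<Prod>r\<in>UNIV. (1 + (real_of_int (k $ r))\<^sup>2)) \<le> (1 + (norm (wave k))\<^sup>2) ^ CARD('d)" by simp
      moreover have "0 < (\<Prod>r\<in>UNIV. (1 + (real_of_int (k $ r))\<^sup>2))"
        by (intro prod_pos) (auto intro: add_pos_nonneg)
      ultimately show ?thesis
        by (simp add: prod_dividef frac_le)
    qed
    have "(\<Sum>k\<in>F. 1 / (1 + (norm (wave k))\<^sup>2) ^ CARD('d))
        \<le> (\<Sum>k\<in>F. \<Prod>r\<in>UNIV. 1 / (1 + (of_int (k $ r))\<^sup>2))"
      by (intro sum_mono le)
    also have "\<dots> = (\<Sum>g\<in>vec_nth ` F. \<Prod>r\<in>UNIV. 1 / (1 + (of_int (g r))\<^sup>2))"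
      by (subst sum.reindex) (auto simp: inj_on_def vec_nth_inject)
    also have "\<dots> \<le> (\<Sum>g\<in>PiE UNIV A. \<Prod>r\<in>UNIV. 1 / (1 + (of_int (g r))\<^sup>2))"
      using F by (intro sum_mono2 finite_PiE prod_nonneg) (auto simp: A_def)
    also have "\<dots> = (\<Prod>r\<in>UNIV. \<Sum>j\<in>A r. 1 / (1 + (of_int j)\<^sup>2))"
      using F by (subst prod_sum_PiE) (auto simp: A_def)
    also have "\<dots> \<le> (\<Prod>r\<in>(UNIV::'d set). C)"
      using F by (intro prod_mono conjI sum_nonneg C(2)) (auto simp: A_def)
    finally show "(\<Sum>k\<in>F. 1 / (1 + (norm (wave k))\<^sup>2) ^ CARD('d)) \<le> C ^ CARD('d)" by simp
  qed
qed auto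

definition lattice_const :: "'d::finite itself \<Rightarrow> real" where
  "lattice_const _ = sqrt (\<Sum>\<^sub>\<infinity>k::int ^ 'd\<in>- {0}. 1 / (norm (wave k)) ^ (2 * CARD('d)))"

lemma lattice_summable':
  "(\<lambda>k :: int ^ 'd::finite. 1 / (norm (wave k)) ^ (2 * CARD('d))) summable_on (- {0})"
proof (rule summable_on_comparison_test)
  show "(\<lambda>k :: int ^ 'd::finite. 2 ^ CARD('d) * (1 / (1 + (norm (wave k))\<^sup>2) ^ CARD('d))) summable_on (- {0})"
    using summable_on_subset_banach[OF lattice_summable] by (intro summable_on_cmult_right) auto
  fix k :: "int ^ 'd" assume "k \<in> - {0}"
  then have k: "1 \<le> norm (wave k)" using norm_wave_ge_1 by auto
  then have "1 \<le> (norm (wave k))\<^sup>2" by simp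
  then have "(1 + (norm (wave k))\<^sup>2) ^ CARD('d) \<le> (2 * (norm (wave k))\<^sup>2) ^ CARD('d)"
    by (intro power_mono) auto
  then have "(1 + (norm (wave k))\<^sup>2) ^ CARD('d) \<le> 2 ^ CARD('d) * norm (wave k) ^ (2 * CARD('d))"
    by (simp add: power_mult_distrib power_mult)
  moreover have "0 < norm (wave k) ^ (2 * CARD('d))" "0 < (1 + (norm (wave k))\<^sup>2) ^ CARD('d)"
    using k by (auto intro!: zero_less_power add_pos_nonneg)
  ultimately show "1 / norm (wave k) ^ (2 * CARD('d)) \<le> 2 ^ CARD('d) * (1 / (1 + (norm (wave k))\<^sup>2) ^ CARD('d))"
    by (simp add: field_simps)
qed auto

text \<open>The surplus of \<open>CARD('d)\<close> powers bounds the terms of the squared norm by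
  multiples of \<open>1 / norm (wave k) ^ (2 * CARD('d))\<close>, which is summable. Passing from
  coefficients to norms costs \<open>CARD('d)\<close> orders, a harmless loss when all orders are
  controlled.\<close>

lemma decay_imp_sob_finite:
  fixes v :: "'d::finite field" and p :: real
  assumes "\<And>k. k \<noteq> 0 \<Longrightarrow> norm (wave k) powr (p + CARD('d)) * norm (v k) \<le> C" "0 \<le> C"
  shows "sob_finite p v" and "sob_norm p v \<le> C * lattice_const TYPE('d)"
proof -
  have le: "sob_weight p k * (norm (v k))\<^sup>2 \<le> C\<^sup>2 * (1 / norm (wave k) ^ (2 * CARD('d)))" if "k \<noteq> 0" for k
  proof -
    have k: "0 < norm (wave k)" using norm_wave_ge_1[OF that] by linarith
    have "(norm (wave k) powr (p + CARD('d)) * norm (v k))\<^sup>2 \<le> C\<^sup>2"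
      using assms that by (intro power_mono) auto
    moreover have "(norm (wave k) powr (p + CARD('d)) * norm (v k))\<^sup>2
        = norm (wave k) ^ (2 * CARD('d)) * (sob_weight p k * (norm (v k))\<^sup>2)"
    proof -
      have "norm (wave k) powr (p + CARD('d)) = norm (wave k) powr p * norm (wave k) ^ CARD('d)"
        using k by (simp add: powr_add powr_realpow)
      moreover have "sob_weight p k = norm (wave k) powr p * norm (wave k) powr p"
        unfolding sob_weight_def mult_2 powr_add ..
      ultimately show ?thesis
        by (simp only: power_mult_distrib power_mult power2_eq_square mult_ac)
    qed
    ultimately have "norm (wave k) ^ (2 * CARD('d)) * (sob_weight p k * (norm (v k))\<^sup>2) \<le> C\<^sup>2" by simp
    moreover have "0 < norm (wave k) ^ (2 * CARD('d))" using k by simp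
    ultimately show ?thesis by (simp add: pos_le_divide_eq mult.commute)
  qed
  have sm: "(\<lambda>k::int ^ 'd. C\<^sup>2 * (1 / norm (wave k) ^ (2 * CARD('d)))) summable_on (- {0})"
    by (intro summable_on_cmult_right lattice_summable')
  show fin: "sob_finite p v"
    unfolding sob_finite_def using sm by (rule summable_on_comparison_test) (use le in auto)
  show "sob_norm p v \<le> C * lattice_const TYPE('d)"
  proof (rule power2_le_imp_le)
    have "(sob_norm p v)\<^sup>2 \<le> (\<Sum>\<^sub>\<infinity>k::int ^ 'd\<in>- {0}. C\<^sup>2 * (1 / norm (wave k) ^ (2 * CARD('d))))"
      unfolding sob_norm_sq_sum using fin sm by (intro infsum_mono) (use le in \<open>auto simp: sob_finite_def\<close>)
    also have "\<dots> = C\<^sup>2 * (\<Sum>\<^sub>\<infinity>k::int ^ 'd\<in>- {0}. 1 / norm (wave k) ^ (2 * CARD('d)))"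
      by (intro infsum_cmult_right lattice_summable')
    also have "\<dots> = (C * lattice_const TYPE('d))\<^sup>2"
      by (simp add: power_mult_distrib lattice_const_def infsum_nonneg)
    finally show "(sob_norm p v)\<^sup>2 \<le> (C * lattice_const TYPE('d))\<^sup>2" .
  qed (simp add: assms(2) lattice_const_def infsum_nonneg)
qed

lemma finite_lattice_ball: "finite {k :: int ^ 'd::finite. norm (wave k) \<le> N}"
proof -
  have "{k :: int ^ 'd. norm (wave k) \<le> N} \<subseteq> vec_lambda ` (PiE UNIV (\<lambda>_. {- \<lceil>N\<rceil>..\<lceil>N\<rceil>}))"
  proof
    fix k :: "int ^ 'd" assume "k \<in> {k. norm (wave k) \<le> N}"
    then have k: "norm (wave k) \<le> N" by simp
    have "k $ r \<in> {- \<lceil>N\<rceil>..\<lceil>N\<rceil>}" for r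
    proof -
      have "\<bar>wave k $ r\<bar> \<le> norm (wave k)" by (rule component_le_norm_cart)
      then have "\<bar>real_of_int (k $ r)\<bar> \<le> N" using k by (simp add: wave_def)
      then show ?thesis by (auto; linarith)
    qed
    then have "vec_nth k \<in> PiE UNIV (\<lambda>_. {- \<lceil>N\<rceil>..\<lceil>N\<rceil>})" by auto
    then show "k \<in> vec_lambda ` (PiE UNIV (\<lambda>_. {- \<lceil>N\<rceil>..\<lceil>N\<rceil>}))"
      by (metis image_eqI vec_nth_inverse)
  qed
  then show ?thesis by (rule finite_subset) (auto intro!: finite_PiE)
qed

subsection \<open>The Laplacian\<close>

lemma laplacian_eq: "laplacian v k = (- ((norm (wave k))\<^sup>2)) *\<^sub>R v k"
proof -
  have "laplacian v k = (\<Sum>s\<in>UNIV. (- ((real_of_int (k $ s))\<^sup>2)) *\<^sub>R v k)"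
    unfolding laplacian_def dpartial_def
    by (intro sum.cong) (auto simp: vec_eq_iff complex_eq_iff power2_eq_square)
  also have "\<dots> = (\<Sum>s\<in>UNIV. (- ((real_of_int (k $ s))\<^sup>2))) *\<^sub>R v k"
    by (simp add: scaleR_sum_left)
  also have "(\<Sum>s\<in>UNIV. (- ((real_of_int (k $ s))\<^sup>2))) = - (wave k \<bullet> wave k)"
    by (simp add: sum_negf wave_def inner_vec_def power2_eq_square)
  also have "\<dots> = - ((norm (wave k))\<^sup>2)" by (simp add: power2_norm_eq_inner)
  finally show ?thesis .
qed

lemma sob_weight_add1: "k \<noteq> 0 \<Longrightarrow> sob_weight p k * (norm (wave k))\<^sup>2 = sob_weight (p + 1) k"
  using norm_wave_ge_1[of k]
  by (simp add: sob_weight_def distrib_left powr_add flip: powr_numeral)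

lemma sob_weight_add2: "k \<noteq> 0 \<Longrightarrow> sob_weight p k * (norm (wave k))\<^sup>2 * (norm (wave k))\<^sup>2 = sob_weight (p + 2) k"
  using sob_weight_add1[of k p] sob_weight_add1[of k "p + 1"] by (simp add: add.assoc)

lemma sob_finite_laplacian: "sob_finite (p + 2) v \<Longrightarrow> sob_finite p (laplacian v)"
  unfolding sob_finite_def
  by (erule summable_on_cong[THEN iffD1, rotated])
     (simp add: laplacian_eq power_mult_distrib power2_eq_square[of "(norm (wave _))\<^sup>2"] flip: sob_weight_add2)

lemma sob_norm_laplacian: "sob_norm p (laplacian v) = sob_norm (p + 2) v"
proof -
  have "(sob_norm p (laplacian v))\<^sup>2 = (sob_norm (p + 2) v)\<^sup>2"
    unfolding sob_norm_sq_sum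
    by (rule infsum_cong)
       (simp add: laplacian_eq power_mult_distrib power2_eq_square[of "(norm (wave _))\<^sup>2"] flip: sob_weight_add2)
  then show ?thesis by (simp add: power2_eq_iff_nonneg)
qed

lemma sob_ip_laplacian: "sob_ip p (laplacian v) v = - (sob_norm (p + 1) v)\<^sup>2"
  unfolding sob_norm_sq sob_ip_def infsum_uminus[symmetric]
  by (rule infsum_cong) (simp add: laplacian_eq flip: sob_weight_add1)

lemma smooth_fields_laplacian:
  assumes "v \<in> smooth_fields"
  shows "laplacian v \<in> smooth_fields"
proof -
  have "bdot a (c *\<^sub>R b) = c *\<^sub>R bdot a b" for a b :: "complex ^ 'a" and c :: real
    by (simp add: bdot_def scaleR_sum_right)
  moreover have "bdot a (- b) = - bdot a b" for a b :: "complex ^ 'a"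
    by (simp add: bdot_def sum_negf)
  ultimately show ?thesis using assms
     by (auto simp: smooth_fields_iff solenoidal_def laplacian_eq sob_finite_laplacian)
qed

subsection \<open>Convergence in the Frechet topology\<close>

lemma topspace_frechet [simp]: "topspace frechet = smooth_fields"
proof -
  have "v \<in> {w \<in> smooth_fields. sob_norm 0 (\<lambda>k. w k - v k) < 1}" if "v \<in> smooth_fields" for v :: "'d::finite field"
    using that by simp
  then show ?thesis
    unfolding frechet_def topology_generated_by_topspace by (blast intro: zero_less_one)
qed

text \<open>The subbasic balls have arbitrary centres, but by the triangle inequality each one that
  contains \<open>l\<close> contains a ball about \<open>l\<close> of the same order. Induction over
  the generated topology extends this to all open sets.\<close>

lemma limitin_frechet_iff:
  fixes l :: "'d::finite field"
  shows "limitin frechet X l F \<longleftrightarrow> l \<in> smooth_fields \<and> (\<forall>\<^sub>F x in F. X x \<in> smooth_fields) \<and>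
     (\<forall>p. ((\<lambda>x. sob_norm p (\<lambda>k. X x k - l k)) \<longlongrightarrow> 0) F)"
    (is "?L \<longleftrightarrow> ?R")
proof
  assume L: ?L
  then have l: "l \<in> smooth_fields" by (auto simp: limitin_def)
  have "\<forall>\<^sub>F x in F. X x \<in> smooth_fields"
    using L by (metis limitin_def openin_topspace topspace_frechet)
  moreover have "((\<lambda>x. sob_norm p (\<lambda>k. X x k - l k)) \<longlongrightarrow> 0) F" for p
  proof (rule tendstoI)
    fix e :: real assume e: "0 < e"
    have "openin frechet {w \<in> smooth_fields. sob_norm p (\<lambda>k. w k - l k) < e}"
      unfolding frechet_def openin_topology_generated_by_iff
      by (rule generate_topology_on.Basis) (use l e in blast)
    moreover have "l \<in> {w \<in> smooth_fields. sob_norm p (\<lambda>k. w k - l k) < e}" using l e by simp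
    ultimately have "\<forall>\<^sub>F x in F. X x \<in> {w \<in> smooth_fields. sob_norm p (\<lambda>k. w k - l k) < e}"
      using L unfolding limitin_def by blast
    then show "\<forall>\<^sub>F x in F. dist (sob_norm p (\<lambda>k. X x k - l k)) 0 < e"
      by (auto elim: eventually_mono)
  qed
  ultimately show ?R using l by blast
next
  assume R: ?R
  then have l: "l \<in> smooth_fields" and X: "\<forall>\<^sub>F x in F. X x \<in> smooth_fields" by auto
  show ?L
    unfolding limitin_def
  proof (intro conjI allI impI)
    show "l \<in> topspace frechet" using l by simp
    fix U assume U: "openin frechet U \<and> l \<in> U"
    then have "generate_topology_on {{w \<in> smooth_fields. sob_norm p (\<lambda>k. w k - v k) < r} | p v r. v \<in> smooth_fields \<and> 0 < r} U"
      by (simp add: frechet_def openin_topology_generated_by_iff)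
    then have "l \<in> U \<longrightarrow> (\<forall>\<^sub>F x in F. X x \<in> U)"
    proof induction
      case (Int a b)
      then show ?case by (auto intro: eventually_conj)
    next
      case (UN K)
      show ?case
      proof
        assume "l \<in> \<Union> K"
        then obtain k where "k \<in> K" "l \<in> k" by blast
        with UN have "\<forall>\<^sub>F x in F. X x \<in> k" by blast
        then show "\<forall>\<^sub>F x in F. X x \<in> \<Union> K" using \<open>k \<in> K\<close> by (auto elim: eventually_mono)
      qed
    next
      case (Basis s)
      then obtain p v r where s: "s = {w \<in> smooth_fields. sob_norm p (\<lambda>k. w k - v k) < r}"
        and v: "v \<in> smooth_fields" by blast
      show ?case
      proof
        assume "l \<in> s"
        then have "0 < r - sob_norm p (\<lambda>k. l k - v k)" using s by simp
        with R have "\<forall>\<^sub>F x in F. sob_norm p (\<lambda>k. X x k - l k) < r - sob_norm p (\<lambda>k. l k - v k)"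
          by (intro order_tendstoD(2)[where y = 0]) auto
        with X show "\<forall>\<^sub>F x in F. X x \<in> s"
        proof eventually_elim
          case (elim x)
          have "sob_norm p (\<lambda>k. (X x k - l k) + (l k - v k))
              \<le> sob_norm p (\<lambda>k. X x k - l k) + sob_norm p (\<lambda>k. l k - v k)"
            using elim l v by (intro sob_norm_triangle smooth_fields_finite) auto
          with elim show ?case by (simp add: s)
        qed
      qed
    qed simp
    with U show "\<forall>\<^sub>F x in F. X x \<in> U" by blast
  qed
qed

lemma limitin_frechet_const: "l \<in> smooth_fields \<Longrightarrow> limitin frechet (\<lambda>_. l) l F"
  by (simp add: limitin_frechet_iff)

lemma limitin_frechet_add:
  assumes "limitin frechet X l F" "limitin frechet Y m F"
  shows "limitin frechet (\<lambda>x k. X x k + Y x k) (\<lambda>k. l k + m k) F"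
  unfolding limitin_frechet_iff
proof (intro conjI allI)
  note a = assms[unfolded limitin_frechet_iff]
  show "(\<lambda>k. l k + m k) \<in> smooth_fields" using a by auto
  show "\<forall>\<^sub>F x in F. (\<lambda>k. X x k + Y x k) \<in> smooth_fields"
    using a by (auto elim: eventually_elim2)
  fix p
  have "((\<lambda>x. sob_norm p (\<lambda>k. X x k - l k) + sob_norm p (\<lambda>k. Y x k - m k)) \<longlongrightarrow> 0 + 0) F"
    using a by (intro tendsto_add) auto
  then have z: "((\<lambda>x. sob_norm p (\<lambda>k. X x k - l k) + sob_norm p (\<lambda>k. Y x k - m k)) \<longlongrightarrow> 0) F" by simp
  have "\<forall>\<^sub>F x in F. sob_norm p (\<lambda>k. (X x k + Y x k) - (l k + m k))
      \<le> sob_norm p (\<lambda>k. X x k - l k) + sob_norm p (\<lambda>k. Y x k - m k)"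
    using a[THEN conjunct2, THEN conjunct1]
  proof eventually_elim
    case (elim x)
    have "sob_norm p (\<lambda>k. (X x k - l k) + (Y x k - m k))
      \<le> sob_norm p (\<lambda>k. X x k - l k) + sob_norm p (\<lambda>k. Y x k - m k)"
      using elim a by (intro sob_norm_triangle smooth_fields_finite) auto
    then show ?case by (simp add: algebra_simps)
  qed
  then show "((\<lambda>x. sob_norm p (\<lambda>k. (X x k + Y x k) - (l k + m k))) \<longlongrightarrow> 0) F"
    by (intro tendsto_sandwich[OF _ _ tendsto_const z]) auto
qed

lemma limitin_frechet_scale:
  assumes "limitin frechet X l F"
  shows "limitin frechet (\<lambda>x k. c *\<^sub>R X x k) (\<lambda>k. c *\<^sub>R l k) F"
  using assms
  by (auto simp: limitin_frechet_iff sob_norm_scale tendsto_mult_right_zero simp flip: scaleR_diff_right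
      elim: eventually_mono)

lemma laplacian_diff: "laplacian v k - laplacian w k = laplacian (\<lambda>k. v k - w k) k"
  by (simp add: laplacian_eq scaleR_diff_right)

lemma limitin_frechet_laplacian:
  assumes "limitin frechet X l F"
  shows "limitin frechet (\<lambda>x. laplacian (X x)) (laplacian l) F"
  using assms
  by (auto simp: limitin_frechet_iff laplacian_diff sob_norm_laplacian smooth_fields_laplacian
      elim: eventually_mono)

lemma limitin_frechet_coeff:
  fixes l :: "'d::finite field"
  assumes "limitin frechet X l F"
  shows "((\<lambda>x. X x k) \<longlongrightarrow> l k) F"
proof (rule Lim_null[THEN iffD2], rule Lim_null_comparison)
  note a = assms[unfolded limitin_frechet_iff]
  show "\<forall>\<^sub>F x in F. norm (X x k - l k) \<le> sob_norm 0 (\<lambda>k. X x k - l k)"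
    using a[THEN conjunct2, THEN conjunct1]
  proof eventually_elim
    case (elim x)
    then show ?case
      using sob_coeff_le_norm[OF smooth_fields_finite[OF smooth_fields_diff[OF elim, of l]], of 0 k] a
      by (cases "k = 0") (auto simp: smooth_fields_at_0)
  qed
  show "((\<lambda>x. sob_norm 0 (\<lambda>k. X x k - l k)) \<longlongrightarrow> 0) F" using a by auto
qed

lemma limitin_frechet_unique:
  fixes l :: "'d::finite field"
  assumes "limitin frechet X l F" "limitin frechet X m F" "F \<noteq> bot"
  shows "l = m"
proof
  show "l k = m k" for k
    using tendsto_unique[OF assms(3) limitin_frechet_coeff[OF assms(1)] limitin_frechet_coeff[OF assms(2)]] .
qed

lemma limitin_frechet_sob_norm:
  assumes "limitin frechet X l F"
  shows "((\<lambda>x. sob_norm p (X x)) \<longlongrightarrow> sob_norm p l) F"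
proof (rule Lim_null[THEN iffD2], rule Lim_null_comparison)
  note a = assms[unfolded limitin_frechet_iff]
  show "\<forall>\<^sub>F x in F. norm (sob_norm p (X x) - sob_norm p l) \<le> sob_norm p (\<lambda>k. X x k - l k)"
    using a[THEN conjunct2, THEN conjunct1]
  proof eventually_elim
    case (elim x)
    then have f: "sob_finite p (X x)" "sob_finite p l" "sob_finite p (\<lambda>k. X x k - l k)" "sob_finite p (\<lambda>k. l k - X x k)"
      using a by (auto intro: smooth_fields_finite)
    show ?case
      using sob_norm_triangle[OF f(3,2)] sob_norm_triangle[OF f(4,1)]
        sob_norm_minus_commute[of p "X x" l] by simp
  qed
  show "((\<lambda>x. sob_norm p (\<lambda>k. X x k - l k)) \<longlongrightarrow> 0) F" using a by auto
qed

lemma tendsto_eventually_const_eq: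
  fixes a :: "'b::t2_space"
  assumes "F \<noteq> bot" "(f \<longlongrightarrow> a) F" "\<forall>\<^sub>F x in F. f x = c"
  shows "a = c"
  using tendsto_unique[OF assms(1,2) tendsto_eventually[OF assms(3)]] .

lemma decay_imp_smooth:
  fixes v :: "'d::finite field"
  assumes "solenoidal v" "\<And>q. 0 \<le> q \<Longrightarrow> \<exists>C. \<forall>k. k \<noteq> 0 \<longrightarrow> norm (wave k) powr q * norm (v k) \<le> C"
  shows "v \<in> smooth_fields"
  unfolding smooth_fields_iff
proof (intro conjI allI assms(1))
  fix p :: real
  obtain C where C: "\<And>k. k \<noteq> 0 \<Longrightarrow> norm (wave k) powr (max 0 p + CARD('d)) * norm (v k) \<le> C"
    using assms(2)[of "max 0 p + CARD('d)"] by auto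
  then have "sob_finite (max 0 p) v"
    by (intro decay_imp_sob_finite(1)[where C = "max 0 C"]) (auto intro: max.coboundedI2)
  then show "sob_finite p v" by (rule sob_finite_order_mono) simp
qed

text \<open>Montel property: on sets that are bounded in every norm, the topology is that of
  coefficientwise convergence.\<close>

lemma limitin_frechet_of_coeff:
  fixes l :: "'d::finite field"
  assumes "F \<noteq> bot" "\<forall>\<^sub>F x in F. X x \<in> smooth_fields" "\<And>k. ((\<lambda>x. X x k) \<longlongrightarrow> l k) F"
    and bd: "\<And>p. \<exists>C. \<forall>\<^sub>F x in F. sob_norm p (X x) \<le> C"
  shows "limitin frechet X l F"
proof -
  have l_bd: "\<exists>C\<ge>0. \<forall>k. k \<noteq> 0 \<longrightarrow> norm (wave k) powr q * norm (l k) \<le> C" for q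
  proof -
    obtain C where C: "\<forall>\<^sub>F x in F. sob_norm q (X x) \<le> C" using bd by blast
    have "norm (wave k) powr q * norm (l k) \<le> max 0 C" if "k \<noteq> 0" for k
    proof (rule tendsto_upperbound)
      show "((\<lambda>x. norm (wave k) powr q * norm (X x k)) \<longlongrightarrow> norm (wave k) powr q * norm (l k)) F"
        by (intro tendsto_intros assms(3))
      show "\<forall>\<^sub>F x in F. norm (wave k) powr q * norm (X x k) \<le> max 0 C"
        using C assms(2)
      proof eventually_elim
        case (elim x)
        with sob_coeff_le[OF smooth_fields_finite[OF elim(2)] that, of q] show ?case by linarith
      qed
    qed (rule assms(1))
    then show ?thesis by (intro exI[of _ "max 0 C"]) auto
  qed
  have sol: "solenoidal l"
    unfolding solenoidal_def
  proof (intro conjI allI)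
    have ev: "\<forall>\<^sub>F x in F. solenoidal (X x)" using assms(2) by eventually_elim (simp add: smooth_fields_iff)
    fix k r
    have "((\<lambda>x. X x (- k) $ r - cnj (X x k $ r)) \<longlongrightarrow> l (- k) $ r - cnj (l k $ r)) F"
      by (intro tendsto_intros assms(3))
    moreover have "\<forall>\<^sub>F x in F. X x (- k) $ r - cnj (X x k $ r) = 0"
      using ev by eventually_elim (simp add: solenoidal_def)
    ultimately have "l (- k) $ r - cnj (l k $ r) = 0"
      by (rule tendsto_eventually_const_eq[OF assms(1)])
    then show "l (- k) $ r = cnj (l k $ r)" by simp
    have "((\<lambda>x. bdot (cwave k) (X x k)) \<longlongrightarrow> bdot (cwave k) (l k)) F"
      unfolding bdot_def by (intro tendsto_intros assms(3))
    moreover have "\<forall>\<^sub>F x in F. bdot (cwave k) (X x k) = 0"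
      using ev by eventually_elim (simp add: solenoidal_def)
    ultimately show "bdot (cwave k) (l k) = 0"
      by (rule tendsto_eventually_const_eq[OF assms(1)])
    have "\<forall>\<^sub>F x in F. X x 0 = 0" using ev by eventually_elim (simp add: solenoidal_def)
    then show "l 0 = 0" by (rule tendsto_eventually_const_eq[OF assms(1,3)])
  qed
  have lS: "l \<in> smooth_fields"
    using decay_imp_smooth[OF sol] l_bd by blast
  have "((\<lambda>x. sob_norm p (\<lambda>k. X x k - l k)) \<longlongrightarrow> 0) F" for p
  proof (rule tendstoI)
    fix e :: real assume e: "0 < e"
    let ?Z = "lattice_const TYPE('d)"
    define q where "q = p + CARD('d)"
    define e' where "e' = e / (2 * (\<bar>?Z\<bar> + 1))"
    have e': "0 < e'" using e by (simp add: e'_def add_nonneg_pos)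
    obtain C1 where C1: "\<forall>\<^sub>F x in F. sob_norm (q + 1) (X x) \<le> C1" using bd by blast
    obtain C2 where C2: "\<forall>k. k \<noteq> 0 \<longrightarrow> norm (wave k) powr (q + 1) * norm (l k) \<le> C2" using l_bd by blast
    \<comment> \<open>Beyond this frequency the bounds of order \<open>q + 1\<close> make the
      weighted coefficient of order \<open>q\<close> at most \<open>e'\<close>; below it only
      finitely many modes are left, and coefficientwise convergence handles those.\<close>
    define N where "N = (\<bar>C1\<bar> + \<bar>C2\<bar>) / e'"
    have "\<forall>\<^sub>F x in F. \<forall>k\<in>{k. norm (wave k) \<le> N}. norm (wave k) powr q * norm (X x k - l k) < e'"
    proof (rule eventually_ball_finite[OF finite_lattice_ball], rule ballI)
      fix k :: "int ^ 'd"
      have "((\<lambda>x. norm (wave k) powr q * norm (X x k - l k)) \<longlongrightarrow> norm (wave k) powr q * norm (l k - l k)) F"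
        by (intro tendsto_intros assms(3))
      then show "\<forall>\<^sub>F x in F. norm (wave k) powr q * norm (X x k - l k) < e'"
        using e' by (auto dest: order_tendstoD)
    qed
    with C1 assms(2) show "\<forall>\<^sub>F x in F. dist (sob_norm p (\<lambda>k. X x k - l k)) 0 < e"
    proof eventually_elim
      case (elim x)
      have "norm (wave k) powr q * norm (X x k - l k) \<le> e'" if k: "k \<noteq> 0" for k
      proof (cases "norm (wave k) \<le> N")
        case True
        then show ?thesis using elim(3) by (auto intro: less_imp_le)
      next
        case False
        have k1: "1 \<le> norm (wave k)" by (rule norm_wave_ge_1[OF k])
        have "norm (wave k) * (norm (wave k) powr q * norm (X x k - l k))
            = norm (wave k) powr (q + 1) * norm (X x k - l k)"
          using k1 by (simp add: powr_add)
        also have "\<dots> \<le> norm (wave k) powr (q + 1) * (norm (X x k) + norm (l k))"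
          by (intro mult_left_mono norm_triangle_ineq4) auto
        also have "\<dots> = norm (wave k) powr (q + 1) * norm (X x k) + norm (wave k) powr (q + 1) * norm (l k)"
          by (rule distrib_left)
        also have "\<dots> \<le> \<bar>C1\<bar> + \<bar>C2\<bar>"
        proof (rule add_mono)
          show "norm (wave k) powr (q + 1) * norm (X x k) \<le> \<bar>C1\<bar>"
            using sob_coeff_le[OF smooth_fields_finite[OF elim(2)] k, of "q + 1"] elim(1) by linarith
          show "norm (wave k) powr (q + 1) * norm (l k) \<le> \<bar>C2\<bar>"
            using C2 k by (meson abs_ge_self order_trans)
        qed
        also have "\<dots> = e' * N" using e' by (simp add: N_def)
        also have "\<dots> \<le> e' * norm (wave k)" using False e' by (intro mult_left_mono) auto
        finally show ?thesis using k1 by (subst (asm) mult.commute[of e']) (simp only: mult_le_cancel_left; linarith)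
      qed
      then have "sob_norm p (\<lambda>k. X x k - l k) \<le> e' * ?Z"
        using e' by (intro decay_imp_sob_finite(2)) (auto simp: q_def)
      also have "\<dots> \<le> e' * (\<bar>?Z\<bar> + 1)" using e' by (intro mult_left_mono) auto
      also have "\<dots> < e" using e add_pos_nonneg[of e "e * \<bar>?Z\<bar>"] by (simp add: e'_def field_simps)
      finally show ?case by simp
    qed
  qed
  with lS assms(2) show ?thesis by (simp add: limitin_frechet_iff)
qed

subsection \<open>Functions of time\<close>

lemma atin_within_euclidean: "atin_within euclidean t I = at t within I"
  unfolding filter_eq_iff eventually_atin_within eventually_at_topological by auto

lemma continuous_map_frechet_iff:
  "continuous_map (top_of_set I) frechet u \<longleftrightarrow> (\<forall>t\<in>I. limitin frechet u (u t) (at t within I))"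
  by (auto simp: continuous_map_atin atin_subtopology_within atin_within_euclidean)

lemma time_Ck_limit: "time_Ck m I u \<Longrightarrow> t \<in> I \<Longrightarrow> limitin frechet u (u t) (at t within I)"
  by (cases m) (auto simp: continuous_map_frechet_iff)

lemma time_Ck_smooth: "time_Ck m I u \<Longrightarrow> t \<in> I \<Longrightarrow> u t \<in> smooth_fields"
  using time_Ck_limit[of m I u t] by (auto simp: limitin_frechet_iff)

lemma time_Ck_0_iff: "time_Ck 0 I u \<longleftrightarrow> (\<forall>t\<in>I. limitin frechet u (u t) (at t within I))"
  by (simp add: continuous_map_frechet_iff)

lemma time_Ck_Suc_iff: "time_Ck (Suc m) I u \<longleftrightarrow>
    time_Ck 0 I u \<and> (\<exists>u'. (\<forall>t\<in>I. has_time_deriv I u (u' t) t) \<and> time_Ck m I u')"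
  by simp

lemma time_Ck_SucD: "time_Ck (Suc m) I u \<Longrightarrow> time_Ck m I u"
proof (induction m arbitrary: u)
  case (Suc m)
  then show ?case unfolding time_Ck_Suc_iff[of "Suc m"] time_Ck_Suc_iff[of m] by blast
qed simp

lemma has_time_deriv_eq: "has_time_deriv I u u' t \<longleftrightarrow>
    limitin frechet (\<lambda>s k. (1 / (s - t)) *\<^sub>R (u s k - u t k)) u' (at t within I)"
  by (simp add: has_time_deriv_def)

lemma has_time_deriv_smooth: "has_time_deriv I u u' t \<Longrightarrow> u' \<in> smooth_fields"
  by (simp add: has_time_deriv_eq limitin_frechet_iff)

lemma has_vector_derivative_quotient:
  fixes f :: "real \<Rightarrow> 'b::real_normed_vector"
  shows "(f has_vector_derivative d) (at t within I) \<longleftrightarrow>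
    ((\<lambda>s. (1 / (s - t)) *\<^sub>R (f s - f t)) \<longlongrightarrow> d) (at t within I)"
proof -
  have "\<forall>\<^sub>F s in at t within I. norm (f s - f t - (s - t) *\<^sub>R d) / norm (s - t)
      = norm ((1 / (s - t)) *\<^sub>R (f s - f t) - d)"
    unfolding eventually_at_filter
  proof (intro always_eventually allI impI)
    fix s assume "s \<noteq> t" "s \<in> I"
    then have "(1 / (s - t)) *\<^sub>R (f s - f t) - d = (1 / (s - t)) *\<^sub>R (f s - f t - (s - t) *\<^sub>R d)"
      by (simp add: scaleR_diff_right)
    then show "norm (f s - f t - (s - t) *\<^sub>R d) / norm (s - t) = norm ((1 / (s - t)) *\<^sub>R (f s - f t) - d)"
      by (simp only: norm_scaleR) simp
  qed
  then show ?thesis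
    unfolding has_vector_derivative_def has_derivative_iff_norm
    by (simp add: bounded_linear_scaleR_left tendsto_norm_zero_iff tendsto_cong flip: Lim_null)
qed

lemma has_time_deriv_add:
  assumes "has_time_deriv I u u' t" "has_time_deriv I v v' t"
  shows "has_time_deriv I (\<lambda>t k. u t k + v t k) (\<lambda>k. u' k + v' k) t"
  using limitin_frechet_add[OF assms[unfolded has_time_deriv_eq]]
  by (simp add: has_time_deriv_eq algebra_simps)

lemma has_time_deriv_scale:
  assumes "has_time_deriv I u u' t"
  shows "has_time_deriv I (\<lambda>t k. c *\<^sub>R u t k) (\<lambda>k. c *\<^sub>R u' k) t"
  using limitin_frechet_scale[OF assms[unfolded has_time_deriv_eq], of c]
  by (simp add: has_time_deriv_eq algebra_simps)

lemma has_time_deriv_diff: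
  assumes "has_time_deriv I u u' t" "has_time_deriv I v v' t"
  shows "has_time_deriv I (\<lambda>t k. u t k - v t k) (\<lambda>k. u' k - v' k) t"
  using has_time_deriv_add[OF assms(1) has_time_deriv_scale[OF assms(2), of "-1"]] by simp

lemma has_time_deriv_laplacian:
  assumes "has_time_deriv I u u' t"
  shows "has_time_deriv I (\<lambda>t. laplacian (u t)) (laplacian u') t"
proof -
  have "(\<lambda>s. laplacian (\<lambda>k. (1 / (s - t)) *\<^sub>R (u s k - u t k)))
      = (\<lambda>s k. (1 / (s - t)) *\<^sub>R (laplacian (u s) k - laplacian (u t) k))"
    by (simp add: fun_eq_iff laplacian_eq algebra_simps)
  with limitin_frechet_laplacian[OF assms[unfolded has_time_deriv_eq]] show ?thesis
    by (simp add: has_time_deriv_eq)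
qed

lemma has_time_deriv_imp_limit:
  assumes d: "has_time_deriv I u u' t" and t: "u t \<in> smooth_fields"
  shows "limitin frechet u (u t) (at t within I)"
  unfolding limitin_frechet_iff
proof (intro conjI allI t)
  note a = d[unfolded has_time_deriv_eq limitin_frechet_iff]
  have ne: "\<forall>\<^sub>F s in at t within I. s \<noteq> t" by (simp add: eventually_at_filter)
  show "\<forall>\<^sub>F s in at t within I. u s \<in> smooth_fields"
    using a[THEN conjunct2, THEN conjunct1] ne
  proof eventually_elim
    case (elim s)
    have "(\<lambda>k. u t k + (s - t) *\<^sub>R ((1 / (s - t)) *\<^sub>R (u s k - u t k))) \<in> smooth_fields"
      by (rule smooth_fields_add[OF t smooth_fields_scale[OF elim(1)]])
    then show ?case using elim(2) by simp
  qed
  fix p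
  have "((\<lambda>s. \<bar>s - t\<bar> * sob_norm p (\<lambda>k. (1 / (s - t)) *\<^sub>R (u s k - u t k))) \<longlongrightarrow> \<bar>t - t\<bar> * sob_norm p u') (at t within I)"
    by (intro tendsto_intros limitin_frechet_sob_norm d[unfolded has_time_deriv_eq])
  moreover have "\<forall>\<^sub>F s in at t within I. \<bar>s - t\<bar> * sob_norm p (\<lambda>k. (1 / (s - t)) *\<^sub>R (u s k - u t k))
      = sob_norm p (\<lambda>k. u s k - u t k)"
    using ne by eventually_elim (simp add: sob_norm_scale)
  ultimately show "((\<lambda>s. sob_norm p (\<lambda>k. u s k - u t k)) \<longlongrightarrow> 0) (at t within I)"
    by (simp add: tendsto_cong)
qed

lemma time_Ck_add: "time_Ck m I u \<Longrightarrow> time_Ck m I v \<Longrightarrow> time_Ck m I (\<lambda>t k. u t k + v t k)"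
proof (induction m arbitrary: u v)
  case 0
  then show ?case unfolding time_Ck_0_iff by (blast intro: limitin_frechet_add)
next
  case (Suc m)
  from Suc.prems obtain u' v' where
    "\<forall>t\<in>I. has_time_deriv I u (u' t) t" "\<forall>t\<in>I. has_time_deriv I v (v' t) t" "time_Ck m I u'" "time_Ck m I v'"
    by (auto simp del: time_Ck.simps simp: time_Ck_Suc_iff)
  moreover have "time_Ck 0 I (\<lambda>t k. u t k + v t k)"
    using Suc.prems unfolding time_Ck_Suc_iff time_Ck_0_iff by (blast intro: limitin_frechet_add)
  ultimately show ?case
    unfolding time_Ck_Suc_iff
    by (intro conjI exI[of _ "\<lambda>t k. u' t k + v' t k"]) (auto intro: has_time_deriv_add Suc.IH)
qed

lemma time_Ck_scale: "time_Ck m I u \<Longrightarrow> time_Ck m I (\<lambda>t k. c *\<^sub>R u t k)"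
proof (induction m arbitrary: u)
  case 0
  then show ?case unfolding time_Ck_0_iff by (blast intro: limitin_frechet_scale)
next
  case (Suc m)
  from Suc.prems obtain u' where
    "\<forall>t\<in>I. has_time_deriv I u (u' t) t" "time_Ck m I u'"
    by (auto simp del: time_Ck.simps simp: time_Ck_Suc_iff)
  moreover have "time_Ck 0 I (\<lambda>t k. c *\<^sub>R u t k)"
    using Suc.prems unfolding time_Ck_Suc_iff time_Ck_0_iff by (blast intro: limitin_frechet_scale)
  ultimately show ?case
    unfolding time_Ck_Suc_iff
    by (intro conjI exI[of _ "\<lambda>t k. c *\<^sub>R u' t k"]) (auto intro: has_time_deriv_scale Suc.IH)
qed

lemma time_Ck_laplacian: "time_Ck m I u \<Longrightarrow> time_Ck m I (\<lambda>t. laplacian (u t))"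
proof (induction m arbitrary: u)
  case 0
  then show ?case unfolding time_Ck_0_iff by (blast intro: limitin_frechet_laplacian)
next
  case (Suc m)
  from Suc.prems obtain u' where
    "\<forall>t\<in>I. has_time_deriv I u (u' t) t" "time_Ck m I u'"
    by (auto simp del: time_Ck.simps simp: time_Ck_Suc_iff)
  moreover have "time_Ck 0 I (\<lambda>t. laplacian (u t))"
    using Suc.prems unfolding time_Ck_Suc_iff time_Ck_0_iff by (blast intro: limitin_frechet_laplacian)
  ultimately show ?case
    unfolding time_Ck_Suc_iff
    by (intro conjI exI[of _ "\<lambda>t. laplacian (u' t)"]) (auto intro: has_time_deriv_laplacian Suc.IH)
qed

lemma time_Ck_subset: "time_Ck m I u \<Longrightarrow> J \<subseteq> I \<Longrightarrow> time_Ck m J u"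
proof (induction m arbitrary: u)
  case 0
  then show ?case by (auto simp: continuous_map_from_subtopology_mono)
next
  case (Suc m)
  have "limitin frechet X l (at t within J)" if "limitin frechet X l (at t within I)" for X l t
    using that at_le[OF Suc.prems(2), of t] unfolding limitin_def filter_leD[OF at_le[OF Suc.prems(2), of t]]
    by (meson filter_leD)
  then show ?case
    using Suc unfolding time_Ck_Suc_iff time_Ck_0_iff has_time_deriv_eq by blast
qed

lemma time_Ck_sob_norm_continuous:
  assumes "time_Ck m I u"
  shows "continuous_on I (\<lambda>t. sob_norm p (u t))"
  unfolding continuous_on_def using limitin_frechet_sob_norm[OF time_Ck_limit[OF assms]] by blast

lemma time_Ck_bounded:
  assumes "time_Ck m I u" "compact J" "J \<subseteq> I"
  obtains C where "0 \<le> C" "\<And>t. t \<in> J \<Longrightarrow> sob_norm p (u t) \<le> C"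
proof -
  have "compact ((\<lambda>t. sob_norm p (u t)) ` J)"
    using time_Ck_sob_norm_continuous[OF assms(1)] assms(2,3)
    by (intro compact_continuous_image) (auto intro: continuous_on_subset)
  then obtain C where "\<forall>x\<in>(\<lambda>t. sob_norm p (u t)) ` J. norm x \<le> C"
    using compact_imp_bounded bounded_iff by blast
  then show ?thesis by (intro that[of "max 0 C"]) auto
qed

text \<open>The mean value inequality for each coefficient, with the bound of order
  \<open>p + CARD('d)\<close> on \<open>F\<close>, bounds the difference quotients in the norm of
  order \<open>p\<close>, uniformly in \<open>s\<close>. The Montel property then upgrades
  coefficientwise convergence of the quotients.\<close>

lemma has_time_deriv_of_coeff:
  fixes u :: "real \<Rightarrow> 'd::finite field"
  assumes I: "convex I" "t \<in> I" "at t within I \<noteq> bot"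
    and u: "\<And>s. s \<in> I \<Longrightarrow> u s \<in> smooth_fields"
    and d: "\<And>s k. s \<in> I \<Longrightarrow> ((\<lambda>s. u s k) has_vector_derivative F s k) (at s within I)"
    and F: "\<And>s. s \<in> I \<Longrightarrow> F s \<in> smooth_fields"
    and bd: "\<And>p. \<exists>C. \<forall>s\<in>I. sob_norm p (F s) \<le> C"
  shows "has_time_deriv I u (F t) t"
  unfolding has_time_deriv_eq
proof (rule limitin_frechet_of_coeff[OF I(3)])
  have inI: "\<forall>\<^sub>F s in at t within I. s \<in> I \<and> s \<noteq> t" by (simp add: eventually_at_filter)
  then show "\<forall>\<^sub>F s in at t within I. (\<lambda>k. (1 / (s - t)) *\<^sub>R (u s k - u t k)) \<in> smooth_fields"
    by eventually_elim (intro smooth_fields_scale smooth_fields_diff u I; simp)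
  fix k
  show "((\<lambda>s. (1 / (s - t)) *\<^sub>R (u s k - u t k)) \<longlongrightarrow> F t k) (at t within I)"
    using d[OF I(2), of k] by (simp add: has_vector_derivative_quotient)
next
  fix p :: real
  define q where "q = p + CARD('d)"
  obtain C where C: "\<And>s. s \<in> I \<Longrightarrow> sob_norm q (F s) \<le> C" using bd by blast
  have C0: "0 \<le> C" using C[OF I(2)] sob_norm_nonneg[of q "F t"] by linarith
  have "sob_norm p (\<lambda>k. (1 / (s - t)) *\<^sub>R (u s k - u t k)) \<le> C * lattice_const TYPE('d)"
    if s: "s \<in> I" "s \<noteq> t" for s
  proof (rule decay_imp_sob_finite(2))
    fix k :: "int ^ 'd" assume k: "k \<noteq> 0"
    have pos: "0 < norm (wave k) powr q" using norm_wave_ge_1[OF k] by auto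
    have Fb: "norm (F r k) \<le> C / norm (wave k) powr q" if "r \<in> I" for r
      using sob_coeff_le[OF smooth_fields_finite[OF F[OF that]] k, of q] C[OF that] pos
      by (simp add: field_simps)
    have "0 \<le> C / norm (wave k) powr q" using C0 by simp
    then have "onorm (\<lambda>x. x *\<^sub>R F r k) \<le> C / norm (wave k) powr q" if "r \<in> I" for r
    proof (rule onorm_bound)
      fix x
      show "norm (x *\<^sub>R F r k) \<le> C / norm (wave k) powr q * norm x"
        using mult_left_mono[OF Fb[OF that], of "norm x"] by (simp add: mult.commute)
    qed
    then have "norm (u s k - u t k) \<le> C / norm (wave k) powr q * norm (s - t)"
      using d by (intro differentiable_bound[OF I(1), where f' = "\<lambda>r x. x *\<^sub>R F r k"] s I)
        (auto simp: has_vector_derivative_def)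
    moreover have "norm ((1 / (s - t)) *\<^sub>R (u s k - u t k)) = norm (u s k - u t k) / norm (s - t)"
      by simp
    moreover have "0 < norm (s - t)" using s by simp
    ultimately show "norm (wave k) powr (p + CARD('d)) * norm ((1 / (s - t)) *\<^sub>R (u s k - u t k)) \<le> C"
      using pos by (simp only: q_def[symmetric]) (simp add: field_simps del: norm_scaleR)
  qed (rule C0)
  moreover have "\<forall>\<^sub>F s in at t within I. s \<in> I \<and> s \<noteq> t" by (simp add: eventually_at_filter)
  ultimately show "\<exists>C. \<forall>\<^sub>F s in at t within I. sob_norm p (\<lambda>k. (1 / (s - t)) *\<^sub>R (u s k - u t k)) \<le> C"
    by (intro exI[of _ "C * lattice_const TYPE('d)"]) (auto elim: eventually_mono)
qed

subsection \<open>Orthogonality of the Fourier modes\<close>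

lemma integral_cis_period:
  "(LINT y|lborel. indicator {0..2 * pi} y *\<^sub>R cis (of_int j * y)) = (if j = 0 then of_real (2 * pi) else 0)"
    (is "?I = _")
proof -
  have "continuous_on {0..2 * pi} (\<lambda>y. cis (of_int j * y))"
    by (intro continuous_intros)
  from set_borel_integral_eq_integral(2)[OF borel_integrable_atLeastAtMost'[OF this]]
  have I: "?I = integral {0..2 * pi} (\<lambda>y. cis (of_int j * y))"
    by (simp add: set_lebesgue_integral_def)
  show ?thesis
  proof (cases "j = 0")
    case True
    then show ?thesis using I by (simp add: scaleR_conv_of_real)
  next
    case False
    define g where "g = (\<lambda>y. cis (of_int j * y) / (\<i> * of_int j))"
    have "((\<lambda>y. cis (of_int j * y)) has_integral (g (2 * pi) - g 0)) {0..2 * pi}"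
    proof (rule fundamental_theorem_of_calculus)
      fix y :: real
      have "((\<lambda>y. exp (\<i> * of_real (of_int j * y)) / (\<i> * of_int j)) has_vector_derivative
          exp (\<i> * of_real (of_int j * y))) (at y within {0..2 * pi})"
        using False
        by (auto intro!: derivative_eq_intros has_vector_derivative_real_field simp: field_simps)
      then show "(g has_vector_derivative cis (of_int j * y)) (at y within {0..2 * pi})"
        by (simp add: g_def cis_conv_exp)
    qed simp
    moreover have "cis (of_int j * (2 * pi)) = 1"
      using cis_multiple_2pi[of "of_int j"] by (simp add: mult_ac)
    then have "g (2 * pi) - g 0 = 0" by (simp add: g_def)
    ultimately show ?thesis using I False by (simp add: integral_unique)
  qed
qed

abbreviation period_box :: "(real ^ 'd::finite) set" where
  "period_box \<equiv> cbox 0 (\<chi> r. 2 * pi)"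

text \<open>Lebesgue measure on \<open>real ^ 'd\<close> is the image of a product of
  one-dimensional measures indexed by \<open>Basis\<close>, and both the exponential and the
  indicator of the box factorise. If \<open>m\<close> is nonzero, some factor integrates a
  nontrivial mode over a period.\<close>

lemma integral_wave:
  fixes m :: "int ^ 'd::finite"
  shows "(LINT x:period_box|lborel. cis (wave m \<bullet> x)) = (if m = 0 then of_real ((2 * pi) ^ CARD('d)) else 0)"
proof -
  define h :: "real ^ 'd \<Rightarrow> real \<Rightarrow> complex" where
    "h = (\<lambda>b y. indicator {0..2 * pi} y *\<^sub>R cis ((wave m \<bullet> b) * y))"
  interpret product_sigma_finite "\<lambda>_ :: real ^ 'd. lborel :: real measure"
    by standard
  have wb: "\<exists>j. wave m \<bullet> b = of_int j" if "b \<in> Basis" for b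
    using that by (auto simp: Basis_vec_def inner_axis wave_def)
  have hi: "integrable lborel (h b)" for b
  proof -
    have "continuous_on {0..2 * pi} (\<lambda>y. cis ((wave m \<bullet> b) * y))" by (intro continuous_intros)
    from borel_integrable_atLeastAtMost'[OF this] show ?thesis
      by (simp add: h_def set_integrable_def)
  qed
  have meas: "(\<lambda>x :: real ^ 'd. indicator period_box x *\<^sub>R cis (wave m \<bullet> x)) \<in> borel_measurable borel"
    by (intro borel_measurable_scaleR borel_measurable_indicator borel_measurable_continuous_onI continuous_intros) auto
  have box: "indicator period_box (\<Sum>b\<in>Basis. f b *\<^sub>R b) = (\<Prod>b\<in>Basis. indicator {0..2 * pi} (f b) :: real)"
    for f :: "real ^ 'd \<Rightarrow> real"
  proof -
    have c: "(\<chi> r. 2 * pi) \<bullet> b = 2 * pi" if "b \<in> Basis" for b :: "real ^ 'd"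
      using that by (auto simp: Basis_vec_def inner_axis)
    have "(\<Sum>b\<in>Basis. f b *\<^sub>R b) \<in> period_box \<longleftrightarrow> (\<forall>b\<in>Basis. f b \<in> {0..2 * pi})"
      by (simp add: mem_box c)
    then show ?thesis
      by (auto simp: indicator_def)
  qed
  have ci: "cis (wave m \<bullet> (\<Sum>b\<in>Basis. f b *\<^sub>R b)) = (\<Prod>b\<in>Basis. cis ((wave m \<bullet> b) * f b))"
    for f :: "real ^ 'd \<Rightarrow> real"
    by (simp add: inner_sum_right cis_conv_exp exp_sum[symmetric] sum_distrib_left mult_ac)
  have "(LINT x:period_box|lborel. cis (wave m \<bullet> x))
      = (\<integral>f. indicator period_box (\<Sum>b\<in>Basis. f b *\<^sub>R b) *\<^sub>R cis (wave m \<bullet> (\<Sum>b\<in>Basis. f b *\<^sub>R b))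
          \<partial>(\<Pi>\<^sub>M b\<in>(Basis :: (real ^ 'd) set). lborel))"
    unfolding set_lebesgue_integral_def lborel_eq_real
    by (subst lborel_def, rule integral_distr[OF _ meas]) measurable
  also have "\<dots> = (\<integral>f. (\<Prod>b\<in>Basis. h b (f b)) \<partial>(\<Pi>\<^sub>M b\<in>Basis. lborel))"
    unfolding box ci h_def scaleR_conv_of_real[where 'a = complex] by (simp add: prod.distrib)
  also have "\<dots> = (\<Prod>b\<in>Basis. integral\<^sup>L lborel (h b))"
    by (rule product_integral_prod) (auto intro: hi)
  also have "\<dots> = (\<Prod>b\<in>(Basis :: (real ^ 'd) set). if wave m \<bullet> b = 0 then of_real (2 * pi) else 0)"
  proof (rule prod.cong[OF refl])
    fix b :: "real ^ 'd" assume "b \<in> Basis"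
    then obtain j where j: "wave m \<bullet> b = of_int j" using wb by blast
    show "integral\<^sup>L lborel (h b) = (if wave m \<bullet> b = 0 then of_real (2 * pi) else 0)"
      using integral_cis_period[of j] by (simp add: h_def j)
  qed
  also have "\<dots> = (if m = 0 then of_real ((2 * pi) ^ CARD('d)) else 0)"
  proof (cases "m = 0")
    case False
    then have "wave m \<noteq> 0" using norm_wave_ge_1[of m] by auto
    then obtain b where "b \<in> Basis" "wave m \<bullet> b \<noteq> 0" using euclidean_all_zero_iff by blast
    then have "(\<Prod>b\<in>(Basis :: (real ^ 'd) set). if wave m \<bullet> b = 0 then complex_of_real (2 * pi) else 0) = 0"
      by (intro prod_zero) auto
    with False show ?thesis by simp
  qed simp
  finally show ?thesis .
qed

text \<open>Absolute summability gives uniform convergence, hence termwise integration. The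
  frequencies \<open>m i\<close> may repeat because the lemma is applied to a product of two series,
  indexed by pairs with frequency \<open>fst p + snd p\<close>.\<close>

lemma integral_fourier_series:
  fixes m :: "'i \<Rightarrow> int ^ 'd::finite"
  assumes a: "(\<lambda>i. norm (a i)) summable_on A"
  shows "((\<lambda>i. if m i = k then a i * of_real ((2 * pi) ^ CARD('d)) else 0) has_sum
     (LINT x:period_box|lborel. (\<Sum>\<^sub>\<infinity>i\<in>A. a i * cis (wave (m i) \<bullet> x)) * cis (- (wave k \<bullet> x)))) A"
proof -
  let ?P = "\<lambda>F x. \<Sum>i\<in>F. a i * cis (wave (m i) \<bullet> x)" and ?G = "\<lambda>x. \<Sum>\<^sub>\<infinity>i\<in>A. a i * cis (wave (m i) \<bullet> x)"
  let ?e = "\<lambda>x. cis (- (wave k \<bullet> x))"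
  have unif: "uniform_limit period_box ?P ?G (finite_subsets_at_top A)"
    by (rule Weierstrass_m_test_general[OF _ a]) (simp add: norm_mult)
  have contP: "continuous_on period_box (?P F)" for F by (intro continuous_intros)
  have contG: "continuous_on period_box ?G"
    by (rule uniform_limit_theorem[OF _ unif]) (auto simp: contP)
  have conte: "continuous_on period_box ?e" by (intro continuous_intros)
  have eqL: "(LINT x:period_box|lborel. g x) = integral period_box g"
    if "continuous_on period_box g" for g :: "real ^ 'd \<Rightarrow> complex"
    using borel_integrable_compact[OF compact_cbox that]
    by (intro set_borel_integral_eq_integral) (simp add: set_integrable_def)
  have unif2: "uniform_limit period_box (\<lambda>F x. ?P F x * ?e x) (\<lambda>x. ?G x * ?e x) (finite_subsets_at_top A)"
    using compact_imp_bounded[OF compact_continuous_image[OF contG compact_cbox]]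
      compact_imp_bounded[OF compact_continuous_image[OF conte compact_cbox]]
    by (rule uniform_lim_mult[OF unif uniform_limit_const])
  have contPe: "continuous_on period_box (\<lambda>x. ?P F x * ?e x)" for F by (intro continuous_intros)
  obtain I J where I: "\<And>F. ((\<lambda>x. ?P F x * ?e x) has_integral I F) period_box"
    and J: "((\<lambda>x. ?G x * ?e x) has_integral J) period_box"
    and lim: "(I \<longlongrightarrow> J) (finite_subsets_at_top A)"
    by (rule uniform_limit_integral_cbox[OF unif2 contPe finite_subsets_at_top_neq_bot]) (rule that)
  have Jeq: "J = (LINT x:period_box|lborel. ?G x * ?e x)"
    using eqL[OF continuous_on_mult[OF contG conte]] J by (simp add: integral_unique)
  have Ieq: "I F = (\<Sum>i\<in>F. if m i = k then a i * of_real ((2 * pi) ^ CARD('d)) else 0)" if "finite F" for F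
  proof -
    have c: "continuous_on period_box (\<lambda>x. cis (wave (m i - k) \<bullet> x))" for i by (intro continuous_intros)
    have "((\<lambda>x. \<Sum>i\<in>F. a i * cis (wave (m i - k) \<bullet> x)) has_integral
        (\<Sum>i\<in>F. a i * (if m i - k = 0 then of_real ((2 * pi) ^ CARD('d)) else 0))) period_box"
    proof (intro has_integral_sum that has_integral_mult_right)
      fix i
      show "((\<lambda>x. cis (wave (m i - k) \<bullet> x)) has_integral (if m i - k = 0 then of_real ((2 * pi) ^ CARD('d)) else 0)) period_box"
        using integrable_integral[OF integrable_continuous[OF c[of i]]] eqL[OF c[of i]] integral_wave[of "m i - k"]
        by simp
    qed
    moreover have "(\<lambda>x. \<Sum>i\<in>F. a i * cis (wave (m i - k) \<bullet> x)) = (\<lambda>x. ?P F x * ?e x)"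
      by (simp add: sum_distrib_right mult.assoc cis_mult wave_diff inner_diff_left)
    ultimately have "((\<lambda>x. ?P F x * ?e x) has_integral
        (\<Sum>i\<in>F. a i * (if m i - k = 0 then of_real ((2 * pi) ^ CARD('d)) else 0))) period_box" by simp
    with I[of F] have "I F = (\<Sum>i\<in>F. a i * (if m i - k = 0 then of_real ((2 * pi) ^ CARD('d)) else 0))"
      by (rule has_integral_unique)
    also have "\<dots> = (\<Sum>i\<in>F. if m i = k then a i * of_real ((2 * pi) ^ CARD('d)) else 0)"
      by (intro sum.cong) auto
    finally show ?thesis .
  qed
  show ?thesis
    unfolding has_sum_def Jeq[symmetric]
    by (rule Lim_transform_eventually[OF lim]) (auto simp: Ieq eventually_finite_subsets_at_top intro!: exI[of _ "{}"])
qed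

subsection \<open>The convolution formula\<close>

lemma has_sum_finite_sum:
  fixes f :: "'s \<Rightarrow> 'i \<Rightarrow> 'b::topological_comm_monoid_add"
  assumes "\<And>s. s \<in> S \<Longrightarrow> (f s has_sum a s) A"
  shows "((\<lambda>x. \<Sum>s\<in>S. f s x) has_sum (\<Sum>s\<in>S. a s)) A"
  using assms by (induction S rule: infinite_finite_induct) (auto intro: has_sum_add)

lemma product_summable:
  fixes f :: "'a \<Rightarrow> real" and g :: "'b \<Rightarrow> real"
  assumes "f summable_on UNIV" "g summable_on UNIV" "\<And>x. 0 \<le> f x" "\<And>x. 0 \<le> g x"
  shows "(\<lambda>(x, y). f x * g y) summable_on UNIV"
proof -
  have "(\<lambda>(x, y). f x * g y) summable_on Sigma UNIV (\<lambda>_. UNIV)"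
    by (rule summable_on_SigmaI[where g = "\<lambda>x. f x * infsum g UNIV"])
       (auto simp: assms intro!: has_sum_cmult_right has_sum_infsum summable_on_cmult_left)
  then show ?thesis by simp
qed

lemma product_has_sum:
  fixes f :: "'a \<Rightarrow> complex" and g :: "'b \<Rightarrow> complex"
  assumes "(\<lambda>x. norm (f x)) summable_on UNIV" "(\<lambda>y. norm (g y)) summable_on UNIV"
  shows "((\<lambda>(x, y). f x * g y) has_sum (infsum f UNIV * infsum g UNIV)) UNIV"
proof -
  have "(\<lambda>p. norm ((\<lambda>(x, y). f x * g y) p)) summable_on UNIV"
    using product_summable[OF assms] by (simp add: case_prod_unfold norm_mult)
  then have "(\<lambda>(x, y). f x * g y) summable_on Sigma UNIV (\<lambda>_. UNIV)"
    by (simp add: abs_summable_summable)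
  then have "((\<lambda>(x, y). f x * g y) has_sum (infsum f UNIV * infsum g UNIV)) (Sigma UNIV (\<lambda>_. UNIV))"
    by (intro has_sum_SigmaI[where g = "\<lambda>x. f x * infsum g UNIV"])
       (auto intro!: has_sum_cmult_right has_sum_cmult_left has_sum_infsum abs_summable_summable assms)
  then show ?thesis by simp
qed

lemma smooth_fields_decay:
  assumes "v \<in> smooth_fields"
  obtains C where "0 \<le> C" "\<And>k. (1 + norm (wave k)) ^ q * norm (v k) \<le> C"
proof
  show "0 \<le> 2 ^ q * sob_norm (real q) v" by simp
  fix k
  show "(1 + norm (wave k)) ^ q * norm (v k) \<le> 2 ^ q * sob_norm (real q) v"
  proof (cases "k = 0")
    case False
    have k1: "1 \<le> norm (wave k)" by (rule norm_wave_ge_1[OF False])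
    have "(1 + norm (wave k)) ^ q * norm (v k) \<le> (2 * norm (wave k)) ^ q * norm (v k)"
      using k1 by (intro mult_right_mono power_mono) auto
    also have "\<dots> = 2 ^ q * (norm (wave k) powr real q * norm (v k))"
      using k1 by (subst powr_realpow) (auto simp: power_mult_distrib)
    also have "\<dots> \<le> 2 ^ q * sob_norm (real q) v"
      by (intro mult_left_mono sob_coeff_le smooth_fields_finite assms False) simp
    finally show ?thesis .
  qed (simp add: smooth_fields_at_0 assms)
qed

lemma smooth_fields_summable:
  fixes v :: "'d::finite field"
  assumes "v \<in> smooth_fields"
  shows "(\<lambda>k. (1 + norm (wave k)) ^ q * norm (v k)) summable_on UNIV"
proof -
  obtain C where C: "\<And>k. (1 + norm (wave k)) ^ (q + 2 * CARD('d)) * norm (v k) \<le> C"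
    using smooth_fields_decay[OF assms] by blast
  show ?thesis
  proof (rule summable_on_comparison_test)
    show "(\<lambda>k :: int ^ 'd. C * (1 / (1 + (norm (wave k))\<^sup>2) ^ CARD('d))) summable_on UNIV"
      by (intro summable_on_cmult_right lattice_summable)
    fix k :: "int ^ 'd"
    let ?x = "norm (wave k)"
    have "(1 + ?x\<^sup>2) ^ CARD('d) \<le> ((1 + ?x)\<^sup>2) ^ CARD('d)"
      by (intro power_mono) (auto simp: power2_sum)
    then have "(1 + ?x\<^sup>2) ^ CARD('d) * ((1 + ?x) ^ q * norm (v k))
        \<le> ((1 + ?x)\<^sup>2) ^ CARD('d) * ((1 + ?x) ^ q * norm (v k))"
      by (intro mult_right_mono) auto
    also have "\<dots> = (1 + ?x) ^ (q + 2 * CARD('d)) * norm (v k)"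
      by (simp add: power_add power_mult)
    also have "\<dots> \<le> C" by (rule C)
    finally have "(1 + ?x\<^sup>2) ^ CARD('d) * ((1 + ?x) ^ q * norm (v k)) \<le> C" .
    moreover have "0 < (1 + ?x\<^sup>2) ^ CARD('d)" by (intro zero_less_power add_pos_nonneg) auto
    ultimately show "(1 + ?x) ^ q * norm (v k) \<le> C * (1 / (1 + ?x\<^sup>2) ^ CARD('d))"
      by (simp add: pos_le_divide_eq mult.commute)
  qed simp
qed

definition fourier_const :: "'d::finite itself \<Rightarrow> real" where
  "fourier_const _ = (2 * pi) powr (- real CARD('d) / 2)"

lemma fourier_const_nonneg [simp]: "0 \<le> fourier_const d"
  by (simp add: fourier_const_def)

lemma fourier_const_sq: "(fourier_const TYPE('d::finite))\<^sup>2 * (2 * pi) ^ CARD('d) = 1"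
proof -
  have "(fourier_const TYPE('d))\<^sup>2 = (2 * pi) powr (- real CARD('d))"
    unfolding fourier_const_def power2_eq_square powr_add[symmetric] by simp
  also have "\<dots> = 1 / (2 * pi) ^ CARD('d)"
    by (simp add: powr_minus powr_realpow divide_inverse)
  finally show ?thesis by simp
qed

lemma field_at_nth:
  fixes v :: "'d::finite field"
  assumes "(\<lambda>k. norm (v k)) summable_on UNIV"
  shows "field_at v x $ s = fourier_const TYPE('d) *\<^sub>R (\<Sum>\<^sub>\<infinity>k. cis (wave k \<bullet> x) * v k $ s)"
proof -
  have n: "norm (c *s z) = norm c * norm z" for c and z :: "complex ^ 'd"
    by (simp add: norm_vec_def L2_set_def norm_mult power_mult_distrib real_sqrt_mult flip: sum_distrib_left)
  have "(\<lambda>k. norm (cis (wave k \<bullet> x) *s v k)) summable_on UNIV" using assms by (simp add: n)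
  then have "(\<lambda>k. cis (wave k \<bullet> x) *s v k) summable_on UNIV" by (rule abs_summable_summable)
  then have "(\<Sum>\<^sub>\<infinity>k. cis (wave k \<bullet> x) *s v k) $ s = (\<Sum>\<^sub>\<infinity>k. (cis (wave k \<bullet> x) *s v k) $ s)"
    by (intro infsumI[symmetric] has_sum_bounded_linear[OF bounded_linear_vec_nth[of s], unfolded comp_def] has_sum_infsum)
  then show ?thesis by (simp add: field_at_def fourier_const_def)
qed

text \<open>Both Fourier series converge absolutely, so their product is a double series that may be
  integrated termwise; orthogonality keeps the pairs of frequencies with sum
  \<open>k\<close>.\<close>

lemma advect_convolution:
  fixes v w :: "'d::finite field"
  assumes v: "v \<in> smooth_fields" and w: "w \<in> smooth_fields"
  shows "((\<lambda>h. \<Sum>s\<in>UNIV. of_real (fourier_const TYPE('d)) *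
      (v h $ s * (\<i> * of_int ((k - h) $ s) * w (k - h) $ r))) has_sum (advect v w k $ r)) UNIV"
proof -
  let ?c = "fourier_const TYPE('d)"
  have vs: "(\<lambda>k. norm (v k)) summable_on UNIV" using smooth_fields_summable[OF v, of 0] by simp
  have ws: "(\<lambda>k. norm (dpartial s w k)) summable_on UNIV" for s
  proof (rule summable_on_comparison_test)
    show "(\<lambda>k. (1 + norm (wave k)) ^ 1 * norm (w k)) summable_on UNIV"
      by (rule smooth_fields_summable[OF w])
    fix k
    have "\<bar>wave k $ s\<bar> \<le> norm (wave k)" by (rule component_le_norm_cart)
    then have "\<bar>real_of_int (k $ s)\<bar> \<le> 1 + norm (wave k)" by (simp add: wave_def)
    moreover have "norm (dpartial s w k) = \<bar>real_of_int (k $ s)\<bar> * norm (w k)"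
      by (simp add: dpartial_def norm_vec_def L2_set_def norm_mult power_mult_distrib real_sqrt_mult flip: sum_distrib_left)
    ultimately show "norm (dpartial s w k) \<le> (1 + norm (wave k)) ^ 1 * norm (w k)"
      by (simp add: mult_right_mono)
  qed simp
  have vs': "(\<lambda>k. norm (v k $ s)) summable_on UNIV" for s
    by (rule summable_on_comparison_test[OF vs]) (auto intro: Finite_Cartesian_Product.norm_nth_le)
  have ws': "(\<lambda>k. norm (dpartial s w k $ r)) summable_on UNIV" for s
    by (rule summable_on_comparison_test[OF ws]) (auto intro: Finite_Cartesian_Product.norm_nth_le)
  define a where "a = (\<lambda>(h, l). \<Sum>s\<in>UNIV. v h $ s * dpartial s w l $ r)"
  have G: "(\<Sum>s\<in>UNIV. field_at v x $ s * field_at (dpartial s w) x $ r)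
      = of_real (?c\<^sup>2) * (\<Sum>\<^sub>\<infinity>p. a p * cis (wave (fst p + snd p) \<bullet> x))" for x
  proof -
    have "((\<lambda>p. \<Sum>s\<in>UNIV. (\<lambda>(h, l). (cis (wave h \<bullet> x) * v h $ s) * (cis (wave l \<bullet> x) * dpartial s w l $ r)) p) has_sum
      (\<Sum>s\<in>UNIV. (\<Sum>\<^sub>\<infinity>h. cis (wave h \<bullet> x) * v h $ s) * (\<Sum>\<^sub>\<infinity>l. cis (wave l \<bullet> x) * dpartial s w l $ r))) UNIV"
      by (intro has_sum_finite_sum product_has_sum) (auto simp: norm_mult vs' ws')
    also have "(\<lambda>p. \<Sum>s\<in>UNIV. (\<lambda>(h, l). (cis (wave h \<bullet> x) * v h $ s) * (cis (wave l \<bullet> x) * dpartial s w l $ r)) p)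
       = (\<lambda>p. a p * cis (wave (fst p + snd p) \<bullet> x))"
      by (auto simp: fun_eq_iff a_def wave_add inner_add_left cis_mult[symmetric] sum_distrib_left mult_ac)
    finally show ?thesis
      by (simp add: infsumI field_at_nth[OF vs] field_at_nth[OF ws] scaleR_conv_of_real
          power2_eq_square sum_distrib_left mult_ac)
  qed
  have asum: "(\<lambda>p. norm (a p)) summable_on UNIV"
  proof (rule summable_on_comparison_test)
    show "(\<lambda>p. \<Sum>s\<in>UNIV. (\<lambda>(h, l). norm (v h $ s) * norm (dpartial s w l $ r)) p) summable_on UNIV"
      by (rule has_sum_imp_summable[OF has_sum_finite_sum[OF has_sum_infsum]])
         (auto intro!: product_summable vs' ws')
    show "norm (a p) \<le> (\<Sum>s\<in>UNIV. (\<lambda>(h, l). norm (v h $ s) * norm (dpartial s w l $ r)) p)" for p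
      by (auto simp: a_def norm_mult split: prod.split intro!: order_trans[OF norm_sum])
  qed simp
  have "(2 * pi) powr - (real CARD('d) / 2) = ?c" by (simp add: fourier_const_def)
  \<comment> \<open>Two factors of the normalising constant stem from the point values and one from
    the Fourier coefficient; the integral over the box contributes
    \<open>(2 * pi) ^ CARD('d)\<close>, which cancels two of the three.\<close>
  then have adv: "advect v w k $ r = of_real (?c ^ 3) *
      (LINT x:period_box|lborel. (\<Sum>\<^sub>\<infinity>p. a p * cis (wave (fst p + snd p) \<bullet> x)) * cis (- (wave k \<bullet> x)))"
    by (simp add: advect_def fourier_coeff_def G fourier_const_def[symmetric] mult.assoc scaleR_conv_of_real
        power2_eq_square power3_eq_cube)
  have "((\<lambda>p. of_real (?c ^ 3) * (if fst p + snd p = k then a p * of_real ((2 * pi) ^ CARD('d)) else 0))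
      has_sum (advect v w k $ r)) UNIV"
    unfolding adv by (rule has_sum_cmult_right[OF integral_fourier_series[OF asum]])
  also have "(\<lambda>p. of_real (?c ^ 3) * (if fst p + snd p = k then a p * of_real ((2 * pi) ^ CARD('d)) else 0))
      = (\<lambda>p. if fst p + snd p = k then of_real ?c * a p else 0)"
  proof -
    have "?c ^ 3 * (2 * pi) ^ CARD('d) = ?c"
      using fourier_const_sq[where 'd = 'd] by (simp add: power3_eq_cube power2_eq_square mult.assoc)
    then have "complex_of_real (?c ^ 3) * of_real ((2 * pi) ^ CARD('d)) = of_real ?c"
      unfolding of_real_mult[symmetric] by (rule arg_cong)
    then show ?thesis by (auto simp: fun_eq_iff mult_ac)
  qed
  finally have "((\<lambda>p. if fst p + snd p = k then of_real ?c * a p else 0) has_sum (advect v w k $ r)) UNIV" .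
  then have "((\<lambda>p. of_real ?c * a p) has_sum (advect v w k $ r)) (range (\<lambda>h. (h, k - h)))"
    by (rule has_sum_cong_neutral[THEN iffD1, rotated -1]) (auto simp: image_iff)
  then have "((\<lambda>p. of_real ?c * a p) \<circ> (\<lambda>h. (h, k - h)) has_sum (advect v w k $ r)) UNIV"
    by (subst (asm) has_sum_reindex) (auto simp: inj_on_def)
  also have "((\<lambda>p. of_real ?c * a p) \<circ> (\<lambda>h. (h, k - h))) = (\<lambda>h. \<Sum>s\<in>UNIV. of_real ?c *
      (v h $ s * (\<i> * of_int ((k - h) $ s) * w (k - h) $ r)))"
    by (simp add: fun_eq_iff a_def dpartial_def sum_distrib_left)
  finally show ?thesis .
qed

subsection \<open>The bilinear map on smooth fields\<close>

lemma cwave_minus [simp]: "cwave (- k) = - cwave k"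
  by (simp add: cwave_def vec_eq_iff)

lemma bdot_cwave_self: "bdot (cwave k) (cwave k) = of_real ((norm (wave k))\<^sup>2)"
  unfolding power2_norm_eq_inner
  by (simp add: bdot_def cwave_def wave_def inner_vec_def flip: of_int_mult of_int_sum)

lemma norm_cwave: "norm (cwave k) = norm (wave k)"
  by (simp add: cwave_def wave_def norm_vec_def L2_set_def)

lemma norm_vector_smult: "norm (c *s z) = norm c * norm (z :: complex ^ 'd::finite)"
  by (simp add: norm_vec_def L2_set_def norm_mult power_mult_distrib real_sqrt_mult flip: sum_distrib_left)

lemma bdot_diff_right: "bdot a (b - c) = bdot a b - bdot a c"
  by (simp add: bdot_def right_diff_distrib sum_subtractf)

lemma bdot_add_right: "bdot a (b + c) = bdot a b + bdot a c"
  by (simp add: bdot_def distrib_left sum.distrib)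

lemma bdot_minus_right: "bdot a (- b) = - bdot a b"
  by (simp add: bdot_def sum_negf)

lemma bdot_smult_right: "bdot a (c *s b) = c * bdot a b"
  by (simp add: bdot_def sum_distrib_left mult_ac)

lemma bdot_scaleR_right: "bdot a (c *\<^sub>R b) = of_real c * bdot a b"
  by (simp add: bdot_def sum_distrib_left scaleR_conv_of_real[where 'a = complex] mult_ac)

lemma leray_divergence_free: "bdot (cwave k) (leray z k) = 0"
proof (cases "k = 0")
  case True
  then show ?thesis by (simp add: bdot_def cwave_def)
next
  case False
  then have "wave k \<noteq> 0" using norm_wave_ge_1[of k] by auto
  then show ?thesis
    by (simp add: leray_def bdot_diff_right bdot_smult_right bdot_cwave_self)
qed

lemma norm_leray_le:
  fixes z :: "'d::finite field"
  shows "norm (leray z k) \<le> (1 + real CARD('d)) * norm (z k)"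
proof (cases "k = 0")
  case True
  then have "leray z k = z k" by (simp add: leray_def)
  then show ?thesis by (simp add: distrib_right)
next
  case False
  then have k: "0 < norm (wave k)" using norm_wave_ge_1[of k] by linarith
  have "norm (leray z k) \<le> norm (z k) + norm ((bdot (cwave k) (z k) / of_real ((norm (wave k))\<^sup>2)) *s cwave k)"
    unfolding leray_def by (rule norm_triangle_ineq4)
  also have "norm ((bdot (cwave k) (z k) / of_real ((norm (wave k))\<^sup>2)) *s cwave k)
      = norm (bdot (cwave k) (z k)) / norm (wave k)"
    using k by (simp add: norm_vector_smult norm_divide norm_cwave power2_eq_square norm_mult)
  also have "\<dots> \<le> real CARD('d) * norm (z k)"
    using norm_bdot_le[of "cwave k" "z k"] k by (simp add: norm_cwave field_simps)
  finally show ?thesis by (simp add: distrib_right)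
qed

lemma leray_add: "leray (\<lambda>k. y k + z k) k = leray y k + leray z k"
  by (simp add: leray_def bdot_add_right add_divide_distrib vec_eq_iff algebra_simps)

lemma leray_scale: "leray (\<lambda>k. c *\<^sub>R z k) k = c *\<^sub>R leray z k"
  by (simp add: leray_def bdot_scaleR_right vec_eq_iff scaleR_conv_of_real[where 'a = complex] algebra_simps)

text \<open>The summand of the convolution formula, named so that bilinearity and symmetry reduce to
  termwise identities and uniqueness of sums.\<close>

definition advect_term :: "'d::finite field \<Rightarrow> 'd field \<Rightarrow> int ^ 'd \<Rightarrow> 'd \<Rightarrow> int ^ 'd \<Rightarrow> complex" where
  "advect_term v w k r h = (\<Sum>s\<in>UNIV. of_real (fourier_const TYPE('d)) *
      (v h $ s * (\<i> * of_int ((k - h) $ s) * w (k - h) $ r)))"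

lemma advect_has_sum:
  assumes "v \<in> smooth_fields" "w \<in> smooth_fields"
  shows "(advect_term v w k r has_sum (advect v w k $ r)) UNIV"
  using advect_convolution[OF assms] by (simp add: advect_term_def[abs_def])

lemma advect_add_left:
  assumes "v \<in> smooth_fields" "v' \<in> smooth_fields" "w \<in> smooth_fields"
  shows "advect (\<lambda>k. v k + v' k) w k = advect v w k + advect v' w k"
proof -
  have eq: "advect_term (\<lambda>k. v k + v' k) w k r = (\<lambda>h. advect_term v w k r h + advect_term v' w k r h)" for r
    unfolding advect_term_def sum.distrib[symmetric] by (intro ext sum.cong) (auto simp: algebra_simps)
  have "advect (\<lambda>k. v k + v' k) w k $ r = advect v w k $ r + advect v' w k $ r" for r
    using advect_has_sum[OF smooth_fields_add[OF assms(1,2)] assms(3), of k r, unfolded eq]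
      has_sum_add[OF advect_has_sum[OF assms(1,3), of k r] advect_has_sum[OF assms(2,3), of k r]]
    by (rule has_sum_unique)
  then show ?thesis by (simp add: vec_eq_iff)
qed

lemma advect_add_right:
  assumes "v \<in> smooth_fields" "w \<in> smooth_fields" "w' \<in> smooth_fields"
  shows "advect v (\<lambda>k. w k + w' k) k = advect v w k + advect v w' k"
proof -
  have eq: "advect_term v (\<lambda>k. w k + w' k) k r = (\<lambda>h. advect_term v w k r h + advect_term v w' k r h)" for r
    unfolding advect_term_def sum.distrib[symmetric] by (intro ext sum.cong) (auto simp: algebra_simps)
  have "advect v (\<lambda>k. w k + w' k) k $ r = advect v w k $ r + advect v w' k $ r" for r
    using advect_has_sum[OF assms(1) smooth_fields_add[OF assms(2,3)], of k r, unfolded eq]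
      has_sum_add[OF advect_has_sum[OF assms(1,2), of k r] advect_has_sum[OF assms(1,3), of k r]]
    by (rule has_sum_unique)
  then show ?thesis by (simp add: vec_eq_iff)
qed

lemma advect_scale_left:
  assumes "v \<in> smooth_fields" "w \<in> smooth_fields"
  shows "advect (\<lambda>k. c *\<^sub>R v k) w k = c *\<^sub>R advect v w k"
proof -
  have eq: "advect_term (\<lambda>k. c *\<^sub>R v k) w k r = (\<lambda>h. of_real c * advect_term v w k r h)" for r
    unfolding advect_term_def sum_distrib_left
    by (intro ext sum.cong) (simp_all add: scaleR_conv_of_real[where 'a = complex])
  have "advect (\<lambda>k. c *\<^sub>R v k) w k $ r = of_real c * advect v w k $ r" for r
    using advect_has_sum[OF smooth_fields_scale[OF assms(1)] assms(2), of c k r, unfolded eq]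
      has_sum_cmult_right[OF advect_has_sum[OF assms, of k r], of "of_real c"]
    by (rule has_sum_unique)
  then show ?thesis by (simp add: vec_eq_iff scaleR_conv_of_real[where 'a = complex])
qed

lemma advect_scale_right:
  assumes "v \<in> smooth_fields" "w \<in> smooth_fields"
  shows "advect v (\<lambda>k. c *\<^sub>R w k) k = c *\<^sub>R advect v w k"
proof -
  have eq: "advect_term v (\<lambda>k. c *\<^sub>R w k) k r = (\<lambda>h. of_real c * advect_term v w k r h)" for r
    unfolding advect_term_def sum_distrib_left
    by (intro ext sum.cong) (simp_all add: scaleR_conv_of_real[where 'a = complex])
  have "advect v (\<lambda>k. c *\<^sub>R w k) k $ r = of_real c * advect v w k $ r" for r
    using advect_has_sum[OF assms(1) smooth_fields_scale[OF assms(2)], of c k r, unfolded eq]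
      has_sum_cmult_right[OF advect_has_sum[OF assms, of k r], of "of_real c"]
    by (rule has_sum_unique)
  then show ?thesis by (simp add: vec_eq_iff scaleR_conv_of_real[where 'a = complex])
qed

text \<open>The substitution of \<open>- h\<close> for \<open>h\<close> in the convolution
  conjugates every summand.\<close>

lemma advect_real:
  assumes v: "v \<in> smooth_fields" and w: "w \<in> smooth_fields"
  shows "advect v w (- k) $ r = cnj (advect v w k $ r)"
proof -
  have rv: "v (- j) $ s = cnj (v j $ s)" and rw: "w (- j) $ s = cnj (w j $ s)" for j s
    using v w by (auto simp: smooth_fields_iff solenoidal_def)
  have eq: "advect_term v w (- k) r (- h) = cnj (advect_term v w k r h)" for h
  proof -
    have "- k - - h = - (k - h)" by simp
    then show ?thesis
      unfolding advect_term_def cnj_sum by (simp only: rv rw) (rule sum.cong, auto simp: algebra_simps)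
  qed
  have "(advect_term v w (- k) r has_sum (advect v w (- k) $ r)) UNIV"
    by (rule advect_has_sum[OF v w])
  then have "((\<lambda>h. advect_term v w (- k) r (- h)) has_sum (advect v w (- k) $ r)) UNIV"
    by (subst has_sum_reindex_bij_betw[of uminus UNIV UNIV "advect_term v w (- k) r"]) (auto simp: bij_uminus)
  moreover have "((\<lambda>h. cnj (advect_term v w k r h)) has_sum cnj (advect v w k $ r)) UNIV"
    unfolding has_sum_cnj_iff by (rule advect_has_sum[OF v w])
  ultimately show ?thesis unfolding eq by (rule has_sum_unique)
qed

text \<open>At frequency 0 the derivative falls on the mode \<open>- h\<close> of \<open>w\<close>,
  so each summand contains the divergence \<open>bdot (cwave h) (v h)\<close>: transport by a
  divergence free field has zero mean.\<close>

lemma advect_0: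
  fixes v :: "'d::finite field"
  assumes v: "v \<in> smooth_fields" and w: "w \<in> smooth_fields"
  shows "advect v w 0 = 0"
proof -
  have "advect v w 0 $ r = 0" for r
  proof -
    have "advect_term v w 0 r h
      = - (of_real (fourier_const TYPE('d)) * \<i> * w (- h) $ r * bdot (cwave h) (v h))" for h
      by (simp add: advect_term_def bdot_def cwave_def sum_distrib_left sum_negf mult_ac)
    moreover have "bdot (cwave h) (v h) = 0" for h
      using v by (simp add: smooth_fields_iff solenoidal_def)
    ultimately show ?thesis
      using has_sum_unique[OF advect_has_sum[OF v w, of 0 r] has_sum_0] by simp
  qed
  then show ?thesis by (simp add: vec_eq_iff)
qed

text \<open>The inequality \<open>1 + |k| \<le> (1 + |h|) * (1 + |k - h|)\<close> distributes the
  weight over the two factors of the convolution. One more power is spent on \<open>w\<close> to pay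
  for its derivative, and the summability of the weighted \<open>v\<close> closes the sum.\<close>

lemma advect_decay:
  fixes v :: "'d::finite field"
  assumes v: "v \<in> smooth_fields" and w: "w \<in> smooth_fields"
  obtains C where "0 \<le> C" "\<And>k. (1 + norm (wave k)) ^ q * norm (advect v w k) \<le> C"
proof -
  let ?c = "fourier_const TYPE('d)"
  obtain B where B: "0 \<le> B" "\<And>k. (1 + norm (wave k)) ^ Suc q * norm (w k) \<le> B"
    using smooth_fields_decay[OF w] by blast
  define g where "g = (\<lambda>h. (real CARD('d) * ?c * B) * ((1 + norm (wave h)) ^ q * norm (v h)))"
  have gs: "g summable_on UNIV"
    unfolding g_def by (intro summable_on_cmult_right smooth_fields_summable[OF v])
  have comp: "(1 + norm (wave k)) ^ q * norm (advect v w k $ r) \<le> infsum g UNIV" for k r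
  proof -
    let ?f = "\<lambda>h. of_real ((1 + norm (wave k)) ^ q) * (\<Sum>s\<in>UNIV. of_real ?c * (v h $ s * (\<i> * of_int ((k - h) $ s) * w (k - h) $ r)))"
    have hs: "(?f has_sum (of_real ((1 + norm (wave k)) ^ q) * (advect v w k $ r))) UNIV"
      by (intro has_sum_cmult_right advect_convolution[OF v w])
    have nk: "norm (complex_of_real ((1 + norm (wave k)) ^ q)) = (1 + norm (wave k)) ^ q"
      by (simp only: norm_of_real) simp
    have le: "norm (?f h) \<le> g h" for h
    proof -
      let ?l = "k - h"
      have s: "norm (of_real ?c * (v h $ s * (\<i> * of_int (?l $ s) * w ?l $ r)))
          \<le> ?c * (norm (v h) * ((1 + norm (wave ?l)) * norm (w ?l)))" for s
      proof -
        have "\<bar>wave ?l $ s\<bar> \<le> norm (wave ?l)" by (rule component_le_norm_cart)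
        then have "\<bar>real_of_int (?l $ s)\<bar> \<le> 1 + norm (wave ?l)" by (simp add: wave_def)
        then have "norm (v h $ s) * (\<bar>real_of_int (?l $ s)\<bar> * norm (w ?l $ r))
            \<le> norm (v h) * ((1 + norm (wave ?l)) * norm (w ?l))"
          by (intro mult_mono Finite_Cartesian_Product.norm_nth_le) auto
        from mult_left_mono[OF this, of ?c] show ?thesis
          by (simp add: norm_mult del: of_int_diff vector_minus_component)
      qed
      have "(1 + norm (wave k)) \<le> (1 + norm (wave h)) * (1 + norm (wave ?l))"
      proof -
        have "norm (wave k) \<le> norm (wave h) + norm (wave ?l)"
          using norm_triangle_ineq[of "wave h" "wave ?l"] by (simp add: wave_diff)
        moreover have "0 \<le> norm (wave h) * norm (wave ?l)" by simp
        ultimately show ?thesis by (simp only: distrib_left distrib_right mult_1 mult_1_right)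
      qed
      then have kq: "(1 + norm (wave k)) ^ q \<le> (1 + norm (wave h)) ^ q * (1 + norm (wave ?l)) ^ q"
        unfolding power_mult_distrib[symmetric] by (intro power_mono) auto
      have "norm (\<Sum>s\<in>UNIV. of_real ?c * (v h $ s * (\<i> * of_int (?l $ s) * w ?l $ r)))
          \<le> (\<Sum>s\<in>(UNIV :: 'd set). ?c * (norm (v h) * ((1 + norm (wave ?l)) * norm (w ?l))))"
        by (rule order_trans[OF norm_sum sum_mono[OF s]])
      then have "norm (?f h) \<le> (1 + norm (wave k)) ^ q * (real CARD('d) * (?c * (norm (v h) * ((1 + norm (wave ?l)) * norm (w ?l)))))"
        unfolding norm_mult nk by (intro mult_left_mono) auto
      also have "\<dots> \<le> ((1 + norm (wave h)) ^ q * (1 + norm (wave ?l)) ^ q) * (real CARD('d) * (?c * (norm (v h) * ((1 + norm (wave ?l)) * norm (w ?l)))))"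
        by (intro mult_right_mono kq) auto
      also have "\<dots> = (real CARD('d) * ?c) * ((1 + norm (wave h)) ^ q * norm (v h)) * ((1 + norm (wave ?l)) ^ Suc q * norm (w ?l))"
        by (simp add: mult_ac)
      also have "\<dots> \<le> (real CARD('d) * ?c) * ((1 + norm (wave h)) ^ q * norm (v h)) * B"
        by (intro mult_left_mono B) auto
      also have "\<dots> = g h" by (simp add: g_def mult_ac)
      finally show ?thesis .
    qed
    have "norm (of_real ((1 + norm (wave k)) ^ q) * (advect v w k $ r)) \<le> infsum g UNIV"
      by (rule norm_infsum_le[OF hs has_sum_infsum[OF gs]]) (use le in blast)
    moreover have "norm (of_real ((1 + norm (wave k)) ^ q) * (advect v w k $ r)) = (1 + norm (wave k)) ^ q * norm (advect v w k $ r)"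
      by (simp only: norm_mult norm_of_real) simp
    ultimately show ?thesis by simp
  qed
  show ?thesis
  proof (rule that)
    show "0 \<le> real CARD('d) * infsum g UNIV"
      using B(1) by (intro mult_nonneg_nonneg infsum_nonneg) (auto simp: g_def)
    fix k
    have "norm (advect v w k) \<le> (\<Sum>r\<in>UNIV. norm (advect v w k $ r))"
      by (simp add: norm_vec_def L2_set_le_sum)
    then have "(1 + norm (wave k)) ^ q * norm (advect v w k) \<le> (\<Sum>r\<in>UNIV. (1 + norm (wave k)) ^ q * norm (advect v w k $ r))"
      by (simp add: mult_left_mono flip: sum_distrib_left)
    also have "\<dots> \<le> (\<Sum>r\<in>(UNIV :: 'd set). infsum g UNIV)" by (intro sum_mono comp)
    finally show "(1 + norm (wave k)) ^ q * norm (advect v w k) \<le> real CARD('d) * infsum g UNIV" by simp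
  qed
qed

text \<open>This cannot be read off from \<open>basic_consts\<close>: a field with divergent sum has
  norm 0 by default, so a bound on the norm does not give membership in the space. Decay of the
  coefficients does.\<close>

lemma nse_bilin_smooth:
  fixes v :: "'d::finite field"
  assumes v: "v \<in> smooth_fields" and w: "w \<in> smooth_fields"
  shows "nse_bilin v w \<in> smooth_fields"
proof (rule decay_imp_smooth)
  show "solenoidal (nse_bilin v w)"
    unfolding solenoidal_def
  proof (intro conjI allI)
    fix k r
    have bd: "bdot (cwave (- k)) (advect v w (- k)) = - cnj (bdot (cwave k) (advect v w k))"
      by (simp add: bdot_def advect_real[OF v w] cwave_def sum_negf)
    show "nse_bilin v w (- k) $ r = cnj (nse_bilin v w k $ r)"
      by (simp add: nse_bilin_def leray_def bd advect_real[OF v w] del: cwave_minus) (simp add: cwave_def)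
    show "bdot (cwave k) (nse_bilin v w k) = 0"
      by (simp add: nse_bilin_def bdot_minus_right leray_divergence_free)
  next
    show "nse_bilin v w 0 = 0"
      by (simp add: nse_bilin_def leray_def advect_0[OF v w] bdot_def)
  qed
  fix q :: real assume q: "0 \<le> q"
  obtain C where C: "\<And>k. (1 + norm (wave k)) ^ (nat \<lceil>q\<rceil>) * norm (advect v w k) \<le> C"
    using advect_decay[OF v w] by blast
  have "norm (wave k) powr q * norm (nse_bilin v w k) \<le> (1 + real CARD('d)) * C" if k: "k \<noteq> 0" for k
  proof -
    have k1: "1 \<le> norm (wave k)" by (rule norm_wave_ge_1[OF k])
    have "norm (wave k) powr q \<le> norm (wave k) powr real (nat \<lceil>q\<rceil>)"
      using k1 by (intro powr_mono) (auto simp: real_nat_ceiling_ge)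
    also have "\<dots> = norm (wave k) ^ (nat \<lceil>q\<rceil>)" using k1 by (subst powr_realpow) auto
    also have "\<dots> \<le> (1 + norm (wave k)) ^ (nat \<lceil>q\<rceil>)" by (intro power_mono) auto
    finally have "norm (wave k) powr q * norm (nse_bilin v w k)
        \<le> (1 + norm (wave k)) ^ (nat \<lceil>q\<rceil>) * ((1 + real CARD('d)) * norm (advect v w k))"
      using norm_leray_le[of "advect v w" k] by (intro mult_mono) (auto simp: nse_bilin_def)
    also have "\<dots> = (1 + real CARD('d)) * ((1 + norm (wave k)) ^ (nat \<lceil>q\<rceil>) * norm (advect v w k))" by simp
    also have "\<dots> \<le> (1 + real CARD('d)) * C" by (intro mult_left_mono C) auto
    finally show ?thesis .
  qed
  then show "\<exists>C. \<forall>k. k \<noteq> 0 \<longrightarrow> norm (wave k) powr q * norm (nse_bilin v w k) \<le> C" by blast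
qed

lemma nse_bilin_add_left:
  assumes "v \<in> smooth_fields" "v' \<in> smooth_fields" "w \<in> smooth_fields"
  shows "nse_bilin (\<lambda>k. v k + v' k) w k = nse_bilin v w k + nse_bilin v' w k"
proof -
  have "advect (\<lambda>k. v k + v' k) w = (\<lambda>k. advect v w k + advect v' w k)"
    using advect_add_left[OF assms] by blast
  then show ?thesis by (simp add: nse_bilin_def leray_add)
qed

lemma nse_bilin_add_right:
  assumes "v \<in> smooth_fields" "w \<in> smooth_fields" "w' \<in> smooth_fields"
  shows "nse_bilin v (\<lambda>k. w k + w' k) k = nse_bilin v w k + nse_bilin v w' k"
proof -
  have "advect v (\<lambda>k. w k + w' k) = (\<lambda>k. advect v w k + advect v w' k)"
    using advect_add_right[OF assms] by blast
  then show ?thesis by (simp add: nse_bilin_def leray_add)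
qed

lemma nse_bilin_scale_left:
  assumes "v \<in> smooth_fields" "w \<in> smooth_fields"
  shows "nse_bilin (\<lambda>k. c *\<^sub>R v k) w k = c *\<^sub>R nse_bilin v w k"
proof -
  have "advect (\<lambda>k. c *\<^sub>R v k) w = (\<lambda>k. c *\<^sub>R advect v w k)"
    using advect_scale_left[OF assms] by blast
  then show ?thesis by (simp add: nse_bilin_def leray_scale)
qed

lemma nse_bilin_scale_right:
  assumes "v \<in> smooth_fields" "w \<in> smooth_fields"
  shows "nse_bilin v (\<lambda>k. c *\<^sub>R w k) k = c *\<^sub>R nse_bilin v w k"
proof -
  have "advect v (\<lambda>k. c *\<^sub>R w k) = (\<lambda>k. c *\<^sub>R advect v w k)"
    using advect_scale_right[OF assms] by blast
  then show ?thesis by (simp add: nse_bilin_def leray_scale)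
qed

lemma nse_bilin_diff_left:
  assumes "v \<in> smooth_fields" "v' \<in> smooth_fields" "w \<in> smooth_fields"
  shows "nse_bilin (\<lambda>k. v k - v' k) w k = nse_bilin v w k - nse_bilin v' w k"
  using nse_bilin_add_left[OF assms(1) smooth_fields_scale[OF assms(2), of "-1"] assms(3), of k]
    nse_bilin_scale_left[OF assms(2,3), of "-1" k] by simp

lemma nse_bilin_diff_right:
  assumes "v \<in> smooth_fields" "w \<in> smooth_fields" "w' \<in> smooth_fields"
  shows "nse_bilin v (\<lambda>k. w k - w' k) k = nse_bilin v w k - nse_bilin v w' k"
  using nse_bilin_add_right[OF assms(1,2) smooth_fields_scale[OF assms(3), of "-1"], of k]
    nse_bilin_scale_right[OF assms(1,3), of "-1" k] by simp

lemma basic_constsD: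
  fixes v :: "'d::finite field"
  assumes "basic_consts TYPE('d) K" "real CARD('d) / 2 < n" "v \<in> smooth_fields" "w \<in> smooth_fields"
  shows "sob_norm n (nse_bilin v w) \<le> K n * sob_norm n v * sob_norm (n + 1) w" "0 < K n"
  using assms by (auto simp: basic_consts_def smooth_fields_sobolev)

lemma nse_bilin_dist_le:
  fixes v v' w w' :: "'d::finite field"
  assumes K: "basic_consts TYPE('d) K" "real CARD('d) / 2 < n"
    and S: "v \<in> smooth_fields" "v' \<in> smooth_fields" "w \<in> smooth_fields" "w' \<in> smooth_fields"
  shows "sob_norm n (\<lambda>k. nse_bilin v w k - nse_bilin v' w' k)
    \<le> K n * sob_norm n (\<lambda>k. v k - v' k) * sob_norm (n + 1) w
      + K n * sob_norm n v' * sob_norm (n + 1) (\<lambda>k. w k - w' k)"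
proof -
  have "sob_norm n (\<lambda>k. nse_bilin v w k - nse_bilin v' w' k)
      = sob_norm n (\<lambda>k. nse_bilin (\<lambda>k. v k - v' k) w k + nse_bilin v' (\<lambda>k. w k - w' k) k)"
    by (simp add: nse_bilin_diff_left nse_bilin_diff_right S)
  also have "\<dots> \<le> sob_norm n (nse_bilin (\<lambda>k. v k - v' k) w) + sob_norm n (nse_bilin v' (\<lambda>k. w k - w' k))"
    by (intro sob_norm_triangle smooth_fields_finite nse_bilin_smooth smooth_fields_diff S)
  also have "\<dots> \<le> K n * sob_norm n (\<lambda>k. v k - v' k) * sob_norm (n + 1) w
      + K n * sob_norm n v' * sob_norm (n + 1) (\<lambda>k. w k - w' k)"
    by (intro add_mono basic_constsD(1)[OF K] smooth_fields_diff S)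
  finally show ?thesis .
qed

lemma limitin_frechet_nse_bilin:
  fixes v w :: "'d::finite field"
  assumes K: "basic_consts TYPE('d) K"
    and X: "limitin frechet X v F" and Y: "limitin frechet Y w F"
  shows "limitin frechet (\<lambda>x. nse_bilin (X x) (Y x)) (nse_bilin v w) F"
proof -
  note x = X[unfolded limitin_frechet_iff] and y = Y[unfolded limitin_frechet_iff]
  have xy: "\<forall>\<^sub>F i in F. X i \<in> smooth_fields \<and> Y i \<in> smooth_fields"
    using x y by (auto intro: eventually_conj)
  have "((\<lambda>i. sob_norm p (\<lambda>k. nse_bilin (X i) (Y i) k - nse_bilin v w k)) \<longlongrightarrow> 0) F" for p
  proof -
    \<comment> \<open>The basic inequality holds for orders above half the dimension; smaller orders
      \<open>p\<close> are dominated by such an \<open>n\<close>.\<close>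
    define n where "n = max p (real CARD('d) / 2 + 1)"
    have n: "real CARD('d) / 2 < n" "p \<le> n" unfolding n_def by (rule less_le_trans[OF _ max.cobounded2]) simp_all
    let ?b = "\<lambda>i. K n * sob_norm n (\<lambda>k. X i k - v k) * sob_norm (n + 1) (Y i)
      + K n * sob_norm n v * sob_norm (n + 1) (\<lambda>k. Y i k - w k)"
    have "(?b \<longlongrightarrow> K n * 0 * sob_norm (n + 1) w + K n * sob_norm n v * 0) F"
      using x y by (intro tendsto_intros limitin_frechet_sob_norm[OF Y]) auto
    then have b: "(?b \<longlongrightarrow> 0) F" by simp
    have "\<forall>\<^sub>F i in F. sob_norm p (\<lambda>k. nse_bilin (X i) (Y i) k - nse_bilin v w k) \<le> ?b i"
      using xy
    proof eventually_elim
      case (elim i)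
      have "sob_norm p (\<lambda>k. nse_bilin (X i) (Y i) k - nse_bilin v w k)
          \<le> sob_norm n (\<lambda>k. nse_bilin (X i) (Y i) k - nse_bilin v w k)"
        using elim x y by (intro sob_norm_order_mono n smooth_fields_finite smooth_fields_diff nse_bilin_smooth) auto
      also have "\<dots> \<le> ?b i" using elim x y by (intro nse_bilin_dist_le K n) auto
      finally show ?case .
    qed
    then show ?thesis by (intro tendsto_sandwich[OF _ _ tendsto_const b]) auto
  qed
  moreover have "\<forall>\<^sub>F i in F. nse_bilin (X i) (Y i) \<in> smooth_fields"
    using xy by eventually_elim (auto intro: nse_bilin_smooth)
  ultimately show ?thesis using x y by (auto simp: limitin_frechet_iff nse_bilin_smooth)
qed

text \<open>Product rule: the difference quotient splits into the quotient of \<open>v\<close>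
  against \<open>w s\<close> and \<open>v t\<close> against the quotient of \<open>w\<close>, and
  the bilinear map is jointly continuous.\<close>

lemma has_time_deriv_nse_bilin:
  fixes v w :: "real \<Rightarrow> 'd::finite field"
  assumes K: "basic_consts TYPE('d) K"
    and v: "time_Ck 0 I v" "has_time_deriv I v v' t" and w: "time_Ck 0 I w" "has_time_deriv I w w' t"
    and t: "t \<in> I"
  shows "has_time_deriv I (\<lambda>t. nse_bilin (v t) (w t)) (\<lambda>k. nse_bilin v' (w t) k + nse_bilin (v t) w' k) t"
proof -
  have St: "v t \<in> smooth_fields" "w t \<in> smooth_fields" using v w t time_Ck_smooth by blast+
  have lim: "limitin frechet (\<lambda>s k. nse_bilin (\<lambda>k. (1 / (s - t)) *\<^sub>R (v s k - v t k)) (w s) k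
      + nse_bilin (v t) (\<lambda>k. (1 / (s - t)) *\<^sub>R (w s k - w t k)) k)
      (\<lambda>k. nse_bilin v' (w t) k + nse_bilin (v t) w' k) (at t within I)"
    by (intro limitin_frechet_add limitin_frechet_nse_bilin[OF K] v(2)[unfolded has_time_deriv_eq]
        w(2)[unfolded has_time_deriv_eq] time_Ck_limit[OF w(1) t] limitin_frechet_const St)
  have ev: "\<forall>\<^sub>F s in at t within I. (\<lambda>k. nse_bilin (\<lambda>k. (1 / (s - t)) *\<^sub>R (v s k - v t k)) (w s) k
      + nse_bilin (v t) (\<lambda>k. (1 / (s - t)) *\<^sub>R (w s k - w t k)) k)
      = (\<lambda>k. (1 / (s - t)) *\<^sub>R (nse_bilin (v s) (w s) k - nse_bilin (v t) (w t) k))"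
    unfolding eventually_at_filter
  proof (intro always_eventually allI impI)
    fix s assume "s \<in> I"
    then have Ss: "v s \<in> smooth_fields" "w s \<in> smooth_fields" using v w time_Ck_smooth by blast+
    show "(\<lambda>k. nse_bilin (\<lambda>k. (1 / (s - t)) *\<^sub>R (v s k - v t k)) (w s) k
      + nse_bilin (v t) (\<lambda>k. (1 / (s - t)) *\<^sub>R (w s k - w t k)) k)
      = (\<lambda>k. (1 / (s - t)) *\<^sub>R (nse_bilin (v s) (w s) k - nse_bilin (v t) (w t) k))"
      by (simp only: nse_bilin_scale_left nse_bilin_scale_right smooth_fields_diff Ss St
          nse_bilin_diff_left nse_bilin_diff_right) (simp add: algebra_simps)
  qed
  show ?thesis
    unfolding has_time_deriv_eq by (rule limitin_transform_eventually[OF ev lim])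
qed

lemma time_Ck_nse_bilin:
  fixes v w :: "real \<Rightarrow> 'd::finite field"
  assumes K: "basic_consts TYPE('d) K"
  shows "time_Ck m I v \<Longrightarrow> time_Ck m I w \<Longrightarrow> time_Ck m I (\<lambda>t. nse_bilin (v t) (w t))"
proof (induction m arbitrary: v w)
  case 0
  then show ?case unfolding time_Ck_0_iff by (blast intro: limitin_frechet_nse_bilin[OF K])
next
  case (Suc m)
  from Suc.prems obtain v' w' where d:
    "\<forall>t\<in>I. has_time_deriv I v (v' t) t" "\<forall>t\<in>I. has_time_deriv I w (w' t) t"
    and c: "time_Ck m I v'" "time_Ck m I w'" "time_Ck 0 I v" "time_Ck 0 I w"
    by (auto simp del: time_Ck.simps simp: time_Ck_Suc_iff)
  have "time_Ck 0 I (\<lambda>t. nse_bilin (v t) (w t))"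
    using c unfolding time_Ck_0_iff by (blast intro: limitin_frechet_nse_bilin[OF K])
  moreover have "time_Ck m I (\<lambda>t k. nse_bilin (v' t) (w t) k + nse_bilin (v t) (w' t) k)"
    using time_Ck_add[OF Suc.IH[OF c(1) time_Ck_SucD[OF Suc.prems(2)]] Suc.IH[OF time_Ck_SucD[OF Suc.prems(1)] c(2)]] .
  ultimately show ?case
    unfolding time_Ck_Suc_iff
    by (intro conjI exI[of _ "\<lambda>t k. nse_bilin (v' t) (w t) k + nse_bilin (v t) (w' t) k"])
      (use d c in \<open>auto simp del: time_Ck.simps intro: has_time_deriv_nse_bilin[OF K]\<close>)
qed

definition nse_rhs :: "real \<Rightarrow> (real \<Rightarrow> 'd::finite field) \<Rightarrow> real \<Rightarrow> 'd field \<Rightarrow> 'd field" where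
  "nse_rhs \<nu> f t v = (\<lambda>k. \<nu> *\<^sub>R laplacian v k + nse_bilin v v k + f t k)"

text \<open>Bootstrapping: the right-hand side of the equation is as regular in time as the solution.\<close>

lemma time_smooth_of_equation:
  fixes u :: "real \<Rightarrow> 'd::finite field"
  assumes K: "basic_consts TYPE('d) K" and f: "time_smooth I f"
    and u: "\<And>t. t \<in> I \<Longrightarrow> u t \<in> smooth_fields"
    and d: "\<And>t. t \<in> I \<Longrightarrow> has_time_deriv I u (nse_rhs \<nu> f t (u t)) t"
  shows "time_smooth I u"
  unfolding time_smooth_def
proof
  fix m
  have c: "time_Ck 0 I u"
    unfolding time_Ck_0_iff using has_time_deriv_imp_limit d u by blast
  show "time_Ck m I u"
  proof (induction m)
    case (Suc m)
    have fm: "time_Ck m I f" using f by (simp add: time_smooth_def)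
    have "time_Ck m I (\<lambda>t. nse_rhs \<nu> f t (u t))"
      unfolding nse_rhs_def
      by (rule time_Ck_add[OF time_Ck_add[OF time_Ck_scale[OF time_Ck_laplacian[OF Suc]] time_Ck_nse_bilin[OF K Suc Suc]] fm])
    then show ?case
      unfolding time_Ck_Suc_iff using c d by (intro conjI exI[of _ "\<lambda>t. nse_rhs \<nu> f t (u t)"] ballI)
  qed (rule c)
qed

section \<open>Half-open time intervals and their right neighbourhoods\<close>

lemma time_ivl_downward: "s \<in> time_ivl T \<Longrightarrow> 0 \<le> r \<Longrightarrow> r \<le> s \<Longrightarrow> r \<in> time_ivl T"
  by (auto simp: time_ivl_def intro: le_less_trans[of "ereal r" "ereal s"])

lemma time_ivl_atLeastAtMost: "s \<in> time_ivl T \<Longrightarrow> {0..s} \<subseteq> time_ivl T"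
  using time_ivl_downward by auto

lemma time_ivl_nonneg: "t \<in> time_ivl T \<Longrightarrow> 0 \<le> t"
  by (simp add: time_ivl_def)

lemma zero_in_time_ivl: "0 < T \<Longrightarrow> 0 \<in> time_ivl T"
  by (simp add: time_ivl_def flip: zero_ereal_def)

lemma time_ivl_right:
  assumes "t \<in> time_ivl T"
  obtains c where "t < c" "c \<in> time_ivl T"
proof -
  have "ereal t < T" "0 \<le> t" using assms by (auto simp: time_ivl_def)
  then obtain c where "ereal t < ereal c" "ereal c < T" using ereal_dense2 by blast
  with \<open>0 \<le> t\<close> show ?thesis by (intro that[of c]) (auto simp: time_ivl_def)
qed

lemma time_ivl_mono: "S \<le> T \<Longrightarrow> time_ivl S \<subseteq> time_ivl T"
  by (auto simp: time_ivl_def)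

lemma at_within_time_ivl:
  assumes "t < c" "c \<in> time_ivl T"
  shows "at t within time_ivl T = at t within {0..c}"
  by (rule at_within_nhd[of t "{..<c}"])
     (use assms in \<open>auto intro: time_ivl_nonneg time_ivl_downward[OF assms(2)]\<close>)

lemma at_within_time_ivl_neq_bot:
  assumes "t \<in> time_ivl T"
  shows "at t within time_ivl T \<noteq> bot"
proof -
  obtain c where c: "t < c" "c \<in> time_ivl T" by (rule time_ivl_right[OF assms])
  have "at t within {t..c} \<le> at t within time_ivl T"
    using c assms time_ivl_nonneg[OF assms] by (intro at_le) (auto intro!: time_ivl_downward[OF c(2)])
  moreover have "at t within {t..c} \<noteq> bot" using c by (simp add: at_within_Icc_at_right)
  ultimately show ?thesis by (metis bot.extremum_uniqueI)
qed

lemma filterlim_time_ivl_right: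
  assumes "t \<in> time_ivl T"
  shows "filterlim (\<lambda>h. t + h) (at t within time_ivl T) (at_right 0)"
proof -
  obtain c where c: "t < c" "c \<in> time_ivl T" by (rule time_ivl_right[OF assms])
  have "filterlim (\<lambda>h. t + h) (at_right t) (at_right 0)"
    by (simp add: filterlim_def filtermap_nhds_shift at_right_to_0[of t] add.commute)
  then have "filterlim (\<lambda>h. t + h) (at t within {t..c}) (at_right 0)"
    using c by (simp add: at_within_Icc_at_right)
  moreover have "at t within {t..c} \<le> at t within time_ivl T"
    using c assms time_ivl_nonneg[OF assms] by (intro at_le) (auto intro!: time_ivl_downward[OF c(2)])
  ultimately show ?thesis by (rule filterlim_mono) auto
qed

subsection \<open>Comparison with Dini derivatives\<close>

lemma right_quotient_tendsto:
  assumes "(R has_real_derivative d) (at t within time_ivl T)" "t \<in> time_ivl T"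
  shows "((\<lambda>h. (R (t + h) - R t) / h) \<longlongrightarrow> d) (at_right 0)"
  using filterlim_compose[OF assms(1)[unfolded has_field_derivative_iff] filterlim_time_ivl_right[OF assms(2)]]
  by simp

lemma dini_eq_derivative:
  assumes "(R has_real_derivative d) (at t within time_ivl T)" "t \<in> time_ivl T"
  shows "dini R t = ereal d"
  unfolding dini_def using right_quotient_tendsto[OF assms]
  by (intro lim_imp_Limsup) auto

lemma dini_ge_frequently:
  assumes "ereal c \<le> dini R t" "c' < c"
  shows "\<exists>\<^sub>F h in at_right 0. c' < (R (t + h) - R t) / h"
proof (rule ccontr)
  assume "\<not> ?thesis"
  then have "\<forall>\<^sub>F h in at_right 0. ereal ((R (t + h) - R t) / h) \<le> ereal c'"
    by (simp add: frequently_def not_less)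
  then have "dini R t \<le> ereal c'" unfolding dini_def by (rule Limsup_bounded)
  with assms show False by (meson ereal_less_eq(3) not_le order_trans)
qed

text \<open>The margin \<open>E\<close> grows at the rate \<open>L + 1\<close>, one more than the
  factor \<open>L\<close> by which \<open>g\<close> can drive \<open>R\<close> and
  \<open>\<phi>\<close> apart; this is violated just after the last time \<open>s\<close> at which
  \<open>R - \<phi> + E\<close> is nonnegative. \<open>dini R\<close> controls only some arbitrarily
  small \<open>h\<close>, but the growth of \<open>\<phi>\<close> is controlled for all small
  \<open>h\<close>, so that both can be used at a common \<open>h\<close>. The continuous function
  \<open>m\<close> takes the place of a Lipschitz condition on \<open>g\<close>.\<close>

lemma dini_comparison:
  fixes R \<phi> m :: "real \<Rightarrow> real"
  assumes cR: "continuous_on {0..b} R" and c\<phi>: "continuous_on {0..b} \<phi>" and cm: "continuous_on {0..b} m"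
    and dR: "\<And>t. 0 \<le> t \<Longrightarrow> t < b \<Longrightarrow> ereal (g t (R t)) \<le> dini R t"
    and d\<phi>: "\<And>t \<eta>. 0 \<le> t \<Longrightarrow> t < b \<Longrightarrow> 0 < \<eta> \<Longrightarrow>
       \<forall>\<^sub>F h in at_right 0. \<phi> (t + h) \<le> \<phi> t + h * (g t (\<phi> t) + \<eta>)"
    and gm: "\<And>t. 0 \<le> t \<Longrightarrow> t < b \<Longrightarrow> g t (R t) - g t (\<phi> t) = m t * (R t - \<phi> t)"
    and init: "\<phi> 0 \<le> R 0" and t1: "t1 \<in> {0..b}"
  shows "\<phi> t1 \<le> R t1"
proof (rule ccontr)
  assume "\<not> \<phi> t1 \<le> R t1"
  then have neg: "R t1 - \<phi> t1 < 0" by simp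
  have "bounded (m ` {0..b})"
    by (intro compact_imp_bounded compact_continuous_image cm compact_Icc)
  then obtain L where L: "0 < L" "\<And>t. t \<in> {0..b} \<Longrightarrow> \<bar>m t\<bar> \<le> L"
    unfolding bounded_pos by (metis image_eqI real_norm_def)
  \<comment> \<open>Makes \<open>E t1\<close> half of the gap \<open>\<phi> t1 - R t1\<close>, so
    that \<open>z\<close> is still negative at \<open>t1\<close>.\<close>
  define \<eta> where "\<eta> = (\<phi> t1 - R t1) / (2 * exp ((L + 1) * t1))"
  have \<eta>: "0 < \<eta>" using neg by (simp add: \<eta>_def)
  define E where "E = (\<lambda>t. \<eta> * exp ((L + 1) * t))"
  define z where "z = (\<lambda>t. R t - \<phi> t + E t)"
  have cz: "continuous_on {0..t1} z"
    unfolding z_def E_def using t1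
    by (intro continuous_intros continuous_on_subset[OF cR] continuous_on_subset[OF c\<phi>]) auto
  have "E t1 = (\<phi> t1 - R t1) / 2" by (simp add: E_def \<eta>_def)
  then have "z t1 = (R t1 - \<phi> t1) / 2" by (simp add: z_def field_simps)
  then have zt1: "z t1 < 0" using neg by simp
  have z0: "0 \<le> z 0" using init \<eta> by (simp add: z_def E_def)
  define A where "A = {t \<in> {0..t1}. 0 \<le> z t}"
  have "A = {0..t1} \<inter> z -` {0..}" by (auto simp: A_def)
  then have "compact A"
    using continuous_on_closed_vimage[of "{0..t1}" z] cz
    by (metis closed_atLeast closed_atLeastAtMost compact_Icc compact_Int_closed inf_commute inf_assoc inf.idem)
  moreover have "0 \<in> A" using z0 t1 by (simp add: A_def)
  ultimately obtain s where s: "s \<in> A" "\<And>t. t \<in> A \<Longrightarrow> t \<le> s"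
    using compact_attains_sup[of A] by blast
  have s0: "0 \<le> s" "s < t1" "0 \<le> z s" using s zt1 by (auto simp: A_def order_less_le)
  obtain x where x: "s \<le> x" "x \<le> t1" "z x = 0"
    using IVT2'[of z t1 0 s] zt1 s0 continuous_on_subset[OF cz, of "{s..t1}"] by auto
  then have "x \<in> A" using s0 by (simp add: A_def)
  with s(2) x have "x = s" by (simp add: antisym)
  with x have zs: "z s = 0" by simp
  then have ws: "R s - \<phi> s = - E s" by (simp add: z_def)
  have Es: "0 < E s" using \<eta> by (simp add: E_def)
  have sb: "s < b" using s0 t1 by auto
  \<comment> \<open>Each of the two rates is taken up to \<open>E s / 2\<close>; together they
    consume exactly the extra 1 in the rate \<open>L + 1\<close>.\<close>
  have freq: "\<exists>\<^sub>F h in at_right 0. g s (R s) - E s / 2 < (R (s + h) - R s) / h"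
    using Es by (intro dini_ge_frequently[OF dR]) (auto simp: s0 sb)
  have "\<forall>\<^sub>F h in at_right 0. \<phi> (s + h) \<le> \<phi> s + h * (g s (\<phi> s) + E s / 2)"
    using Es s0 sb by (intro d\<phi>) auto
  moreover have "\<forall>\<^sub>F h in at_right 0. h \<in> {0<..<t1 - s}"
    by (intro eventually_at_rightI) (use s0 in auto)
  ultimately have "\<forall>\<^sub>F h in at_right 0. \<not> g s (R s) - E s / 2 < (R (s + h) - R s) / h"
  proof eventually_elim
    case *: (elim h)
    show ?case
    proof
      assume **: "g s (R s) - E s / 2 < (R (s + h) - R s) / h"
      have h: "0 < h" "s + h \<le> t1" using * by auto
      have "s + h \<notin> A" using s(2)[of "s + h"] h by auto
      then have "z (s + h) < 0" using h s0 by (simp add: A_def)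
      then have 1: "R (s + h) - \<phi> (s + h) < - E (s + h)" by (simp add: z_def)
      have "1 + (L + 1) * h \<le> exp ((L + 1) * h)" by (rule exp_ge_add_one_self)
      then have "E s * (1 + (L + 1) * h) \<le> E s * exp ((L + 1) * h)" using Es by (intro mult_left_mono) auto
      also have "\<dots> = E (s + h)" by (simp add: E_def distrib_left exp_add)
      finally have 2: "E s + h * ((L + 1) * E s) \<le> E (s + h)" by (simp add: algebra_simps)
      have 3: "h * (g s (R s) - E s / 2) < R (s + h) - R s"
        using ** h by (simp add: pos_less_divide_eq mult.commute)
      have "\<bar>m s\<bar> \<le> L" using L(2) s0 sb by auto
      then have "m s * E s \<le> L * E s" using Es by (intro mult_right_mono) auto
      then have 4: "- (L * E s) \<le> g s (R s) - g s (\<phi> s)" using gm[OF s0(1) sb] ws by simp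
      have "h * (- (L * E s)) \<le> h * (g s (R s) - g s (\<phi> s))" using 4 h by (intro mult_left_mono) auto
      with 1 2 3 *(1) ws show False by (simp add: algebra_simps)
    qed
  qed
  with freq show False by (simp add: frequently_def)
qed

lemma C1_comparison_rate:
  assumes "(S has_real_derivative d) (at t within time_ivl T)" "t \<in> time_ivl T" "0 < \<eta>"
  shows "\<forall>\<^sub>F h in at_right 0. S (t + h) \<le> S t + h * (d + \<eta>)"
proof -
  have "\<forall>\<^sub>F h in at_right 0. (S (t + h) - S t) / h < d + \<eta>"
    using right_quotient_tendsto[OF assms(1,2)] assms(3) by (intro order_tendstoD(2)) auto
  moreover have "\<forall>\<^sub>F h :: real in at_right 0. 0 < h"
    by (simp add: eventually_at_filter)
  ultimately show ?thesis
    by eventually_elim (simp add: pos_divide_less_eq mult.commute)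
qed

lemma real_C1_continuous: "real_C1 I R \<Longrightarrow> continuous_on I R"
  unfolding real_C1_def continuous_on_eq_continuous_within by (metis DERIV_continuous)

text \<open>The function \<open>m\<close> is the difference quotient of the right-hand side.\<close>

lemma dini_equation_unique:
  assumes R: "real_C1 (time_ivl T) R" "\<And>t. t \<in> time_ivl T \<Longrightarrow> dini R t = ereal (g t (R t))"
    and S: "real_C1 (time_ivl T) S" "\<And>t. t \<in> time_ivl T \<Longrightarrow> dini S t = ereal (g t (S t))"
    and m: "\<And>R S. continuous_on (time_ivl T) R \<Longrightarrow> continuous_on (time_ivl T) S \<Longrightarrow>
      \<exists>m. continuous_on (time_ivl T) m \<and> (\<forall>t\<in>time_ivl T. g t (R t) - g t (S t) = m t * (R t - S t))"
    and init: "R 0 = S 0" and t: "t \<in> time_ivl T"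
  shows "R t = S t"
proof (rule antisym)
  have le: "Q t \<le> P t"
    if P: "real_C1 (time_ivl T) P" "\<And>t. t \<in> time_ivl T \<Longrightarrow> dini P t = ereal (g t (P t))"
      and Q: "real_C1 (time_ivl T) Q" "\<And>t. t \<in> time_ivl T \<Longrightarrow> dini Q t = ereal (g t (Q t))"
      and "Q 0 = P 0" for P Q
  proof -
    obtain m where m: "continuous_on (time_ivl T) m"
      "\<And>t. t \<in> time_ivl T \<Longrightarrow> g t (P t) - g t (Q t) = m t * (P t - Q t)"
      using m[OF real_C1_continuous[OF P(1)] real_C1_continuous[OF Q(1)]] by blast
    obtain Q' where Q': "\<And>s. s \<in> time_ivl T \<Longrightarrow> (Q has_real_derivative Q' s) (at s within time_ivl T)"
      using Q(1) by (auto simp: real_C1_def)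
    \<comment> \<open>For a differentiable function the upper derivative is the derivative, which
      bounds the growth of \<open>Q\<close> from above as the comparison requires.\<close>
    have Q'g: "Q' s = g s (Q s)" if "s \<in> time_ivl T" for s
      using dini_eq_derivative[OF Q'[OF that] that] Q(2)[OF that] by simp
    note sub = time_ivl_atLeastAtMost[OF t]
    show ?thesis
    proof (rule dini_comparison[where b = t and m = m and g = g and R = P and \<phi> = Q and ?t1.0 = t])
      fix s \<eta> :: real assume s: "0 \<le> s" "s < t" and \<eta>: "0 < \<eta>"
      have "s \<in> time_ivl T" using s sub by auto
      with C1_comparison_rate[OF Q'[OF this] this \<eta>] Q'g
      show "\<forall>\<^sub>F h in at_right 0. Q (s + h) \<le> Q s + h * (g s (Q s) + \<eta>)" by simp
    next
      fix s assume "0 \<le> s" "s < t"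
      then have "s \<in> time_ivl T" using sub by auto
      then show "ereal (g s (P s)) \<le> dini P s" "g s (P s) - g s (Q s) = m s * (P s - Q s)"
        by (simp_all add: P(2) m(2))
    qed (use that time_ivl_nonneg[OF t] sub in
        \<open>auto intro: continuous_on_subset[OF real_C1_continuous[OF P(1)] sub]
           continuous_on_subset[OF real_C1_continuous[OF Q(1)] sub] continuous_on_subset[OF m(1) sub]\<close>)
  qed
  show "R t \<le> S t" using le[OF S R] init by simp
  show "S t \<le> R t" using le[OF R S] init by simp
qed

subsection \<open>The linear control equation\<close>

lemma integral_has_derivative_time_ivl:
  assumes "continuous_on (time_ivl T) \<alpha>" "t \<in> time_ivl T"
  shows "((\<lambda>t. integral {0..t} \<alpha>) has_real_derivative \<alpha> t) (at t within time_ivl T)"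
proof -
  obtain c where c: "t < c" "c \<in> time_ivl T" by (rule time_ivl_right[OF assms(2)])
  have "((\<lambda>t. integral {0..t} \<alpha>) has_real_derivative \<alpha> t) (at t within {0..c})"
    by (intro integral_has_real_derivative continuous_on_subset[OF assms(1) time_ivl_atLeastAtMost[OF c(2)]])
       (use c time_ivl_nonneg[OF assms(2)] in auto)
  then show ?thesis by (simp add: at_within_time_ivl[OF c])
qed

text \<open>Variation of constants: \<open>A\<close> vanishes at 0, and at time \<open>t\<close> the
  two exponentials in front of \<open>\<epsilon> t\<close> cancel.\<close>

lemma linear_ode_solution:
  fixes \<alpha> \<epsilon> :: "real \<Rightarrow> real" and \<nu> \<delta> :: real
  assumes a: "continuous_on (time_ivl T) \<alpha>" and e: "continuous_on (time_ivl T) \<epsilon>"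
  defines "A \<equiv> \<lambda>t. integral {0..t} \<alpha>"
  defines "R \<equiv> \<lambda>t. exp (- \<nu> * t + A t) * (\<delta> + integral {0..t} (\<lambda>s. exp (\<nu> * s - A s) * \<epsilon> s))"
  shows "real_C1 (time_ivl T) R" "R 0 = \<delta>"
    "\<And>t. t \<in> time_ivl T \<Longrightarrow> dini R t = ereal (- \<nu> * R t + \<alpha> t * R t + \<epsilon> t)"
proof -
  have dA: "(A has_real_derivative \<alpha> t) (at t within time_ivl T)" if "t \<in> time_ivl T" for t
    unfolding A_def by (rule integral_has_derivative_time_ivl[OF a that])
  have cA: "continuous_on (time_ivl T) A"
    using dA unfolding continuous_on_eq_continuous_within by (metis DERIV_continuous)
  have dR: "(R has_real_derivative (- \<nu> * R t + \<alpha> t * R t + \<epsilon> t)) (at t within time_ivl T)"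
    if t: "t \<in> time_ivl T" for t
  proof -
    have "continuous_on (time_ivl T) (\<lambda>s. exp (\<nu> * s - A s) * \<epsilon> s)"
      by (intro continuous_intros cA e)
    note dI = integral_has_derivative_time_ivl[OF this t]
    define I where "I = (\<lambda>t. integral {0..t} (\<lambda>s. exp (\<nu> * s - A s) * \<epsilon> s))"
    have e: "exp (- \<nu> * t + A t) * (exp (\<nu> * t - A t) * \<epsilon> t) = \<epsilon> t"
      by (simp add: mult.assoc[symmetric] exp_add[symmetric])
    have RI: "R = (\<lambda>t. exp (- \<nu> * t + A t) * (\<delta> + I t))" by (simp add: R_def I_def)
    have "((\<lambda>t. exp (- \<nu> * t + A t) * (\<delta> + I t)) has_real_derivative
        exp (- \<nu> * t + A t) * (- \<nu> + \<alpha> t) * (\<delta> + I t) + exp (- \<nu> * t + A t) * (exp (\<nu> * t - A t) * \<epsilon> t))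
        (at t within time_ivl T)"
      by (rule derivative_eq_intros dA[OF t] dI[folded I_def] refl | simp)+
    then show ?thesis unfolding e RI by (simp add: algebra_simps)
  qed
  have cR: "continuous_on (time_ivl T) R"
    using dR unfolding continuous_on_eq_continuous_within by (metis DERIV_continuous)
  show "real_C1 (time_ivl T) R"
    unfolding real_C1_def
    by (rule exI[of _ "\<lambda>t. - \<nu> * R t + \<alpha> t * R t + \<epsilon> t"]) (intro conjI ballI dR continuous_intros cR a e)
  show "R 0 = \<delta>" by (simp add: R_def A_def)
  show "dini R t = ereal (- \<nu> * R t + \<alpha> t * R t + \<epsilon> t)" if "t \<in> time_ivl T" for t
    by (rule dini_eq_derivative[OF dR[OF that] that])
qed

subsection \<open>Local existence for a scalar Riccati equation\<close>

lemma picard_scalar: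
  fixes F :: "real \<Rightarrow> real \<Rightarrow> real"
  assumes cont: "\<And>x. continuous_on {0..\<tau>} x \<Longrightarrow> continuous_on {0..\<tau>} (\<lambda>s. F s (x s))"
    and lip: "\<And>s x y. s \<in> {0..\<tau>} \<Longrightarrow> \<bar>F s x - F s y\<bar> \<le> L * \<bar>x - y\<bar>"
    and bd: "\<And>s x. s \<in> {0..\<tau>} \<Longrightarrow> \<bar>F s x\<bar> \<le> B"
    and small: "0 \<le> \<tau>" "0 \<le> L" "\<tau> * L < 1"
  obtains R where "R 0 = \<delta>" "\<And>t. t \<in> {0..\<tau>} \<Longrightarrow> \<bar>R t - \<delta>\<bar> \<le> \<tau> * B"
    "\<And>t. t \<in> {0..\<tau>} \<Longrightarrow> (R has_real_derivative F t (R t)) (at t within {0..\<tau>})"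
proof -
  \<comment> \<open>The Banach space at hand consists of bounded continuous functions on the whole
    line, so iterates are extended by constants outside \<open>{0..\<tau>}\<close>.\<close>
  define cl where "cl = (\<lambda>t. max 0 (min \<tau> t))"
  have cl: "cl t \<in> {0..\<tau>}" for t using small by (simp add: cl_def)
  have cl_id: "cl t = t" if "t \<in> {0..\<tau>}" for t using that by (auto simp: cl_def)
  have B0: "0 \<le> B" using bd[of 0 0] small by (force intro: order_trans[OF abs_ge_zero])
  define J where "J = (\<lambda>x :: real \<Rightarrow>\<^sub>C real. \<lambda>t. \<delta> + integral {0..t} (\<lambda>s. F s (x s)))"
  have cx: "continuous_on {0..\<tau>} (\<lambda>s. F s (apply_bcontfun x s))" for x
    by (intro cont continuous_on_subset[OF continuous_on_apply_bcontfun]) auto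
  have cx': "continuous_on {0..t} (\<lambda>s. F s (apply_bcontfun x s))" if "t \<in> {0..\<tau>}" for x t
    using continuous_on_subset[OF cx, of "{0..t}"] that by auto
  have dJ: "(J x has_real_derivative F t (x t)) (at t within {0..\<tau>})" if "t \<in> {0..\<tau>}" for x t
    unfolding J_def using integral_has_real_derivative[OF cx that] by (auto intro!: derivative_eq_intros)
  have cJ: "continuous_on {0..\<tau>} (J x)" for x
    using dJ unfolding continuous_on_eq_continuous_within by (metis DERIV_continuous)
  have Jb: "\<bar>J x t - \<delta>\<bar> \<le> \<tau> * B" if t: "t \<in> {0..\<tau>}" for x t
  proof -
    have "norm (integral {0..t} (\<lambda>s. F s (x s))) \<le> B * (t - 0)"
      using t bd by (intro integral_bound cx') auto
    also have "\<dots> \<le> B * \<tau>" using t B0 by (intro mult_left_mono) auto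
    finally show ?thesis by (simp add: J_def mult.commute)
  qed
  have bc: "(\<lambda>t. J x (cl t)) \<in> bcontfun" for x
  proof (rule bcontfun_normI)
    show "continuous_on UNIV (\<lambda>t. J x (cl t))"
      by (rule continuous_on_compose2[OF cJ]) (auto simp: cl_def intro!: continuous_intros cl[unfolded cl_def])
    fix t
    show "norm (J x (cl t)) \<le> \<bar>\<delta>\<bar> + \<tau> * B" using Jb[OF cl, of x t] by auto
  qed
  define \<Phi> where "\<Phi> = (\<lambda>x. Bcontfun (\<lambda>t. J x (cl t)))"
  have \<Phi>: "apply_bcontfun (\<Phi> x) t = J x (cl t)" for x t
    unfolding \<Phi>_def by (simp add: Bcontfun_inverse bc)
  have "\<exists>!x. \<Phi> x = x"
  proof (rule banach_fix_type[where c = "\<tau> * L"])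
    show "\<forall>x y. dist (\<Phi> x) (\<Phi> y) \<le> \<tau> * L * dist x y"
    proof (intro allI dist_bound)
      fix x y t
      have "J x (cl t) - J y (cl t) = integral {0..cl t} (\<lambda>s. F s (x s) - F s (y s))"
        unfolding J_def using cl
        by (subst integral_diff) (auto intro!: integrable_continuous_real cx')
      moreover have "norm (integral {0..cl t} (\<lambda>s. F s (x s) - F s (y s))) \<le> (L * dist x y) * (cl t - 0)"
      proof (intro integral_bound continuous_intros cx' cl)
        show "0 \<le> cl t" using cl[of t] by simp
        fix s assume "s \<in> {0..cl t}"
        then have "s \<in> {0..\<tau>}" using cl[of t] by auto
        then have "\<bar>F s (x s) - F s (y s)\<bar> \<le> L * \<bar>x s - y s\<bar>" by (rule lip)
        also have "\<dots> \<le> L * dist x y"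
          using dist_bounded[of x s y] small by (intro mult_left_mono) (auto simp: dist_real_def)
        finally show "norm (F s (x s) - F s (y s)) \<le> L * dist x y" by simp
      qed
      moreover have "(L * dist x y) * (cl t - 0) \<le> \<tau> * L * dist x y"
        using cl[of t] small by (simp add: mult_ac mult_left_mono mult_right_mono)
      ultimately show "dist (apply_bcontfun (\<Phi> x) t) (apply_bcontfun (\<Phi> y) t) \<le> \<tau> * L * dist x y"
        by (simp add: \<Phi> dist_real_def)
    qed
  qed (use small in auto)
  then obtain x where x: "\<Phi> x = x" by blast
  have eq: "apply_bcontfun x t = J x t" if "t \<in> {0..\<tau>}" for t
    using \<Phi>[of x t] x cl_id[OF that] by simp
  show ?thesis
  proof (rule that[of "J x"])
    show "J x 0 = \<delta>" by (simp add: J_def)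
    show "\<bar>J x t - \<delta>\<bar> \<le> \<tau> * B" if "t \<in> {0..\<tau>}" for t by (rule Jb[OF that])
    show "(J x has_real_derivative F t (J x t)) (at t within {0..\<tau>})" if "t \<in> {0..\<tau>}" for t
      using dJ[OF that, of x] eq[OF that] by simp
  qed
qed

text \<open>The quadratic term is not globally Lipschitz. The unknown is therefore truncated to the
  interval of radius 1 about \<open>\<delta>\<close>, and the time is so short that the truncation
  never acts on the solution.\<close>

lemma riccati_local_existence:
  fixes a \<epsilon> :: "real \<Rightarrow> real"
  assumes b: "0 < b" and ca: "continuous_on {0..b} a" and ce: "continuous_on {0..b} \<epsilon>"
  obtains \<tau> R where "0 < \<tau>" "\<tau> \<le> b" "R 0 = \<delta>"
    "\<And>t. t \<in> {0..\<tau>} \<Longrightarrow> (R has_real_derivative (a t * R t + G * (R t)\<^sup>2 + \<epsilon> t)) (at t within {0..\<tau>})"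
proof -
  obtain Ma where Ma: "0 < Ma" "\<And>t. t \<in> {0..b} \<Longrightarrow> \<bar>a t\<bar> \<le> Ma"
    using compact_imp_bounded[OF compact_continuous_image[OF ca compact_Icc]]
    unfolding bounded_pos by (metis image_eqI real_norm_def)
  obtain Me where Me: "0 < Me" "\<And>t. t \<in> {0..b} \<Longrightarrow> \<bar>\<epsilon> t\<bar> \<le> Me"
    using compact_imp_bounded[OF compact_continuous_image[OF ce compact_Icc]]
    unfolding bounded_pos by (metis image_eqI real_norm_def)
  define cl where "cl = (\<lambda>x. max (\<delta> - 1) (min (\<delta> + 1) x))"
  define N where "N = \<bar>\<delta>\<bar> + 1"
  have clN: "\<bar>cl x\<bar> \<le> N" for x by (auto simp: cl_def N_def)
  have cl_lip: "\<bar>cl x - cl y\<bar> \<le> \<bar>x - y\<bar>" for x y by (auto simp: cl_def max_def min_def)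
  define F where "F = (\<lambda>t x. a t * cl x + G * (cl x)\<^sup>2 + \<epsilon> t)"
  define L where "L = Ma + \<bar>G\<bar> * (2 * N)"
  define B where "B = Ma * N + \<bar>G\<bar> * N\<^sup>2 + Me"
  have N: "1 \<le> N" by (simp add: N_def)
  have L0: "0 < L" using Ma N unfolding L_def by (intro add_pos_nonneg mult_nonneg_nonneg) auto
  have "0 < B" using Ma Me N unfolding B_def by (intro add_nonneg_pos add_nonneg_nonneg mult_nonneg_nonneg) auto
  note LB = L0 this
  \<comment> \<open>The bound \<open>1 / (2 * L)\<close> yields the contraction;
    \<open>1 / B\<close> keeps the solution within distance 1 of \<open>\<delta>\<close>.\<close>
  define \<tau> where "\<tau> = min b (min (1 / (2 * L)) (1 / B))"
  have \<tau>: "0 < \<tau>" "\<tau> \<le> b" using b LB by (auto simp: \<tau>_def)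
  have \<tau>L: "\<tau> * L < 1"
  proof -
    have "\<tau> * L \<le> 1 / (2 * L) * L" using LB by (intro mult_right_mono) (auto simp: \<tau>_def)
    then show ?thesis using LB by simp
  qed
  have \<tau>B: "\<tau> * B \<le> 1"
  proof -
    have "\<tau> * B \<le> 1 / B * B" using LB by (intro mult_right_mono) (auto simp: \<tau>_def)
    then show ?thesis using LB by simp
  qed
  obtain R where R: "R 0 = \<delta>" "\<And>t. t \<in> {0..\<tau>} \<Longrightarrow> \<bar>R t - \<delta>\<bar> \<le> \<tau> * B"
    "\<And>t. t \<in> {0..\<tau>} \<Longrightarrow> (R has_real_derivative F t (R t)) (at t within {0..\<tau>})"
  proof (rule picard_scalar[where F = F and \<tau> = \<tau> and L = L and B = B])
    fix x :: "real \<Rightarrow> real" assume "continuous_on {0..\<tau>} x"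
    then show "continuous_on {0..\<tau>} (\<lambda>s. F s (x s))"
      unfolding F_def cl_def using \<tau>
      by (intro continuous_intros continuous_on_subset[OF ca] continuous_on_subset[OF ce]) auto
  next
    fix s x y assume "s \<in> {0..\<tau>}"
    then have s: "s \<in> {0..b}" using \<tau> by auto
    have "F s x - F s y = (a s + G * (cl x + cl y)) * (cl x - cl y)"
      by (simp add: F_def algebra_simps power2_eq_square)
    then have "\<bar>F s x - F s y\<bar> = \<bar>a s + G * (cl x + cl y)\<bar> * \<bar>cl x - cl y\<bar>" by (simp add: abs_mult)
    also have "\<dots> \<le> L * \<bar>x - y\<bar>"
    proof (rule mult_mono[OF _ cl_lip])
      have "\<bar>G * (cl x + cl y)\<bar> \<le> \<bar>G\<bar> * (2 * N)"
        unfolding abs_mult using clN[of x] clN[of y] by (intro mult_left_mono) auto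
      then show "\<bar>a s + G * (cl x + cl y)\<bar> \<le> L" using Ma(2)[OF s] by (simp add: L_def)
    qed (use LB in auto)
    finally show "\<bar>F s x - F s y\<bar> \<le> L * \<bar>x - y\<bar>" .
  next
    fix s x assume "s \<in> {0..\<tau>}"
    then have s: "s \<in> {0..b}" using \<tau> by auto
    have 1: "\<bar>a s * cl x\<bar> \<le> Ma * N" unfolding abs_mult using Ma(2)[OF s] Ma(1) clN by (intro mult_mono) auto
    have "\<bar>cl x\<bar>\<^sup>2 \<le> N\<^sup>2" using clN by (intro power_mono) auto
    then have 2: "\<bar>G * (cl x)\<^sup>2\<bar> \<le> \<bar>G\<bar> * N\<^sup>2" unfolding abs_mult by (intro mult_left_mono) auto
    show "\<bar>F s x\<bar> \<le> B" using 1 2 Me(2)[OF s] by (simp add: F_def B_def)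
  qed (use \<tau> \<tau>L LB in auto)
  have "cl (R t) = R t" if "t \<in> {0..\<tau>}" for t using R(2)[OF that] \<tau>B by (auto simp: cl_def)
  with R \<tau> show ?thesis by (intro that[of \<tau> R]) (auto simp: F_def)
qed

section \<open>One-sided growth of Sobolev norms\<close>

lemma limitin_filterlim_compose:
  "limitin X f l F \<Longrightarrow> filterlim g F G \<Longrightarrow> limitin X (\<lambda>x. f (g x)) l G"
  by (auto simp: limitin_def filterlim_iff)

text \<open>Expanding the square on the right leaves a surplus of
  \<open>2 * h * \<phi> * \<eta>\<close>, which for small \<open>h\<close> dominates the term of
  second order because \<open>\<phi>\<close> is positive.\<close>

lemma sqrt_growth_step:
  fixes \<phi> c N \<eta> :: real
  assumes "0 < \<phi>" "0 < \<eta>"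
  shows "\<forall>\<^sub>F h in at_right 0. \<phi>\<^sup>2 + 2 * h * (c * \<phi>) + h\<^sup>2 * N\<^sup>2 \<le> (\<phi> + h * (c + \<eta>))\<^sup>2 \<and> 0 \<le> \<phi> + h * (c + \<eta>)"
proof -
  define r where "r = min (\<phi> / (\<bar>c + \<eta>\<bar> + 1)) (2 * \<phi> * \<eta> / (N\<^sup>2 + 1))"
  have N1: "0 < N\<^sup>2 + 1" by (simp add: add_nonneg_pos)
  have c1: "0 < \<bar>c + \<eta>\<bar> + 1" by (simp add: add_nonneg_pos)
  have r: "0 < r" using assms N1 c1 by (simp add: r_def)
  show ?thesis
  proof (rule eventually_at_rightI[OF _ r])
    fix h assume h: "h \<in> {0<..<r}"
    have "h * (\<bar>c + \<eta>\<bar> + 1) \<le> \<phi>" using h c1 by (simp add: r_def pos_less_divide_eq less_imp_le)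
    moreover have "- (h * (c + \<eta>)) \<le> h * \<bar>c + \<eta>\<bar>"
      using h by (metis abs_ge_minus_self greaterThanLessThan_iff less_imp_le mult_left_mono mult_minus_right)
    ultimately have 1: "0 \<le> \<phi> + h * (c + \<eta>)" using h by (simp add: distrib_left)
    have "h * (N\<^sup>2 + 1) \<le> 2 * \<phi> * \<eta>" using h N1 by (simp add: r_def pos_less_divide_eq less_imp_le)
    then have "h * N\<^sup>2 \<le> 2 * \<phi> * \<eta>" using h by (simp add: distrib_left)
    then have "h * (h * N\<^sup>2) \<le> h * (2 * \<phi> * \<eta>)" using h by (intro mult_left_mono) auto
    moreover have "0 \<le> (h * (c + \<eta>))\<^sup>2" by simp
    ultimately have "\<phi>\<^sup>2 + 2 * h * (c * \<phi>) + h\<^sup>2 * N\<^sup>2 \<le> (\<phi> + h * (c + \<eta>))\<^sup>2"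
      by (simp add: power2_eq_square algebra_simps)
    with 1 show "\<phi>\<^sup>2 + 2 * h * (c * \<phi>) + h\<^sup>2 * N\<^sup>2 \<le> (\<phi> + h * (c + \<eta>))\<^sup>2 \<and> 0 \<le> \<phi> + h * (c + \<eta>)" by simp
  qed
qed

text \<open>Passing from the squared norm to the norm divides by \<open>sob_norm p (w t)\<close>;
  the case of norm 0 is therefore treated apart, by the triangle inequality and the hypothesis on
  \<open>sob_norm p w'\<close>. One half of \<open>\<eta>\<close> pays for this passage, the other
  for replacing the difference quotient by \<open>w'\<close>.\<close>

lemma sob_norm_growth:
  assumes t: "t \<in> time_ivl T" and w: "w t \<in> smooth_fields"
    and d: "has_time_deriv (time_ivl T) w w' t"
    and ip: "sob_ip p w' (w t) \<le> c * sob_norm p (w t)"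
    and z: "sob_norm p (w t) = 0 \<Longrightarrow> sob_norm p w' \<le> c"
    and \<eta>: "0 < \<eta>"
  shows "\<forall>\<^sub>F h in at_right 0. sob_norm p (w (t + h)) \<le> sob_norm p (w t) + h * (c + \<eta>)"
proof -
  let ?\<phi> = "sob_norm p (w t)"
  have w': "w' \<in> smooth_fields" by (rule has_time_deriv_smooth[OF d])
  note f = smooth_fields_finite[OF w, of p] smooth_fields_finite[OF w', of p]
  have lim: "limitin frechet (\<lambda>h k. (1 / h) *\<^sub>R (w (t + h) k - w t k)) w' (at_right 0)"
    using limitin_filterlim_compose[OF d[unfolded has_time_deriv_eq] filterlim_time_ivl_right[OF t]] by simp
  have "((\<lambda>h. sob_norm p (\<lambda>k. (1 / h) *\<^sub>R (w (t + h) k - w t k) - w' k)) \<longlongrightarrow> 0) (at_right 0)"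
    and S: "\<forall>\<^sub>F h in at_right 0. (\<lambda>k. (1 / h) *\<^sub>R (w (t + h) k - w t k)) \<in> smooth_fields"
    using lim unfolding limitin_frechet_iff by blast+
  then have 1: "\<forall>\<^sub>F h in at_right 0. sob_norm p (\<lambda>k. (1 / h) *\<^sub>R (w (t + h) k - w t k) - w' k) < \<eta> / 2"
    using \<eta> by (intro order_tendstoD(2)) auto
  have 2: "\<forall>\<^sub>F h in at_right 0. sob_norm p (\<lambda>k. w t k + h *\<^sub>R w' k) \<le> ?\<phi> + h * (c + \<eta> / 2)"
  proof (cases "?\<phi> = 0")
    case True
    have "\<forall>\<^sub>F h :: real in at_right 0. 0 < h" by (simp add: eventually_at_filter)
    then show ?thesis
    proof eventually_elim
      case (elim h)
      have "sob_norm p (\<lambda>k. w t k + h *\<^sub>R w' k) \<le> ?\<phi> + sob_norm p (\<lambda>k. h *\<^sub>R w' k)"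
        by (intro sob_norm_triangle f sob_finite_scale)
      also have "\<dots> = ?\<phi> + h * sob_norm p w'" using elim by (simp add: sob_norm_scale)
      also have "\<dots> \<le> ?\<phi> + h * (c + \<eta> / 2)"
        using elim z[OF True] \<eta> by (intro add_left_mono mult_left_mono) auto
      finally show ?case .
    qed
  next
    case False
    then have pos: "0 < ?\<phi>" by (simp add: order_less_le)
    have "\<forall>\<^sub>F h :: real in at_right 0. 0 < h" by (simp add: eventually_at_filter)
    moreover have "\<forall>\<^sub>F h in at_right 0. ?\<phi>\<^sup>2 + 2 * h * (c * ?\<phi>) + h\<^sup>2 * (sob_norm p w')\<^sup>2
        \<le> (?\<phi> + h * (c + \<eta> / 2))\<^sup>2 \<and> 0 \<le> ?\<phi> + h * (c + \<eta> / 2)"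
      using \<eta> by (intro sqrt_growth_step pos) auto
    ultimately show ?thesis
    proof eventually_elim
      case (elim h)
      show ?case
      proof (rule power2_le_imp_le)
        have "(sob_norm p (\<lambda>k. w t k + h *\<^sub>R w' k))\<^sup>2
            = ?\<phi>\<^sup>2 + 2 * h * sob_ip p w' (w t) + h\<^sup>2 * (sob_norm p w')\<^sup>2"
          by (rule sob_norm_add_scale_sq[OF f])
        also have "\<dots> \<le> ?\<phi>\<^sup>2 + 2 * h * (c * ?\<phi>) + h\<^sup>2 * (sob_norm p w')\<^sup>2"
          using elim(1) ip by (intro add_mono mult_left_mono) auto
        finally show "(sob_norm p (\<lambda>k. w t k + h *\<^sub>R w' k))\<^sup>2 \<le> (?\<phi> + h * (c + \<eta> / 2))\<^sup>2"
          using elim(2) by linarith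
      qed (use elim in auto)
    qed
  qed
  have "\<forall>\<^sub>F h :: real in at_right 0. 0 < h" by (simp add: eventually_at_filter)
  from this 1 2 S show ?thesis
  proof eventually_elim
    case (elim h)
    let ?q = "\<lambda>k. (1 / h) *\<^sub>R (w (t + h) k - w t k) - w' k"
    have q: "?q \<in> smooth_fields" by (rule smooth_fields_diff[OF elim(4) w'])
    have "w (t + h) = (\<lambda>k. (w t k + h *\<^sub>R w' k) + h *\<^sub>R ?q k)"
      using elim(1) by (simp add: fun_eq_iff algebra_simps)
    then have "sob_norm p (w (t + h)) = sob_norm p (\<lambda>k. (w t k + h *\<^sub>R w' k) + h *\<^sub>R ?q k)" by simp
    also have "\<dots> \<le> sob_norm p (\<lambda>k. w t k + h *\<^sub>R w' k) + sob_norm p (\<lambda>k. h *\<^sub>R ?q k)"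
      by (intro sob_norm_triangle sob_finite_add sob_finite_scale f smooth_fields_finite[OF q])
    also have "\<dots> = sob_norm p (\<lambda>k. w t k + h *\<^sub>R w' k) + h * sob_norm p ?q"
      using elim(1) by (simp add: sob_norm_scale[of p h ?q])
    also have "\<dots> \<le> (?\<phi> + h * (c + \<eta> / 2)) + h * (\<eta> / 2)"
      using elim by (intro add_mono mult_left_mono) auto
    also have "\<dots> = ?\<phi> + h * (c + \<eta>)" by (simp add: algebra_simps)
    finally show ?case .
  qed
qed

subsection \<open>Energy estimates\<close>

lemma sob_ip_diff_left:
  assumes "sob_finite p v" "sob_finite p w" "sob_finite p z"
  shows "sob_ip p (\<lambda>k. v k - w k) z = sob_ip p v z - sob_ip p w z"
  using sob_ip_add_left[OF assms(1) sob_finite_minus[OF assms(2)] assms(3)] by (simp add: sob_ip_minus_left)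

lemma kato_constsD:
  fixes v w :: "'d::finite field"
  assumes "kato_consts TYPE('d) G" "real CARD('d) / 2 + 1 < n" "v \<in> smooth_fields" "w \<in> smooth_fields"
  shows "sob_ip n (nse_bilin v w) w \<le> G n * sob_norm n v * (sob_norm n w)\<^sup>2" "0 < G n"
proof -
  have "norm (sob_inner n (nse_bilin v w) w) \<le> G n * sob_norm n v * (sob_norm n w)\<^sup>2"
    and "0 < G n" using assms by (auto simp: kato_consts_def smooth_fields_sobolev)
  moreover have "sob_ip n (nse_bilin v w) w = Re (sob_inner n (nse_bilin v w) w)"
    by (intro Re_sob_inner[symmetric] smooth_fields_finite nse_bilin_smooth assms)
  ultimately show "sob_ip n (nse_bilin v w) w \<le> G n * sob_norm n v * (sob_norm n w)\<^sup>2" "0 < G n"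
    using complex_Re_le_cmod[of "sob_inner n (nse_bilin v w) w"] by auto
qed

lemma tame_kato_constsD:
  fixes w :: "'d::finite field"
  assumes "tame_kato_consts TYPE('d) GG" "real CARD('d) / 2 + 1 < n" "n \<le> p" "w \<in> smooth_fields"
  shows "sob_ip p (nse_bilin w w) w \<le> GG p n * sob_norm n w * (sob_norm p w)\<^sup>2" "0 < GG p n"
proof -
  have "norm (sob_inner p (nse_bilin w w) w)
      \<le> 1 / 2 * GG p n * (sob_norm p w * sob_norm n w + sob_norm n w * sob_norm p w) * sob_norm p w"
    and "0 < GG p n"
    using assms(1)[unfolded tame_kato_consts_def, rule_format, OF assms(2,3)]
      smooth_fields_sobolev[OF assms(4)] by blast+
  moreover have "sob_ip p (nse_bilin w w) w = Re (sob_inner p (nse_bilin w w) w)"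
    by (intro Re_sob_inner[symmetric] smooth_fields_finite nse_bilin_smooth assms)
  ultimately show "sob_ip p (nse_bilin w w) w \<le> GG p n * sob_norm n w * (sob_norm p w)\<^sup>2" "0 < GG p n"
    using complex_Re_le_cmod[of "sob_inner p (nse_bilin w w) w"]
    by (auto simp: power2_eq_square mult_ac)
qed

locale nse_constants =
  fixes K G :: "real \<Rightarrow> real" and GG :: "real \<Rightarrow> real \<Rightarrow> real" and \<nu> n :: real and dim :: "'d::finite itself"
  assumes K: "basic_consts TYPE('d) K" and G: "kato_consts TYPE('d) G" and GG: "tame_kato_consts TYPE('d) GG"
    and \<nu>: "0 \<le> \<nu>" and n: "real CARD('d) / 2 + 1 < n"
begin

text \<open>The time derivative of \<open>w\<close> if \<open>v + w\<close> solves the equation and \<open>v\<close> has differential error \<open>e\<close>.\<close>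

definition perturbation_rhs :: "'d field \<Rightarrow> 'd field \<Rightarrow> 'd field \<Rightarrow> 'd field" where
  "perturbation_rhs v w e = (\<lambda>k. \<nu> *\<^sub>R laplacian w k
     + (nse_bilin v w k + nse_bilin w v k + nse_bilin w w k) - e k)"

text \<open>In \<open>P(v, w)\<close> the derivative falls on \<open>w\<close>, and the Kato
  inequality avoids its loss. In \<open>P(w, v)\<close> it falls on \<open>v\<close>, which costs
  the norm of order \<open>p + 1\<close> of \<open>v\<close> but permits Cauchy-Schwarz with the
  basic inequality. \<open>P(w, w)\<close> takes the tame inequality, and the dissipation is
  estimated by the norm of order \<open>p\<close> because nonzero wave vectors have length at least
  1.\<close>

lemma perturbation_ip_le:
  assumes S: "v \<in> smooth_fields" "w \<in> smooth_fields" "e \<in> smooth_fields" and p: "n \<le> p"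
  shows "sob_ip p (perturbation_rhs v w e) w \<le>
    (- \<nu> * sob_norm p w + (G p * sob_norm p v + K p * sob_norm (p + 1) v + GG p n * sob_norm n w) * sob_norm p w
      + sob_norm p e) * sob_norm p w"
proof -
  let ?\<phi> = "sob_norm p w"
  have pk: "real CARD('d) / 2 < p" and pg: "real CARD('d) / 2 + 1 < p" using n p by linarith+
  note B = nse_bilin_smooth[OF S(1,2)] nse_bilin_smooth[OF S(2,1)] nse_bilin_smooth[OF S(2,2)]
  note F = smooth_fields_finite[OF S(1), of p] smooth_fields_finite[OF S(2), of p] smooth_fields_finite[OF S(3), of p]
    B[THEN smooth_fields_finite, of p] smooth_fields_finite[OF smooth_fields_laplacian[OF S(2)], of p]
  have "sob_ip p (perturbation_rhs v w e) w = \<nu> * sob_ip p (laplacian w) w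
      + (sob_ip p (nse_bilin v w) w + sob_ip p (nse_bilin w v) w + sob_ip p (nse_bilin w w) w) + - sob_ip p e w"
    unfolding perturbation_rhs_def
    by (simp add: sob_ip_diff_left sob_ip_add_left sob_ip_scale_left F sob_finite_add sob_finite_scale)
  also have "\<nu> * sob_ip p (laplacian w) w \<le> - \<nu> * ?\<phi>\<^sup>2"
  proof -
    have "?\<phi>\<^sup>2 \<le> (sob_norm (p + 1) w)\<^sup>2"
      by (intro power_mono sob_norm_order_mono smooth_fields_finite S) auto
    then show ?thesis using \<nu> by (simp add: sob_ip_laplacian mult_left_mono)
  qed
  also have "sob_ip p (nse_bilin v w) w \<le> G p * sob_norm p v * ?\<phi>\<^sup>2"
    by (rule kato_constsD[OF G pg S(1,2)])
  also have "sob_ip p (nse_bilin w v) w \<le> (K p * ?\<phi> * sob_norm (p + 1) v) * ?\<phi>"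
    using sob_ip_le[OF F(5,2)] mult_right_mono[OF basic_constsD(1)[OF K pk S(2,1)], of ?\<phi>] by simp
  also have "sob_ip p (nse_bilin w w) w \<le> GG p n * sob_norm n w * ?\<phi>\<^sup>2"
    by (rule tame_kato_constsD[OF GG n p S(2)])
  also have "- sob_ip p e w \<le> sob_norm p e * ?\<phi>"
    using sob_ip_le[OF F(3,2)] by simp
  finally show ?thesis by (simp add: power2_eq_square algebra_simps)
qed

text \<open>Serves the degenerate case of \<open>sob_norm_growth\<close>: a smooth field of norm 0
  vanishes, and only the error term survives.\<close>

lemma perturbation_norm_le:
  assumes S: "v \<in> smooth_fields" "w \<in> smooth_fields" "e \<in> smooth_fields" and w: "sob_norm p w = 0"
  shows "sob_norm p (perturbation_rhs v w e) = sob_norm p e"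
proof -
  have w0: "w = (\<lambda>k. 0)" using smooth_fields_eqI[OF S(2) smooth_fields_0, of p] w by simp
  have "nse_bilin v (\<lambda>k. 0 *\<^sub>R w k) k = 0" "nse_bilin (\<lambda>k. 0 *\<^sub>R w k) v k = 0" "nse_bilin (\<lambda>k. 0 *\<^sub>R w k) (\<lambda>k. 0 *\<^sub>R w k) k = 0" for k
    using nse_bilin_scale_right[OF S(1,2), of 0] nse_bilin_scale_left[OF S(2,1), of 0]
      nse_bilin_scale_left[OF S(2) smooth_fields_0, of 0] by simp_all
  then have "perturbation_rhs v w e = (\<lambda>k. - e k)"
    by (simp add: perturbation_rhs_def w0 laplacian_eq)
  then show ?thesis by (simp add: sob_norm_minus)
qed

text \<open>The bound \<open>X\<close> on the norm of order \<open>n\<close> is left free: the norm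
  itself yields the quadratic rate for \<open>p = n\<close>, an already established control function
  yields a rate that is linear in the norm of order \<open>p\<close>.\<close>

lemma perturbation_growth:
  fixes u v :: "real \<Rightarrow> 'd field" and f :: "real \<Rightarrow> 'd field"
  assumes t: "t \<in> time_ivl S"
    and u: "u t \<in> smooth_fields" "has_time_deriv (time_ivl S) u (nse_rhs \<nu> f t (u t)) t"
    and v: "v t \<in> smooth_fields" "has_time_deriv (time_ivl S) v v' t"
    and f: "f t \<in> smooth_fields"
    and e: "sob_norm p (\<lambda>k. v' k - nse_rhs \<nu> f t (v t) k) \<le> \<epsilon>"
    and D: "sob_norm p (v t) \<le> Dp" "sob_norm (p + 1) (v t) \<le> Dq"
    and p: "n \<le> p" and \<eta>: "0 < \<eta>"
    and X: "sob_norm n (\<lambda>k. u t k - v t k) \<le> X"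
  shows "\<forall>\<^sub>F h in at_right 0. sob_norm p (\<lambda>k. u (t + h) k - v (t + h) k)
    \<le> sob_norm p (\<lambda>k. u t k - v t k)
      + h * (- \<nu> * sob_norm p (\<lambda>k. u t k - v t k)
        + (G p * Dp + K p * Dq + GG p n * X) * sob_norm p (\<lambda>k. u t k - v t k) + \<epsilon> + \<eta>)"
proof -
  define w where "w = (\<lambda>t k. u t k - v t k)"
  define er where "er = (\<lambda>k. v' k - nse_rhs \<nu> f t (v t) k)"
  have v'S: "v' \<in> smooth_fields" by (rule has_time_deriv_smooth[OF v(2)])
  have rS: "nse_rhs \<nu> f t (v t) \<in> smooth_fields"
    unfolding nse_rhs_def by (intro smooth_fields_add smooth_fields_scale smooth_fields_laplacian nse_bilin_smooth v f)
  have erS: "er \<in> smooth_fields" unfolding er_def by (intro smooth_fields_diff v'S rS)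
  have wS: "w t \<in> smooth_fields" unfolding w_def by (intro smooth_fields_diff u v)
  have pk: "real CARD('d) / 2 < p" and pg: "real CARD('d) / 2 + 1 < p" using n p by linarith+
  have uvw: "u t = (\<lambda>k. v t k + w t k)" by (simp add: w_def)
  have "has_time_deriv (time_ivl S) w (\<lambda>k. nse_rhs \<nu> f t (u t) k - v' k) t"
    unfolding w_def by (rule has_time_deriv_diff[OF u(2) v(2)])
  also have "(\<lambda>k. nse_rhs \<nu> f t (u t) k - v' k) = perturbation_rhs (v t) (w t) er"
  proof
    fix k
    have "nse_bilin (u t) (u t) k = nse_bilin (v t) (v t) k + nse_bilin (v t) (w t) k + (nse_bilin (w t) (v t) k + nse_bilin (w t) (w t) k)"
      unfolding uvw by (simp add: nse_bilin_add_left nse_bilin_add_right smooth_fields_add v wS)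
    moreover have "laplacian (u t) k = laplacian (v t) k + laplacian (w t) k"
      unfolding uvw by (simp add: laplacian_eq algebra_simps)
    ultimately show "nse_rhs \<nu> f t (u t) k - v' k = perturbation_rhs (v t) (w t) er k"
      by (simp add: nse_rhs_def perturbation_rhs_def er_def algebra_simps)
  qed
  finally have d: "has_time_deriv (time_ivl S) w (perturbation_rhs (v t) (w t) er) t" .
  let ?\<phi> = "sob_norm p (w t)"
  let ?c = "- \<nu> * ?\<phi> + (G p * Dp + K p * Dq + GG p n * X) * ?\<phi> + \<epsilon>"
  have "\<forall>\<^sub>F h in at_right 0. sob_norm p (w (t + h)) \<le> ?\<phi> + h * (?c + \<eta>)"
  proof (rule sob_norm_growth[OF t wS d _ _ \<eta>])
    have "sob_ip p (perturbation_rhs (v t) (w t) er) (w t) \<le>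
      (- \<nu> * ?\<phi> + (G p * sob_norm p (v t) + K p * sob_norm (p + 1) (v t) + GG p n * sob_norm n (w t)) * ?\<phi>
        + sob_norm p er) * ?\<phi>"
      by (rule perturbation_ip_le[OF v(1) wS erS p])
    also have "\<dots> \<le> ?c * ?\<phi>"
      using kato_constsD(2)[OF G pg v(1) wS] basic_constsD(2)[OF K pk v(1) wS] tame_kato_constsD(2)[OF GG n p wS] D e X
      by (intro mult_right_mono add_mono mult_left_mono) (auto simp: er_def w_def)
    finally show "sob_ip p (perturbation_rhs (v t) (w t) er) (w t) \<le> ?c * ?\<phi>" .
    show "sob_norm p (perturbation_rhs (v t) (w t) er) \<le> ?c" if "?\<phi> = 0"
      using perturbation_norm_le[OF v(1) wS erS that] that e by (simp add: er_def)
  qed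
  then show ?thesis by (simp add: w_def algebra_simps)
qed

end

lemma has_time_deriv_subset:
  "has_time_deriv I u u' t \<Longrightarrow> J \<subseteq> I \<Longrightarrow> has_time_deriv J u u' t"
  unfolding has_time_deriv_eq limitin_def using at_le[of J I t] by (meson filter_leD)

context nse_constants
begin

text \<open>Both functions have zero error and equal data, so the norm of the difference is compared
  with the constant 0. The quadratic term is hidden in the coefficient \<open>?m\<close>, which
  contains the norm itself and is continuous, so the comparison is linear.\<close>

lemma nse_uniqueness:
  fixes u v :: "real \<Rightarrow> 'd field" and f :: "real \<Rightarrow> 'd field"
  assumes u: "\<And>t. t \<in> time_ivl S \<Longrightarrow> u t \<in> smooth_fields"
      "\<And>t. t \<in> time_ivl S \<Longrightarrow> has_time_deriv (time_ivl S) u (nse_rhs \<nu> f t (u t)) t"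
    and v: "\<And>t. t \<in> time_ivl S \<Longrightarrow> v t \<in> smooth_fields"
      "\<And>t. t \<in> time_ivl S \<Longrightarrow> has_time_deriv (time_ivl S) v (nse_rhs \<nu> f t (v t)) t"
    and f: "\<And>t. t \<in> time_ivl S \<Longrightarrow> f t \<in> smooth_fields"
    and init: "u 0 = v 0" and b: "b \<in> time_ivl S"
  shows "u b = v b"
proof -
  have c: "time_Ck 0 (time_ivl S) u" "time_Ck 0 (time_ivl S) v"
    unfolding time_Ck_0_iff using has_time_deriv_imp_limit u v by blast+
  then have cw: "time_Ck 0 (time_ivl S) (\<lambda>t k. u t k - v t k)"
    using time_Ck_add[OF c(1) time_Ck_scale[OF c(2), of "-1"]] by simp
  let ?\<phi> = "\<lambda>t. sob_norm n (\<lambda>k. u t k - v t k)"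
  let ?m = "\<lambda>t. - \<nu> + (G n * sob_norm n (v t) + K n * sob_norm (n + 1) (v t) + GG n n * ?\<phi> t)"
  note sub = time_ivl_atLeastAtMost[OF b]
  have "?\<phi> b \<le> 0"
  proof (rule dini_comparison[where b = b and \<phi> = ?\<phi> and R = "\<lambda>_. 0" and m = ?m and g = "\<lambda>t x. ?m t * x" and ?t1.0 = b])
    show "continuous_on {0..b} ?\<phi>"
      by (rule continuous_on_subset[OF time_Ck_sob_norm_continuous[OF cw] sub])
    show "continuous_on {0..b} ?m"
      by (intro continuous_intros continuous_on_subset[OF time_Ck_sob_norm_continuous[OF cw] sub]
          continuous_on_subset[OF time_Ck_sob_norm_continuous[OF c(2)] sub])
    fix t assume "0 \<le> t" "t < b"
    then have t: "t \<in> time_ivl S" using sub by auto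
    have "dini (\<lambda>_. 0) t = ereal 0" by (rule dini_eq_derivative[OF _ t]) simp
    then show "ereal (?m t * 0) \<le> dini (\<lambda>_. 0) t" by simp
    show "?m t * 0 - ?m t * ?\<phi> t = ?m t * (0 - ?\<phi> t)" by simp
    fix \<eta> :: real assume \<eta>: "0 < \<eta>"
    show "\<forall>\<^sub>F h in at_right 0. ?\<phi> (t + h) \<le> ?\<phi> t + h * (?m t * ?\<phi> t + \<eta>)"
      using perturbation_growth[OF t u(1,2)[OF t] v(1,2)[OF t] f[OF t], of n 0 "sob_norm n (v t)" "sob_norm (n + 1) (v t)" \<eta> "?\<phi> t"] \<eta>
      by (simp add: algebra_simps)
  next
    show "?\<phi> 0 \<le> 0" using init by simp
  qed (use time_ivl_nonneg[OF b] in auto)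
  then have "?\<phi> b = 0" by (simp add: order_antisym)
  then show ?thesis by (intro smooth_fields_eqI u(1) v(1) b)
qed

end

subsection \<open>Truncation of the Fourier series\<close>

definition trunc :: "real \<Rightarrow> 'd::finite field \<Rightarrow> 'd field" where
  "trunc L v = (\<lambda>k. if norm (wave k) \<le> L then v k else 0)"

definition band_limited :: "real \<Rightarrow> 'd::finite field \<Rightarrow> bool" where
  "band_limited L v \<longleftrightarrow> (\<forall>k. L < norm (wave k) \<longrightarrow> v k = 0)"

lemma band_limited_trunc: "band_limited L (trunc L v)"
  by (auto simp: band_limited_def trunc_def)

lemma band_limited_add_scale: "band_limited L v \<Longrightarrow> band_limited L w \<Longrightarrow> band_limited L (\<lambda>k. v k + h *\<^sub>R w k)"
  by (simp add: band_limited_def)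

lemma trunc_smooth:
  assumes "v \<in> smooth_fields"
  shows "trunc L v \<in> smooth_fields"
proof -
  have "sob_finite p (trunc L v)" for p
    by (rule sob_finite_mono[OF smooth_fields_finite[OF assms]]) (simp add: trunc_def)
  moreover have "solenoidal (trunc L v)"
    using assms by (auto simp: smooth_fields_iff solenoidal_def trunc_def bdot_def)
  ultimately show ?thesis by (simp add: smooth_fields_iff)
qed

lemma sob_norm_trunc_le: "sob_finite p v \<Longrightarrow> sob_norm p (trunc L v) \<le> sob_norm p v"
  by (rule sob_norm_mono) (auto simp: trunc_def)

text \<open>Truncation is symmetric and fixes \<open>x\<close>; this is how energy estimates for the
  full equation carry over to the truncated one with the same constants.\<close>

lemma sob_ip_trunc: "band_limited L x \<Longrightarrow> sob_ip p (trunc L z) x = sob_ip p z x"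
  unfolding sob_ip_def by (rule infsum_cong) (auto simp: trunc_def band_limited_def not_le)

text \<open>Bernstein inequality: all frequencies that occur are at most \<open>L\<close>, so
  \<open>a\<close> additional orders cost a factor \<open>L powr a\<close>.\<close>

lemma sob_norm_band_limited:
  assumes x: "x \<in> smooth_fields" "band_limited L x" and a: "0 \<le> a"
  shows "sob_norm (p + a) x \<le> L powr a * sob_norm p x"
proof (rule power2_le_imp_le)
  have le: "sob_weight (p + a) k * (norm (x k))\<^sup>2 \<le> (L powr a)\<^sup>2 * (sob_weight p k * (norm (x k))\<^sup>2)"
    if k: "k \<noteq> 0" for k
  proof (cases "norm (wave k) \<le> L")
    case True
    have "norm (wave k) powr (2 * a) \<le> L powr (2 * a)"
      using True a by (intro powr_mono2) auto
    moreover have "L powr (2 * a) = (L powr a)\<^sup>2" unfolding mult_2 powr_add by (simp add: power2_eq_square)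
    ultimately have "norm (wave k) powr (2 * a) * (sob_weight p k * (norm (x k))\<^sup>2) \<le> (L powr a)\<^sup>2 * (sob_weight p k * (norm (x k))\<^sup>2)"
      by (intro mult_right_mono) auto
    then show ?thesis by (simp add: sob_weight_def distrib_left powr_add mult_ac)
  next
    case False
    then show ?thesis using x(2) by (simp add: band_limited_def)
  qed
  have "(sob_norm (p + a) x)\<^sup>2 \<le> (\<Sum>\<^sub>\<infinity>k\<in>- {0}. (L powr a)\<^sup>2 * (sob_weight p k * (norm (x k))\<^sup>2))"
    unfolding sob_norm_sq_sum
    using smooth_fields_finite[OF x(1), of "p + a"] smooth_fields_finite[OF x(1), of p] le
    by (intro infsum_mono summable_on_cmult_right) (auto simp: sob_finite_def)
  also have "\<dots> = (L powr a * sob_norm p x)\<^sup>2"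
    using smooth_fields_finite[OF x(1), of p]
    by (subst infsum_cmult_right) (auto simp: sob_norm_sq_sum power_mult_distrib sob_finite_def)
  finally show "(sob_norm (p + a) x)\<^sup>2 \<le> (L powr a * sob_norm p x)\<^sup>2" .
qed simp

text \<open>The number of time steps grows faster than any power of the cutoff \<open>N + 1\<close>.\<close>

definition steps :: "nat \<Rightarrow> nat" where
  "steps N = (N + 1) ^ (N + 1)"

lemma steps_ge: "N + 1 \<le> steps N" "0 < steps N"
  using power_increasing[of 1 "N + 1" "N + 1"] by (auto simp: steps_def)

text \<open>For \<open>q \<le> N + 1\<close> the power is at most \<open>(N + 1) ^ (N + 1)\<close>;
  the finitely many smaller \<open>N\<close> are absorbed by the constant
  \<open>q powr q\<close>.\<close>

lemma powr_le_steps: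
  assumes "0 \<le> q"
  shows "real (N + 1) powr q \<le> max 1 (q powr q) * real (steps N)"
proof (cases "q \<le> real (N + 1)")
  case True
  have "real (N + 1) powr q \<le> real (N + 1) powr real (N + 1)" using True by (intro powr_mono) auto
  also have "\<dots> = real (steps N)" by (subst powr_realpow) (auto simp: steps_def algebra_simps)
  also have "\<dots> \<le> max 1 (q powr q) * real (steps N)"
    using mult_right_mono[of 1 "max 1 (q powr q)" "real (steps N)"] by simp
  finally show ?thesis .
next
  case False
  have "real (N + 1) powr q \<le> q powr q" using False assms by (intro powr_mono2) auto
  also have "\<dots> \<le> max 1 (q powr q) * 1" by simp
  also have "\<dots> \<le> max 1 (q powr q) * real (steps N)" using steps_ge(2)[of N] by (intro mult_left_mono) auto
  finally show ?thesis .
qed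

text \<open>Adding 1 lets inhomogeneous terms be absorbed in the growth factor, and
  \<open>1 + x \<le> exp x\<close> makes the bound depend on the elapsed time \<open>h * j\<close>
  alone.\<close>

lemma discrete_gronwall:
  fixes b :: "nat \<Rightarrow> real"
  assumes step: "\<And>j. j < J \<Longrightarrow> b (Suc j) + 1 \<le> (b j + 1) * (1 + h * \<alpha>)"
    and "0 \<le> h" "0 \<le> \<alpha>" "0 \<le> b 0" "j \<le> J"
  shows "b j + 1 \<le> (b 0 + 1) * exp (h * real j * \<alpha>)"
  using \<open>j \<le> J\<close>
proof (induction j)
  case (Suc j)
  have "b (Suc j) + 1 \<le> (b j + 1) * (1 + h * \<alpha>)" using step Suc.prems by simp
  also have "\<dots> \<le> ((b 0 + 1) * exp (h * real j * \<alpha>)) * exp (h * \<alpha>)"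
    using Suc assms by (intro mult_mono exp_ge_add_one_self) auto
  also have "\<dots> = (b 0 + 1) * exp (h * real (Suc j) * \<alpha>)"
    by (simp add: exp_add[symmetric] algebra_simps)
  finally show ?case .
qed simp

context nse_constants
begin

lemma nse_rhs_smooth: "x \<in> smooth_fields \<Longrightarrow> f t \<in> smooth_fields \<Longrightarrow> nse_rhs \<nu> f t x \<in> smooth_fields"
  for x :: "'d field"
  unfolding nse_rhs_def by (intro smooth_fields_add smooth_fields_scale smooth_fields_laplacian nse_bilin_smooth)

lemma nse_rhs_norm_le:
  fixes x :: "'d field"
  assumes S: "x \<in> smooth_fields" "f t \<in> smooth_fields" and p: "n \<le> p"
  shows "sob_norm p (nse_rhs \<nu> f t x)
    \<le> \<nu> * sob_norm (p + 2) x + K p * sob_norm p x * sob_norm (p + 1) x + sob_norm p (f t)"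
proof -
  note F = smooth_fields_finite[OF smooth_fields_laplacian[OF S(1)], of p]
    smooth_fields_finite[OF nse_bilin_smooth[OF S(1,1)], of p] smooth_fields_finite[OF S(2), of p]
  have pk: "real CARD('d) / 2 < p" using n p by linarith
  have "sob_norm p (nse_rhs \<nu> f t x) \<le> sob_norm p (\<lambda>k. \<nu> *\<^sub>R laplacian x k + nse_bilin x x k) + sob_norm p (f t)"
    unfolding nse_rhs_def by (intro sob_norm_triangle sob_finite_add sob_finite_scale F)
  also have "sob_norm p (\<lambda>k. \<nu> *\<^sub>R laplacian x k + nse_bilin x x k)
      \<le> sob_norm p (\<lambda>k. \<nu> *\<^sub>R laplacian x k) + sob_norm p (nse_bilin x x)"
    by (intro sob_norm_triangle sob_finite_scale F)
  also have "sob_norm p (\<lambda>k. \<nu> *\<^sub>R laplacian x k) = \<nu> * sob_norm (p + 2) x"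
    using \<nu> by (simp add: sob_norm_scale sob_norm_laplacian)
  also have "sob_norm p (nse_bilin x x) \<le> K p * sob_norm p x * sob_norm (p + 1) x"
    by (rule basic_constsD(1)[OF K pk S(1,1)])
  finally show ?thesis by simp
qed

text \<open>What remains of the bound on the right-hand side, for data of norm at most
  \<open>m\<close> and force at most \<open>\<Phi>\<close> in order \<open>n\<close>, once the
  cutoff power for the two derivatives of the Laplacian is factored out.\<close>

definition rhs_size :: "real \<Rightarrow> real \<Rightarrow> real" where
  "rhs_size m \<Phi> = \<nu> * m + K n * m\<^sup>2 + \<Phi>"

lemma K_pos: "n \<le> p \<Longrightarrow> 0 < K p"
  using basic_constsD(2)[OF K _ smooth_fields_0 smooth_fields_0, of p] n by linarith

lemma GG_pos: "n \<le> p \<Longrightarrow> 0 < GG p n"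
  using tame_kato_constsD(2)[OF GG n _ smooth_fields_0] by blast

text \<open>By the Bernstein inequality every norm is controlled by that of order \<open>n\<close>:
  \<open>p - n\<close> powers of \<open>L\<close> for the change of order, two more for the
  Laplacian. The bound is useless as \<open>L\<close> grows, and is applied only where it is
  multiplied by the square of the step.\<close>

lemma trunc_rhs_norm_le:
  fixes x :: "'d field"
  assumes x: "x \<in> smooth_fields" "band_limited L x" "sob_norm n x \<le> m" and L: "1 \<le> L"
    and f: "f t \<in> smooth_fields" "sob_norm n (f t) \<le> \<Phi>" and p: "n \<le> p"
  shows "sob_norm p (trunc L (nse_rhs \<nu> f t x)) \<le> L powr (p - n + 2) * rhs_size m \<Phi>"
proof -
  note rS = nse_rhs_smooth[OF x(1), of f, OF f(1)]
  have m0: "0 \<le> m" using x(3) sob_norm_nonneg[of n x] by linarith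
  have \<Phi>0: "0 \<le> \<Phi>" using f(2) sob_norm_nonneg[of n "f t"] by linarith
  have L2: "L powr 1 \<le> L powr 2" "1 \<le> L powr 2" using L mult_mono[of 1 L 1 L] by (auto simp: power2_eq_square)
  have "sob_norm (n + (p - n)) (trunc L (nse_rhs \<nu> f t x)) \<le> L powr (p - n) * sob_norm n (trunc L (nse_rhs \<nu> f t x))"
    using p by (intro sob_norm_band_limited trunc_smooth rS band_limited_trunc) auto
  also have "sob_norm n (trunc L (nse_rhs \<nu> f t x)) \<le> sob_norm n (nse_rhs \<nu> f t x)"
    by (rule sob_norm_trunc_le[OF smooth_fields_finite[OF rS]])
  also have "\<dots> \<le> \<nu> * sob_norm (n + 2) x + K n * sob_norm n x * sob_norm (n + 1) x + sob_norm n (f t)"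
    by (rule nse_rhs_norm_le[of x f t, OF x(1) f(1) order_refl])
  also have "\<dots> \<le> \<nu> * (L powr 2 * m) + K n * m * (L powr 2 * m) + L powr 2 * \<Phi>"
  proof (intro add_mono mult_mono)
    have "sob_norm (n + 2) x \<le> L powr 2 * sob_norm n x" by (rule sob_norm_band_limited[OF x(1,2)]) simp
    also have "\<dots> \<le> L powr 2 * m" using x(3) by (intro mult_left_mono) auto
    finally show "sob_norm (n + 2) x \<le> L powr 2 * m" .
    have "sob_norm (n + 1) x \<le> L powr 1 * sob_norm n x" by (rule sob_norm_band_limited[OF x(1,2)]) simp
    also have "\<dots> \<le> L powr 2 * m" using x(3) L2 m0 by (intro mult_mono) auto
    finally show "sob_norm (n + 1) x \<le> L powr 2 * m" .
    show "sob_norm n (f t) \<le> L powr 2 * \<Phi>"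
      using f(2) L2 \<Phi>0 mult_right_mono[of 1 "L powr 2" \<Phi>] by simp
  qed (use \<nu> K_pos[of n] m0 x in auto)
  also have "\<dots> = L powr 2 * rhs_size m \<Phi>" by (simp add: rhs_size_def algebra_simps power2_eq_square)
  finally have "sob_norm p (trunc L (nse_rhs \<nu> f t x)) \<le> L powr (p - n) * (L powr 2 * rhs_size m \<Phi>)"
    by (simp add: mult_left_mono)
  then show ?thesis by (simp add: powr_add mult.assoc del: powr_numeral)
qed

text \<open>In contrast to the norm of the right-hand side, its pairing with \<open>x\<close> is
  bounded without any power of \<open>L\<close>.\<close>

lemma trunc_rhs_ip_le:
  fixes x :: "'d field"
  assumes x: "x \<in> smooth_fields" "band_limited L x" "sob_norm n x \<le> m"
    and f: "f t \<in> smooth_fields" and p: "n \<le> p"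
  shows "sob_ip p (trunc L (nse_rhs \<nu> f t x)) x \<le> GG p n * m * (sob_norm p x)\<^sup>2 + sob_norm p (f t) * sob_norm p x"
proof -
  note F = smooth_fields_finite[OF x(1), of p] smooth_fields_finite[OF smooth_fields_laplacian[OF x(1)], of p]
    smooth_fields_finite[OF nse_bilin_smooth[OF x(1,1)], of p] smooth_fields_finite[OF f, of p]
  have "sob_ip p (trunc L (nse_rhs \<nu> f t x)) x = sob_ip p (nse_rhs \<nu> f t x) x" by (rule sob_ip_trunc[OF x(2)])
  also have "\<dots> = \<nu> * sob_ip p (laplacian x) x + sob_ip p (nse_bilin x x) x + sob_ip p (f t) x"
    unfolding nse_rhs_def by (simp add: sob_ip_add_left sob_ip_scale_left F sob_finite_add sob_finite_scale)
  also have "\<nu> * sob_ip p (laplacian x) x \<le> 0" using \<nu> by (simp add: sob_ip_laplacian)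
  also have "sob_ip p (nse_bilin x x) x \<le> GG p n * sob_norm n x * (sob_norm p x)\<^sup>2"
    by (rule tame_kato_constsD(1)[OF GG n p x(1)])
  also have "\<dots> \<le> GG p n * m * (sob_norm p x)\<^sup>2"
    using GG_pos[OF p] x(3) by (intro mult_right_mono mult_left_mono) auto
  also have "sob_ip p (f t) x \<le> sob_norm p (f t) * sob_norm p x" using sob_ip_le[OF F(4,1)] by simp
  finally show ?thesis by simp
qed

text \<open>Expanding the square, the term linear in \<open>h\<close> is the energy pairing and is
  uniform in \<open>L\<close>; only the quadratic term sees the cutoff.\<close>

lemma euler_step_le:
  fixes x :: "'d field"
  assumes x: "x \<in> smooth_fields" "band_limited L x" "sob_norm n x \<le> m" and L: "1 \<le> L" and h: "0 \<le> h"
    and f: "f t \<in> smooth_fields" "sob_norm n (f t) \<le> \<Phi>" and p: "n \<le> p"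
  shows "(sob_norm p (\<lambda>k. x k + h *\<^sub>R trunc L (nse_rhs \<nu> f t x) k))\<^sup>2
    \<le> (sob_norm p x)\<^sup>2 + 2 * h * (GG p n * m * (sob_norm p x)\<^sup>2 + sob_norm p (f t) * sob_norm p x)
      + h * (h * L powr (2 * (p - n + 2))) * (rhs_size m \<Phi>)\<^sup>2"
proof -
  let ?F = "trunc L (nse_rhs \<nu> f t x)"
  have FS: "?F \<in> smooth_fields" by (intro trunc_smooth nse_rhs_smooth x f)
  have "(sob_norm p (\<lambda>k. x k + h *\<^sub>R ?F k))\<^sup>2 = (sob_norm p x)\<^sup>2 + 2 * h * sob_ip p ?F x + h\<^sup>2 * (sob_norm p ?F)\<^sup>2"
    by (intro sob_norm_add_scale_sq smooth_fields_finite x FS)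
  also have "2 * h * sob_ip p ?F x \<le> 2 * h * (GG p n * m * (sob_norm p x)\<^sup>2 + sob_norm p (f t) * sob_norm p x)"
    using h by (intro mult_left_mono trunc_rhs_ip_le x f p) auto
  also have "h\<^sup>2 * (sob_norm p ?F)\<^sup>2 \<le> h\<^sup>2 * (L powr (p - n + 2) * rhs_size m \<Phi>)\<^sup>2"
    by (intro mult_left_mono power_mono trunc_rhs_norm_le x f p L) auto
  also have "h\<^sup>2 * (L powr (p - n + 2) * rhs_size m \<Phi>)\<^sup>2 = h * (h * L powr (2 * (p - n + 2))) * (rhs_size m \<Phi>)\<^sup>2"
    unfolding mult_2[of "p - n + 2"] powr_add[of L "p - n + 2" "p - n + 2"] by (simp add: power2_eq_square mult_ac)
  finally show ?thesis by simp
qed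

text \<open>Bounds the growth of the squared norm of order \<open>n\<close> as long as it stays below \<open>M0\<^sup>2 + 1\<close>; the factor
  \<open>4 powr 4\<close> comes from \<open>powr_le_steps\<close> with \<open>q = 4\<close> and controls the quadratic error of a time step.\<close>

definition growth_rate :: "real \<Rightarrow> real \<Rightarrow> real" where
  "growth_rate M0 \<Phi> = 2 * (GG n n * sqrt (M0\<^sup>2 + 1) * (M0\<^sup>2 + 1) + \<Phi> * sqrt (M0\<^sup>2 + 1))
     + max 1 (4 powr 4) * (rhs_size (sqrt (M0\<^sup>2 + 1)) \<Phi>)\<^sup>2"

end

subsection \<open>The truncated Euler scheme\<close>

text \<open>The last condition on \<open>\<tau>\<close> lets the squared norm of order
  \<open>n\<close> grow by at most 1 during the whole run, which explains the radius
  \<open>m = sqrt (M0\<^sup>2 + 1)\<close>.\<close>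

locale euler_scheme = nse_constants K G GG \<nu> n dim
  for K G :: "real \<Rightarrow> real" and GG :: "real \<Rightarrow> real \<Rightarrow> real" and \<nu> n :: real and dim :: "'d::finite itself" +
  fixes f :: "real \<Rightarrow> 'd field" and a :: "'d field" and M0 \<Phi> \<tau> :: real
  assumes f: "time_Ck 0 {0..} f" and a: "a \<in> smooth_fields" "sob_norm n a \<le> M0"
    and f\<Phi>: "\<And>t. t \<in> {0..1} \<Longrightarrow> sob_norm n (f t) \<le> \<Phi>"
    and \<tau>: "0 < \<tau>" "\<tau> \<le> 1" "\<tau> * growth_rate M0 \<Phi> \<le> 1"
begin

definition m where "m = sqrt (M0\<^sup>2 + 1)"

definition h :: "nat \<Rightarrow> real" where "h N = \<tau> / real (steps N)"

primrec X :: "nat \<Rightarrow> nat \<Rightarrow> 'd field" where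
  "X N 0 = trunc (real (N + 1)) a"
| "X N (Suc j) = (\<lambda>k. X N j k + h N *\<^sub>R trunc (real (N + 1)) (nse_rhs \<nu> f (real j * h N) (X N j)) k)"

lemma h_pos: "0 < h N"
  using \<tau> steps_ge(2)[of N] by (simp add: h_def)

lemma h_steps: "real (steps N) * h N = \<tau>"
  using steps_ge(2)[of N] by (simp add: h_def)

lemma h_tendsto: "h \<longlonglongrightarrow> 0"
proof (rule tendsto_sandwich[OF _ _ tendsto_const])
  show "(\<lambda>N. 1 / real (N + 1)) \<longlonglongrightarrow> 0"
    using LIMSEQ_inverse_real_of_nat by (simp add: divide_inverse add.commute)
  show "\<forall>\<^sub>F N in sequentially. h N \<le> 1 / real (N + 1)"
  proof (intro always_eventually allI)
    fix N
    show "h N \<le> 1 / real (N + 1)"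
      unfolding h_def using \<tau> steps_ge[of N] by (intro frac_le) (auto simp del: of_nat_add simp flip: of_nat_le_iff[where 'a = real])
  qed
  show "\<forall>\<^sub>F N in sequentially. 0 \<le> h N" using h_pos by (simp add: less_imp_le)
qed

lemma step_time: "j \<le> steps N \<Longrightarrow> real j * h N \<in> {0..\<tau>}"
  using h_pos[of N] h_steps[of N] mult_right_mono[of "real j" "real (steps N)" "h N"] by simp

lemma f_smooth: "0 \<le> t \<Longrightarrow> f t \<in> smooth_fields"
  using time_Ck_smooth[OF f] by simp

lemma X_smooth: "X N j \<in> smooth_fields" and X_band: "band_limited (real (N + 1)) (X N j)"
proof (induction j)
  case (Suc j)
  { case 1
    have "f (real j * h N) \<in> smooth_fields" using h_pos[of N] by (intro f_smooth) simp
    then show ?case using Suc by (simp only: X.simps) (intro smooth_fields_add smooth_fields_scale trunc_smooth nse_rhs_smooth) }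
  { case 2 show ?case using Suc by (simp only: X.simps) (intro band_limited_add_scale band_limited_trunc) }
qed (simp_all only: X.simps trunc_smooth a band_limited_trunc)

lemma \<Phi>_nonneg: "0 \<le> \<Phi>"
  using order_trans[OF sob_norm_nonneg f\<Phi>[of 0]] by simp

lemma m_sq: "m\<^sup>2 = M0\<^sup>2 + 1" and m_pos: "0 < m"
  by (auto simp: m_def add_nonneg_pos)

text \<open>\<open>h N\<close> times the cutoff power in \<open>euler_step_le\<close> is bounded
  independently of \<open>N\<close>, since the number of steps outgrows every power. The quadratic
  error thus becomes one more term of size \<open>h N\<close>.\<close>

lemma X_step:
  assumes "j < steps N" "sob_norm n (X N j) \<le> m" "n \<le> p"
  shows "(sob_norm p (X N (Suc j)))\<^sup>2 \<le> (sob_norm p (X N j))\<^sup>2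
    + 2 * h N * (GG p n * m * (sob_norm p (X N j))\<^sup>2 + sob_norm p (f (real j * h N)) * sob_norm p (X N j))
    + h N * (max 1 ((2 * (p - n + 2)) powr (2 * (p - n + 2))) * (rhs_size m \<Phi>)\<^sup>2)"
proof -
  have t: "real j * h N \<in> {0..1}" using step_time[of j N] assms(1) \<tau> by auto
  have q: "0 \<le> 2 * (p - n + 2)" using assms(3) by simp
  have "h N * real (N + 1) powr (2 * (p - n + 2)) \<le> h N * (max 1 ((2 * (p - n + 2)) powr (2 * (p - n + 2))) * real (steps N))"
    using h_pos[of N] powr_le_steps[OF q, of N] by (intro mult_left_mono) auto
  also have "\<dots> = max 1 ((2 * (p - n + 2)) powr (2 * (p - n + 2))) * \<tau>"
    using h_steps[of N] by (simp add: mult_ac)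
  also have "\<dots> \<le> max 1 ((2 * (p - n + 2)) powr (2 * (p - n + 2))) * 1"
    using \<tau> by (intro mult_left_mono) auto
  finally have 1: "h N * real (N + 1) powr (2 * (p - n + 2)) \<le> max 1 ((2 * (p - n + 2)) powr (2 * (p - n + 2)))" by simp
  have "(sob_norm p (X N (Suc j)))\<^sup>2 \<le> (sob_norm p (X N j))\<^sup>2
    + 2 * h N * (GG p n * m * (sob_norm p (X N j))\<^sup>2 + sob_norm p (f (real j * h N)) * sob_norm p (X N j))
    + h N * (h N * real (N + 1) powr (2 * (p - n + 2))) * (rhs_size m \<Phi>)\<^sup>2"
    unfolding X.simps
    using t h_pos[of N] by (intro euler_step_le X_smooth X_band assms f_smooth f\<Phi>) auto
  also have "h N * (h N * real (N + 1) powr (2 * (p - n + 2))) * (rhs_size m \<Phi>)\<^sup>2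
      \<le> h N * max 1 ((2 * (p - n + 2)) powr (2 * (p - n + 2))) * (rhs_size m \<Phi>)\<^sup>2"
    using 1 h_pos[of N] by (intro mult_right_mono mult_left_mono) auto
  finally show ?thesis by (simp add: mult.assoc)
qed

text \<open>A bootstrap: the growth estimate holds only while the norm is at most \<open>m\<close>,
  so the induction carries the sharper bound that increases linearly in the elapsed time and reaches
  at most \<open>M0\<^sup>2 + 1\<close> by time \<open>\<tau>\<close>.\<close>

lemma X_bound_n: "j \<le> steps N \<Longrightarrow> sob_norm n (X N j) \<le> m"
proof -
  have "(sob_norm n (X N j))\<^sup>2 \<le> M0\<^sup>2 + real j * h N * growth_rate M0 \<Phi>" if "j \<le> steps N" for j
    using that
  proof (induction j)
    case 0
    have "sob_norm n (X N 0) \<le> M0"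
      using sob_norm_trunc_le[OF smooth_fields_finite[OF a(1)], of n] a(2) by (simp only: X.simps) (rule order_trans)
    then show ?case by (simp add: power_mono)
  next
    case (Suc j)
    have g0: "0 \<le> growth_rate M0 \<Phi>"
      using GG_pos[of n] \<Phi>_nonneg unfolding growth_rate_def by (intro add_nonneg_nonneg mult_nonneg_nonneg) auto
    have IH: "(sob_norm n (X N j))\<^sup>2 \<le> M0\<^sup>2 + real j * h N * growth_rate M0 \<Phi>" using Suc by simp
    have "real j * h N * growth_rate M0 \<Phi> \<le> \<tau> * growth_rate M0 \<Phi>"
      using step_time[of j N] Suc.prems g0 by (intro mult_right_mono) auto
    then have sq: "(sob_norm n (X N j))\<^sup>2 \<le> m\<^sup>2" using IH \<tau>(3) by (simp add: m_sq)
    then have le: "sob_norm n (X N j) \<le> m" using m_pos by (meson less_imp_le power2_le_imp_le)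
    have t: "real j * h N \<in> {0..1}" using step_time[of j N] Suc.prems \<tau> by auto
    have "GG n n * m * (sob_norm n (X N j))\<^sup>2 + sob_norm n (f (real j * h N)) * sob_norm n (X N j)
        \<le> GG n n * m * m\<^sup>2 + \<Phi> * m"
      using GG_pos[of n] m_pos \<Phi>_nonneg f\<Phi>[OF t] le sq by (intro add_mono mult_left_mono mult_mono) auto
    then have "2 * h N * (GG n n * m * (sob_norm n (X N j))\<^sup>2 + sob_norm n (f (real j * h N)) * sob_norm n (X N j))
        \<le> 2 * h N * (GG n n * m * m\<^sup>2 + \<Phi> * m)"
      using h_pos[of N] by (intro mult_left_mono) auto
    then have "(sob_norm n (X N (Suc j)))\<^sup>2 \<le> (sob_norm n (X N j))\<^sup>2
      + 2 * h N * (GG n n * m * m\<^sup>2 + \<Phi> * m) + h N * (max 1 (4 powr 4) * (rhs_size m \<Phi>)\<^sup>2)"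
      \<comment> \<open>At order \<open>p = n\<close> the exponent is
        \<open>2 * (p - n + 2) = 4\<close>, the one built into \<open>growth_rate\<close>.\<close>
      using X_step[of j N n] Suc.prems le by (simp del: X.simps powr_numeral)
    also have "\<dots> = (sob_norm n (X N j))\<^sup>2 + h N * growth_rate M0 \<Phi>"
      unfolding growth_rate_def m_def[symmetric] by (simp add: m_sq algebra_simps)
    finally show ?case using IH by (simp add: algebra_simps del: X.simps)
  qed
  moreover assume j: "j \<le> steps N"
  moreover have "real j * h N * growth_rate M0 \<Phi> \<le> 1"
  proof -
    have g0: "0 \<le> growth_rate M0 \<Phi>"
      using GG_pos[of n] \<Phi>_nonneg unfolding growth_rate_def by (intro add_nonneg_nonneg mult_nonneg_nonneg) auto
    have "real j * h N * growth_rate M0 \<Phi> \<le> \<tau> * growth_rate M0 \<Phi>"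
      using step_time[OF j] g0 by (intro mult_right_mono) auto
    then show ?thesis using \<tau>(3) by linarith
  qed
  ultimately have "(sob_norm n (X N j))\<^sup>2 \<le> m\<^sup>2" using m_sq by (smt (verit))
  then show ?thesis using m_pos by (meson less_imp_le power2_le_imp_le)
qed

lemma f_bounded:
  obtains C where "0 \<le> C" "\<And>t. t \<in> {0..1} \<Longrightarrow> sob_norm p (f t) \<le> C"
  using time_Ck_bounded[OF f, of "{0..1}" p] by auto

text \<open>With the norm of order \<open>n\<close> already bounded by \<open>m\<close>, the tame
  estimate is linear in the squared norm of order \<open>p\<close>. Gronwall then gives a bound on
  the same time interval, without shrinking \<open>\<tau>\<close> as \<open>p\<close> grows.\<close>

lemma X_bound_high:
  assumes p: "n \<le> p"
  shows "\<exists>C. \<forall>N j. j \<le> steps N \<longrightarrow> sob_norm p (X N j) \<le> C"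
proof -
  obtain \<Phi>p where \<Phi>p: "0 \<le> \<Phi>p" "\<And>t. t \<in> {0..1} \<Longrightarrow> sob_norm p (f t) \<le> \<Phi>p" using f_bounded by blast
  define Cp where "Cp = max 1 ((2 * (p - n + 2)) powr (2 * (p - n + 2))) * (rhs_size m \<Phi>)\<^sup>2"
  have Cp: "0 \<le> Cp" by (simp add: Cp_def)
  define \<alpha> where "\<alpha> = 2 * (GG p n * m + \<Phi>p) + Cp"
  have \<alpha>: "0 \<le> \<alpha>" using GG_pos[OF p] m_pos \<Phi>p Cp by (auto simp: \<alpha>_def intro!: add_nonneg_nonneg mult_nonneg_nonneg)
  define C where "C = ((sob_norm p a)\<^sup>2 + 1) * exp \<alpha>"
  have "(sob_norm p (X N j))\<^sup>2 + 1 \<le> C" if j: "j \<le> steps N" for N j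
  proof -
    have step: "(sob_norm p (X N (Suc j)))\<^sup>2 + 1 \<le> ((sob_norm p (X N j))\<^sup>2 + 1) * (1 + h N * \<alpha>)"
      if j: "j < steps N" for j
    proof -
      let ?b = "(sob_norm p (X N j))\<^sup>2"
      have t: "real j * h N \<in> {0..1}" using step_time[of j N] j \<tau> by auto
      \<comment> \<open>Turns the contribution of the force, linear in the norm, into one that is
        linear in \<open>?b + 1\<close>.\<close>
      have "sob_norm p (X N j) \<le> ?b + 1"
        using sum_squares_bound[of "sob_norm p (X N j)" 1] sob_norm_nonneg[of p "X N j"]
        by (simp only: one_power2 mult_1_right)
      then have "sob_norm p (f (real j * h N)) * sob_norm p (X N j) \<le> \<Phi>p * (?b + 1)"
        using \<Phi>p t by (intro mult_mono) auto
      moreover have "GG p n * m * ?b \<le> GG p n * m * (?b + 1)"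
        using GG_pos[OF p] m_pos by (intro mult_left_mono) auto
      ultimately have "2 * h N * (GG p n * m * ?b + sob_norm p (f (real j * h N)) * sob_norm p (X N j))
          \<le> 2 * h N * (GG p n * m * (?b + 1) + \<Phi>p * (?b + 1))"
        using h_pos[of N] by (intro mult_left_mono[where c = "2 * h N"] add_mono) auto
      moreover have "h N * Cp \<le> h N * (Cp * (?b + 1))"
        using h_pos[of N] Cp mult_left_mono[of 1 "?b + 1" Cp] by (intro mult_left_mono) auto
      moreover have "(sob_norm p (X N (Suc j)))\<^sup>2 \<le> ?b
          + 2 * h N * (GG p n * m * ?b + sob_norm p (f (real j * h N)) * sob_norm p (X N j)) + h N * Cp"
        unfolding Cp_def using j by (intro X_step X_bound_n p) auto
      ultimately have "(sob_norm p (X N (Suc j)))\<^sup>2 + 1 \<le> (?b + 1)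
          + 2 * h N * (GG p n * m * (?b + 1) + \<Phi>p * (?b + 1)) + h N * (Cp * (?b + 1))" by linarith
      also have "\<dots> = (?b + 1) * (1 + h N * \<alpha>)" by (simp add: \<alpha>_def algebra_simps)
      finally show ?thesis .
    qed
    have "(sob_norm p (X N j))\<^sup>2 + 1 \<le> ((sob_norm p (X N 0))\<^sup>2 + 1) * exp (h N * real j * \<alpha>)"
      using h_pos[of N] j \<alpha> step
      by (intro discrete_gronwall[where b = "\<lambda>j. (sob_norm p (X N j))\<^sup>2" and J = "steps N"]) auto
    also have "\<dots> \<le> ((sob_norm p a)\<^sup>2 + 1) * exp \<alpha>"
    proof (intro mult_mono add_right_mono power_mono)
      show "sob_norm p (X N 0) \<le> sob_norm p a"
        using sob_norm_trunc_le[OF smooth_fields_finite[OF a(1)]] by simp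
      have "h N * real j \<le> 1" using step_time[OF j] \<tau> by (simp add: mult.commute)
      then have "h N * real j * \<alpha> \<le> 1 * \<alpha>" using \<alpha> by (intro mult_right_mono)
      then show "exp (h N * real j * \<alpha>) \<le> exp \<alpha>" by simp
    qed auto
    finally show ?thesis by (simp add: C_def)
  qed
  then have "sob_norm p (X N j) \<le> sqrt C" if "j \<le> steps N" for N j
    using that by (intro real_le_rsqrt) (smt (verit))
  then show ?thesis by blast
qed

lemma X_bounds:
  obtains M R where "\<And>p. 0 \<le> M p" "\<And>p N j. j \<le> steps N \<Longrightarrow> sob_norm p (X N j) \<le> M p"
    "\<And>p. 0 \<le> R p" "\<And>p N j. j \<le> steps N \<Longrightarrow> sob_norm p (nse_rhs \<nu> f (real j * h N) (X N j)) \<le> R p"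
proof -
  have "\<exists>C. \<forall>N j. j \<le> steps N \<longrightarrow> sob_norm p (X N j) \<le> C" for p
  proof -
    obtain C where "\<forall>N j. j \<le> steps N \<longrightarrow> sob_norm (max n p) (X N j) \<le> C"
      using X_bound_high[of "max n p"] by auto
    then show ?thesis
      using sob_norm_order_mono[OF smooth_fields_finite[OF X_smooth], of p "max n p"] by (meson max.cobounded2 order_trans)
  qed
  then obtain M where M: "\<And>p N j. j \<le> steps N \<Longrightarrow> sob_norm p (X N j) \<le> M p" by metis
  have M0: "0 \<le> M p" for p using M[of 0 0 p] sob_norm_nonneg[of p "X 0 0"] by linarith
  have "\<exists>C\<ge>0. \<forall>N j. j \<le> steps N \<longrightarrow> sob_norm p (nse_rhs \<nu> f (real j * h N) (X N j)) \<le> C" for p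
  proof -
    define q where "q = max n p"
    have q: "n \<le> q" "p \<le> q" by (auto simp: q_def)
    obtain F where F: "0 \<le> F" "\<And>t. t \<in> {0..1} \<Longrightarrow> sob_norm q (f t) \<le> F" using f_bounded by blast
    have "sob_norm p (nse_rhs \<nu> f (real j * h N) (X N j)) \<le> \<nu> * M (q + 2) + K q * M q * M (q + 1) + F"
      if j: "j \<le> steps N" for N j
    proof -
      have t: "real j * h N \<in> {0..1}" using step_time[OF j] \<tau> by auto
      have fS: "f (real j * h N) \<in> smooth_fields" using t by (intro f_smooth) simp
      have "sob_norm p (nse_rhs \<nu> f (real j * h N) (X N j)) \<le> sob_norm q (nse_rhs \<nu> f (real j * h N) (X N j))"
        by (intro sob_norm_order_mono q smooth_fields_finite nse_rhs_smooth X_smooth fS)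
      also have "\<dots> \<le> \<nu> * sob_norm (q + 2) (X N j) + K q * sob_norm q (X N j) * sob_norm (q + 1) (X N j) + sob_norm q (f (real j * h N))"
        by (intro nse_rhs_norm_le X_smooth fS q)
      also have "\<dots> \<le> \<nu> * M (q + 2) + K q * M q * M (q + 1) + F"
        using \<nu> K_pos[OF q(1)] M[OF j] M0 F(2)[OF t] by (intro add_mono mult_mono mult_left_mono) auto
      finally show ?thesis .
    qed
    moreover have "0 \<le> \<nu> * M (q + 2) + K q * M q * M (q + 1) + F"
      using \<nu> K_pos[OF q(1)] M0 F(1) by (intro add_nonneg_nonneg mult_nonneg_nonneg) auto
    ultimately show ?thesis by blast
  qed
  then have "\<exists>R. \<forall>p. 0 \<le> R p \<and> (\<forall>N j. j \<le> steps N \<longrightarrow> sob_norm p (nse_rhs \<nu> f (real j * h N) (X N j)) \<le> R p)"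
    by (intro choice allI) blast
  then obtain R where R: "\<forall>p. 0 \<le> R p \<and> (\<forall>N j. j \<le> steps N \<longrightarrow> sob_norm p (nse_rhs \<nu> f (real j * h N) (X N j)) \<le> R p)"
    by blast
  show ?thesis by (rule that[of M R]) (use M M0 R in auto)
qed

end

subsection \<open>Convergence of the scheme and local existence\<close>

locale euler_bounds = euler_scheme K G GG \<nu> n dim f a M0 \<Phi> \<tau>
  for K G :: "real \<Rightarrow> real" and GG :: "real \<Rightarrow> real \<Rightarrow> real" and \<nu> n :: real and dim :: "'d::finite itself"
    and f :: "real \<Rightarrow> 'd field" and a :: "'d field" and M0 \<Phi> \<tau> :: real +
  fixes M R :: "real \<Rightarrow> real"
  assumes M_nonneg: "0 \<le> M p" and M: "j \<le> steps N \<Longrightarrow> sob_norm p (X N j) \<le> M p"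
    and R_nonneg: "0 \<le> R p"
    and R: "j \<le> steps N \<Longrightarrow> sob_norm p (nse_rhs \<nu> f (real j * h N) (X N j)) \<le> R p"
begin

definition idx :: "nat \<Rightarrow> real \<Rightarrow> nat" where "idx N t = nat \<lfloor>t / h N\<rfloor>"

definition U :: "nat \<Rightarrow> real \<Rightarrow> 'd field" where "U N t = X N (idx N t)"

definition grid_time :: "nat \<Rightarrow> real \<Rightarrow> real" where "grid_time N t = real (idx N t) * h N"

lemma idx_le: "t \<in> {0..\<tau>} \<Longrightarrow> idx N t \<le> steps N"
proof -
  assume t: "t \<in> {0..\<tau>}"
  have "t / h N \<le> real (steps N)" using t h_steps[of N] h_pos[of N] by (simp add: pos_divide_le_eq)
  then have "\<lfloor>t / h N\<rfloor> \<le> int (steps N)" by linarith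
  then show ?thesis by (simp add: idx_def)
qed

lemma idx_grid: "idx N (real j * h N) = j"
  using h_pos[of N] by (simp add: idx_def)

lemma grid_time_bounds:
  assumes "0 \<le> t"
  shows "grid_time N t \<le> t" "t < grid_time N t + h N" "0 \<le> grid_time N t"
proof -
  have r: "real (idx N t) = of_int \<lfloor>t / h N\<rfloor>" using assms h_pos[of N] by (simp add: idx_def)
  have "of_int \<lfloor>t / h N\<rfloor> \<le> t / h N" by (rule of_int_floor_le)
  then show "grid_time N t \<le> t" unfolding grid_time_def r by (rule pos_le_divide_eq[OF h_pos, THEN iffD1])
  have "t / h N < of_int \<lfloor>t / h N\<rfloor> + 1" by linarith
  then have "t < (of_int \<lfloor>t / h N\<rfloor> + 1) * h N" by (rule pos_divide_less_eq[OF h_pos, THEN iffD1])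
  then show "t < grid_time N t + h N"
    unfolding grid_time_def r by (simp only: distrib_right mult_1_left)
  show "0 \<le> grid_time N t" using h_pos[of N] by (simp add: grid_time_def)
qed

lemma idx_mono: "s \<le> t \<Longrightarrow> idx N s \<le> idx N t"
  unfolding idx_def using h_pos[of N] by (intro nat_mono floor_mono divide_right_mono) auto

lemma U_smooth: "U N t \<in> smooth_fields"
  by (simp add: U_def X_smooth)

lemma rhs_smooth: "0 \<le> t \<Longrightarrow> v \<in> smooth_fields \<Longrightarrow> nse_rhs \<nu> f t v \<in> smooth_fields"
  by (intro nse_rhs_smooth f_smooth)

lemma X_lipschitz:
  assumes "i \<le> j" "j \<le> steps N"
  shows "sob_norm p (\<lambda>k. X N j k - X N i k) \<le> (real j * h N - real i * h N) * R p"
  using assms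
proof (induction j rule: dec_induct)
  case (step j)
  let ?F = "trunc (real (N + 1)) (nse_rhs \<nu> f (real j * h N) (X N j))"
  have rS: "nse_rhs \<nu> f (real j * h N) (X N j) \<in> smooth_fields"
    using h_pos[of N] by (intro rhs_smooth X_smooth) simp
  have "(\<lambda>k. X N (Suc j) k - X N i k) = (\<lambda>k. (X N j k - X N i k) + h N *\<^sub>R ?F k)"
    by (simp add: fun_eq_iff)
  then have "sob_norm p (\<lambda>k. X N (Suc j) k - X N i k)
      \<le> sob_norm p (\<lambda>k. X N j k - X N i k) + sob_norm p (\<lambda>k. h N *\<^sub>R ?F k)"
    by (simp only:) (intro sob_norm_triangle smooth_fields_finite smooth_fields_diff smooth_fields_scale X_smooth trunc_smooth rS)
  also have "sob_norm p (\<lambda>k. h N *\<^sub>R ?F k) \<le> h N * R p"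
    using h_pos[of N] R[of j N p] step sob_norm_trunc_le[OF smooth_fields_finite[OF rS], of p "real (N + 1)"]
    by (simp add: sob_norm_scale)
  finally show ?case using step by (simp add: algebra_simps del: X.simps)
qed simp

text \<open>\<open>U\<close> is piecewise constant in time, so the Lipschitz bound of the iterates
  survives only up to one jump, the term \<open>h N\<close>, which disappears in the limit.\<close>

lemma U_lipschitz:
  assumes "s \<in> {0..\<tau>}" "t \<in> {0..\<tau>}"
  shows "sob_norm p (\<lambda>k. U N t k - U N s k) \<le> (\<bar>t - s\<bar> + h N) * R p"
proof -
  have le: "sob_norm p (\<lambda>k. U N t k - U N s k) \<le> (\<bar>t - s\<bar> + h N) * R p"
    if st: "s \<le> t" "s \<in> {0..\<tau>}" "t \<in> {0..\<tau>}" for s t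
  proof -
    have "sob_norm p (\<lambda>k. U N t k - U N s k) \<le> (grid_time N t - grid_time N s) * R p"
      unfolding U_def grid_time_def by (intro X_lipschitz idx_mono idx_le st)
    also have "\<dots> \<le> (\<bar>t - s\<bar> + h N) * R p"
      using grid_time_bounds[of t N] grid_time_bounds[of s N] st R_nonneg by (intro mult_right_mono) auto
    finally show ?thesis .
  qed
  show ?thesis
  proof (cases "s \<le> t")
    case False
    then show ?thesis using le[of t s] assms by (simp add: sob_norm_minus_commute[of p "U N t"] abs_minus_commute)
  qed (rule le, use assms in auto)
qed

lemma coeff_diff_le:
  assumes "v \<in> smooth_fields" "w \<in> smooth_fields"
  shows "norm (v k - w k) \<le> sob_norm 0 (\<lambda>k. v k - w k)"
  using sob_coeff_le_norm[OF smooth_fields_finite[OF smooth_fields_diff[OF assms]], of 0 k] assms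
  by (cases "k = 0") (auto simp: smooth_fields_at_0)

lemma countable_lattice: "countable (UNIV :: (int ^ 'd) set)"
proof -
  have "(UNIV :: (int ^ 'd) set) = (\<Union>N :: nat. {k. norm (wave k) \<le> real N})"
    using real_arch_simple by auto
  then show ?thesis using finite_lattice_ball by (metis countable_UN countableI_type countable_finite)
qed

text \<open>A diagonal selection over the countable set of pairs of a mode and a rational time,
  where \<open>M 0\<close> bounds the coefficients. Density of these times and the approximate
  Lipschitz bound give the Cauchy property at every time.\<close>

lemma convergent_subsequence:
  obtains \<sigma> v where "strict_mono \<sigma>" "\<And>t k. t \<in> {0..\<tau>} \<Longrightarrow> (\<lambda>N. U (\<sigma> N) t k) \<longlonglongrightarrow> v t k"
proof -
  let ?S = "(UNIV :: (int ^ 'd) set) \<times> (\<rat> \<inter> {0..\<tau>})"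
  have "countable ?S" by (intro countable_SIGMA countable_lattice countable_Int1 countable_rat)
  moreover have "norm (U N (snd x) (fst x)) \<le> M 0" if "x \<in> ?S" for N x
  proof -
    have "norm (U N (snd x) (fst x) - 0) \<le> sob_norm 0 (\<lambda>k. U N (snd x) k - 0)"
      by (rule coeff_diff_le[OF U_smooth smooth_fields_0])
    also have "\<dots> \<le> M 0" using M[OF idx_le, of "snd x" 0 N] that by (auto simp: U_def)
    finally show ?thesis by simp
  qed
  ultimately obtain \<sigma> where \<sigma>: "strict_mono \<sigma>"
    and conv: "\<And>x. x \<in> ?S \<Longrightarrow> \<exists>l. (\<lambda>N. U (\<sigma> N) (snd x) (fst x)) \<longlonglongrightarrow> l"
    using function_convergent_subsequence[of ?S "\<lambda>N x. U N (snd x) (fst x)" "M 0"] by blast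
  have h\<sigma>: "(\<lambda>N. h (\<sigma> N)) \<longlonglongrightarrow> 0"
    using LIMSEQ_subseq_LIMSEQ[OF h_tendsto \<sigma>] by (simp add: comp_def)
  have "convergent (\<lambda>N. U (\<sigma> N) t k)" if t: "t \<in> {0..\<tau>}" for t k
  proof -
    have "Cauchy (\<lambda>N. U (\<sigma> N) t k)"
    proof (rule metric_CauchyI)
      fix e :: real assume e: "0 < e"
      \<comment> \<open>Moving from \<open>t\<close> to \<open>q\<close> costs
        \<open>(\<bar>t - q\<bar> + h (\<sigma> N)) * R 0\<close>, and each of the two lengths is
        kept below \<open>\<eta>\<close>; the result is at most \<open>e / 3\<close>.\<close>
      define \<eta> where "\<eta> = e / (6 * (R 0 + 1))"
      have R1: "0 < R 0 + 1" using R_nonneg[of 0] by linarith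
      then have \<eta>: "0 < \<eta>" "2 * \<eta> * (R 0 + 1) = e / 3" using e by (auto simp: \<eta>_def field_simps)
      have "max 0 (t - \<eta>) < min \<tau> (t + \<eta>)" using t \<eta> \<tau> by auto
      then obtain q where q: "q \<in> \<rat>" "max 0 (t - \<eta>) < q" "q < min \<tau> (t + \<eta>)"
        using Rats_dense_in_real by blast
      have qI: "q \<in> {0..\<tau>}" and tq: "\<bar>t - q\<bar> < \<eta>" using q by auto
      obtain l where "(\<lambda>N. U (\<sigma> N) q k) \<longlonglongrightarrow> l" using conv[of "(k, q)"] q(1) qI by auto
      then have "Cauchy (\<lambda>N. U (\<sigma> N) q k)" by (rule LIMSEQ_imp_Cauchy)
      then obtain N1 where N1: "\<And>i j. i \<ge> N1 \<Longrightarrow> j \<ge> N1 \<Longrightarrow> dist (U (\<sigma> i) q k) (U (\<sigma> j) q k) < e / 3"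
        using e unfolding Cauchy_def by (meson divide_pos_pos zero_less_numeral)
      obtain N2 where N2: "\<And>N. N \<ge> N2 \<Longrightarrow> h (\<sigma> N) < \<eta>"
        using order_tendstoD(2)[OF h\<sigma> \<eta>(1)] unfolding eventually_sequentially by blast
      have close: "dist (U (\<sigma> N) t k) (U (\<sigma> N) q k) \<le> e / 3" if "N \<ge> N2" for N
      proof -
        have "dist (U (\<sigma> N) t k) (U (\<sigma> N) q k) \<le> sob_norm 0 (\<lambda>k. U (\<sigma> N) t k - U (\<sigma> N) q k)"
          unfolding dist_norm by (rule coeff_diff_le[OF U_smooth U_smooth])
        also have "\<dots> \<le> (\<bar>t - q\<bar> + h (\<sigma> N)) * R 0" by (rule U_lipschitz[OF qI t])
        also have "\<dots> \<le> (2 * \<eta>) * (R 0 + 1)"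
          using tq N2[OF that] h_pos[of "\<sigma> N"] R_nonneg[of 0] by (intro mult_mono) auto
        finally show ?thesis using \<eta> by simp
      qed
      show "\<exists>B. \<forall>i\<ge>B. \<forall>j\<ge>B. dist (U (\<sigma> i) t k) (U (\<sigma> j) t k) < e"
      proof (intro exI[of _ "max N1 N2"] allI impI)
        fix i j assume ij: "max N1 N2 \<le> i" "max N1 N2 \<le> j"
        have "dist (U (\<sigma> i) t k) (U (\<sigma> j) t k)
            \<le> dist (U (\<sigma> i) t k) (U (\<sigma> i) q k) + dist (U (\<sigma> i) q k) (U (\<sigma> j) q k) + dist (U (\<sigma> j) t k) (U (\<sigma> j) q k)"
          using dist_triangle[of "U (\<sigma> i) t k" "U (\<sigma> j) t k" "U (\<sigma> i) q k"]
            dist_triangle[of "U (\<sigma> i) q k" "U (\<sigma> j) t k" "U (\<sigma> j) q k"]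
            dist_commute[of "U (\<sigma> j) q k" "U (\<sigma> j) t k"] by linarith
        also have "\<dots> < e / 3 + e / 3 + e / 3"
          using close[of i] close[of j] N1[of i j] ij by linarith
        finally show "dist (U (\<sigma> i) t k) (U (\<sigma> j) t k) < e" by simp
      qed
    qed
    then show ?thesis by (rule Cauchy_convergent)
  qed
  then show ?thesis
    using \<sigma> by (intro that[of \<sigma> "\<lambda>t k. lim (\<lambda>N. U (\<sigma> N) t k)"]) (auto simp: convergent_LIMSEQ_iff)
qed

end

locale euler_limit = euler_bounds K G GG \<nu> n dim f a M0 \<Phi> \<tau> M R
  for K G :: "real \<Rightarrow> real" and GG :: "real \<Rightarrow> real \<Rightarrow> real" and \<nu> n :: real and dim :: "'d::finite itself"
    and f :: "real \<Rightarrow> 'd field" and a :: "'d field" and M0 \<Phi> \<tau> :: real and M R :: "real \<Rightarrow> real" +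
  fixes \<sigma> :: "nat \<Rightarrow> nat" and v :: "real \<Rightarrow> 'd field"
  assumes \<sigma>: "strict_mono \<sigma>"
    and conv: "t \<in> {0..\<tau>} \<Longrightarrow> (\<lambda>N. U (\<sigma> N) t k) \<longlonglongrightarrow> v t k"
begin

lemma h_subseq: "(\<lambda>N. h (\<sigma> N)) \<longlonglongrightarrow> 0"
  using LIMSEQ_subseq_LIMSEQ[OF h_tendsto \<sigma>] by (simp add: comp_def)

lemma pointwise_limit:
  assumes t: "t \<in> {0..\<tau>}"
  shows "limitin frechet (\<lambda>N. U (\<sigma> N) t) (v t) sequentially"
proof (rule limitin_frechet_of_coeff)
  show "\<exists>C. \<forall>\<^sub>F N in sequentially. sob_norm p (U (\<sigma> N) t) \<le> C" for p
    using M[OF idx_le[OF t]] by (intro exI[of _ "M p"]) (simp add: U_def)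
qed (auto simp: U_smooth conv[OF t])

lemma v_smooth: "t \<in> {0..\<tau>} \<Longrightarrow> v t \<in> smooth_fields"
  using pointwise_limit by (auto simp: limitin_frechet_iff)

lemma grid_time_subseq:
  assumes "0 \<le> t"
  shows "(\<lambda>N. grid_time (\<sigma> N) t) \<longlonglongrightarrow> t"
proof (rule tendsto_sandwich[where h = "\<lambda>_. t"])
  show "(\<lambda>N. t - h (\<sigma> N)) \<longlonglongrightarrow> t" using tendsto_diff[OF tendsto_const h_subseq, of t] by simp
qed (use grid_time_bounds[OF assms] in \<open>auto intro!: always_eventually simp: diff_le_eq less_imp_le\<close>)

abbreviation near :: "real \<Rightarrow> (nat \<times> real) filter" where
  "near r \<equiv> sequentially \<times>\<^sub>F inf (nhds r) (principal {0..\<tau>})"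

lemma near_snd: "\<forall>\<^sub>F x in near r. snd x \<in> {0..\<tau>}"
proof -
  have "\<forall>\<^sub>F t in inf (nhds r) (principal {0..\<tau>}). t \<in> {0..\<tau>}"
    by (simp add: eventually_inf_principal)
  then show ?thesis by (rule eventually_compose_filterlim[OF _ filterlim_snd])
qed

lemma near_small: "((\<lambda>x. \<bar>snd x - r\<bar> + h (\<sigma> (fst x))) \<longlongrightarrow> 0) (near r)"
proof -
  have "((\<lambda>x. h (\<sigma> (fst x))) \<longlongrightarrow> 0) (near r)"
    by (rule filterlim_compose[OF h_subseq filterlim_fst])
  moreover have "filterlim snd (nhds r) (near r)"
    by (rule filterlim_mono[OF filterlim_snd _ order_refl]) simp
  then have "((\<lambda>x. \<bar>snd x - r\<bar>) \<longlongrightarrow> \<bar>r - r\<bar>) (near r)"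
    by (rule tendsto_rabs[OF tendsto_diff[OF _ tendsto_const]])
  ultimately show ?thesis using tendsto_add by fastforce
qed

text \<open>Convergence at the fixed time \<open>r\<close>, plus the approximate Lipschitz bound for
  the distance between the values at \<open>snd x\<close> and at \<open>r\<close>.\<close>

lemma joint_limit:
  assumes r: "r \<in> {0..\<tau>}"
  shows "limitin frechet (\<lambda>x. U (\<sigma> (fst x)) (snd x)) (v r) (near r)"
  unfolding limitin_frechet_iff
proof (intro conjI allI)
  show "v r \<in> smooth_fields" by (rule v_smooth[OF r])
  show "\<forall>\<^sub>F x in near r. U (\<sigma> (fst x)) (snd x) \<in> smooth_fields" by (simp add: U_smooth)
  fix p
  let ?b = "\<lambda>x. (\<bar>snd x - r\<bar> + h (\<sigma> (fst x))) * R p + sob_norm p (\<lambda>k. U (\<sigma> (fst x)) r k - v r k)"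
  have "((\<lambda>x. sob_norm p (\<lambda>k. U (\<sigma> (fst x)) r k - v r k)) \<longlongrightarrow> 0) (near r)"
    by (rule filterlim_compose[OF _ filterlim_fst]) (use pointwise_limit[OF r] in \<open>auto simp: limitin_frechet_iff\<close>)
  then have "(?b \<longlongrightarrow> 0 * R p + 0) (near r)"
    by (intro tendsto_add tendsto_mult tendsto_const near_small)
  then have b: "(?b \<longlongrightarrow> 0) (near r)" by simp
  have "\<forall>\<^sub>F x in near r. sob_norm p (\<lambda>k. U (\<sigma> (fst x)) (snd x) k - v r k) \<le> ?b x"
    using near_snd
  proof eventually_elim
    case (elim x)
    have "sob_norm p (\<lambda>k. (U (\<sigma> (fst x)) (snd x) k - U (\<sigma> (fst x)) r k) + (U (\<sigma> (fst x)) r k - v r k))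
        \<le> sob_norm p (\<lambda>k. U (\<sigma> (fst x)) (snd x) k - U (\<sigma> (fst x)) r k) + sob_norm p (\<lambda>k. U (\<sigma> (fst x)) r k - v r k)"
      by (intro sob_norm_triangle smooth_fields_finite smooth_fields_diff U_smooth v_smooth r)
    also have "\<dots> \<le> ?b x" using U_lipschitz[OF r elim] by simp
    finally show ?case by simp
  qed
  then show "((\<lambda>x. sob_norm p (\<lambda>k. U (\<sigma> (fst x)) (snd x) k - v r k)) \<longlongrightarrow> 0) (near r)"
    by (intro tendsto_sandwich[OF _ _ tendsto_const b]) auto
qed

text \<open>Grid times may coincide with \<open>r\<close>, so the punctured limit that expresses
  continuity of \<open>f\<close> is first completed by the value at \<open>r\<close>.\<close>

lemma force_limit:
  assumes r: "r \<in> {0..\<tau>}"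
  shows "limitin frechet (\<lambda>x. f (grid_time (\<sigma> (fst x)) (snd x))) (f r) (near r)"
proof (rule limitin_filterlim_compose)
  have lim: "limitin frechet f (f r) (at r within {0..})" using time_Ck_limit[OF f] r by simp
  have fr: "f r \<in> smooth_fields" using r by (simp add: f_smooth)
  show "limitin frechet f (f r) (inf (nhds r) (principal {0..}))"
    unfolding limitin_def
  proof (intro conjI allI impI)
    show "f r \<in> topspace frechet" using fr by simp
    fix V assume V: "openin frechet V \<and> f r \<in> V"
    then have "\<forall>\<^sub>F s in at r within {0..}. f s \<in> V" using lim by (simp add: limitin_def)
    then show "\<forall>\<^sub>F s in inf (nhds r) (principal {0..}). f s \<in> V"
      unfolding eventually_inf_principal eventually_at_filter
      by (rule eventually_mono) (use V in auto)
  qed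
  show "filterlim (\<lambda>x. grid_time (\<sigma> (fst x)) (snd x)) (inf (nhds r) (principal {0..})) (near r)"
    unfolding filterlim_inf filterlim_principal
  proof
    show "\<forall>\<^sub>F x in near r. grid_time (\<sigma> (fst x)) (snd x) \<in> {0..}"
      using near_snd by eventually_elim (simp add: grid_time_bounds)
    show "((\<lambda>x. grid_time (\<sigma> (fst x)) (snd x)) \<longlongrightarrow> r) (near r)"
    proof (rule Lim_null[THEN iffD2], rule Lim_null_comparison[OF _ near_small])
      show "\<forall>\<^sub>F x in near r. norm (grid_time (\<sigma> (fst x)) (snd x) - r) \<le> \<bar>snd x - r\<bar> + h (\<sigma> (fst x))"
        using near_snd
      proof eventually_elim
        case (elim x)
        then have "0 \<le> snd x" by simp
        from grid_time_bounds[OF this, of "\<sigma> (fst x)"] show ?case by auto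
      qed
    qed
  qed
qed

lemma rhs_limit:
  assumes r: "r \<in> {0..\<tau>}"
  shows "limitin frechet (\<lambda>x. nse_rhs \<nu> f (grid_time (\<sigma> (fst x)) (snd x)) (U (\<sigma> (fst x)) (snd x)))
    (nse_rhs \<nu> f r (v r)) (near r)"
  unfolding nse_rhs_def
  by (intro limitin_frechet_add limitin_frechet_scale limitin_frechet_laplacian
      limitin_frechet_nse_bilin[OF K] joint_limit[OF r] force_limit[OF r])

lemma rhs_close:
  assumes r: "r \<in> {0..\<tau>}" and \<eta>: "0 < \<eta>"
  obtains N0 \<rho> where "0 < \<rho>" "\<And>N t. N0 \<le> N \<Longrightarrow> t \<in> {0..\<tau>} \<Longrightarrow> \<bar>t - r\<bar> < \<rho> \<Longrightarrow>
     norm (nse_rhs \<nu> f (grid_time (\<sigma> N) t) (U (\<sigma> N) t) k - nse_rhs \<nu> f r (v r) k) \<le> \<eta>"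
proof -
  have "\<forall>\<^sub>F x in near r. dist (nse_rhs \<nu> f (grid_time (\<sigma> (fst x)) (snd x)) (U (\<sigma> (fst x)) (snd x)) k) (nse_rhs \<nu> f r (v r) k) < \<eta>"
    by (rule tendstoD[OF limitin_frechet_coeff[OF rhs_limit[OF r]] \<eta>])
  then obtain P Q where P: "eventually P sequentially" and Q: "eventually Q (inf (nhds r) (principal {0..\<tau>}))"
    and PQ: "\<And>N t. P N \<Longrightarrow> Q t \<Longrightarrow> dist (nse_rhs \<nu> f (grid_time (\<sigma> N) t) (U (\<sigma> N) t) k) (nse_rhs \<nu> f r (v r) k) < \<eta>"
    unfolding eventually_prod_filter by auto
  obtain N0 where N0: "\<And>N. N0 \<le> N \<Longrightarrow> P N" using P unfolding eventually_sequentially by blast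
  obtain \<rho> where \<rho>: "0 < \<rho>" "\<And>t. t \<in> {0..\<tau>} \<Longrightarrow> \<bar>t - r\<bar> < \<rho> \<Longrightarrow> Q t"
    using Q unfolding eventually_inf_principal eventually_nhds_metric by (auto simp: dist_real_def)
  show ?thesis
    by (rule that[OF \<rho>(1), of N0]) (use PQ N0 \<rho>(2) in \<open>auto simp: dist_norm intro: less_imp_le\<close>)
qed

text \<open>The mode lies below the cutoff, so the truncation leaves it alone; for fixed
  \<open>k\<close> this holds for all large \<open>N\<close>.\<close>

lemma X_telescope:
  assumes "i \<le> l" "norm (wave k) \<le> real (N + 1)"
  shows "X N l k - X N i k = (\<Sum>j\<in>{i..<l}. h N *\<^sub>R nse_rhs \<nu> f (real j * h N) (X N j) k)"
  using assms(1)
proof (induction l rule: dec_induct)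
  case (step l)
  have "X N (Suc l) k = X N l k + h N *\<^sub>R nse_rhs \<nu> f (real l * h N) (X N l) k"
    using assms(2) by (simp add: trunc_def)
  then show ?case using step by (simp add: algebra_simps del: X.simps)
qed simp

text \<open>By \<open>rhs_close\<close> all summands of the telescoped increment of an approximation
  are close to \<open>h\<close> times the same vector once the grid points lie near
  \<open>r\<close>; the estimate passes to the limit. With two free end points
  \<open>s \<le> t\<close> it serves for both sides of \<open>r\<close>.\<close>

lemma increment_close:
  assumes r: "r \<in> {0..\<tau>}" and \<eta>: "0 < \<eta>"
  obtains \<rho> where "0 < \<rho>" "\<And>s t. s \<in> {0..\<tau>} \<Longrightarrow> t \<in> {0..\<tau>} \<Longrightarrow> s \<le> t \<Longrightarrow> \<bar>s - r\<bar> < \<rho> \<Longrightarrow> \<bar>t - r\<bar> < \<rho> \<Longrightarrow>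
     norm (v t k - v s k - (t - s) *\<^sub>R nse_rhs \<nu> f r (v r) k) \<le> \<eta> * (t - s)"
proof -
  let ?w = "nse_rhs \<nu> f r (v r) k"
  obtain N0 \<rho> where \<rho>: "0 < \<rho>" and close: "\<And>N t. N0 \<le> N \<Longrightarrow> t \<in> {0..\<tau>} \<Longrightarrow> \<bar>t - r\<bar> < \<rho> \<Longrightarrow>
     norm (nse_rhs \<nu> f (grid_time (\<sigma> N) t) (U (\<sigma> N) t) k - ?w) \<le> \<eta>"
    by (rule rhs_close[OF r \<eta>]) (rule that)
  show ?thesis
  proof (rule that[of "\<rho> / 2"])
    show "0 < \<rho> / 2" using \<rho> by simp
    fix s t assume st: "s \<in> {0..\<tau>}" "t \<in> {0..\<tau>}" "s \<le> t" "\<bar>s - r\<bar> < \<rho> / 2" "\<bar>t - r\<bar> < \<rho> / 2"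
    let ?g = "\<lambda>N. grid_time (\<sigma> N) t - grid_time (\<sigma> N) s"
    have s0: "0 \<le> s" and t0: "0 \<le> t" using st by auto
    have g: "?g \<longlonglongrightarrow> t - s" by (intro tendsto_diff grid_time_subseq s0 t0)
    have ev: "\<forall>\<^sub>F N in sequentially. norm (U (\<sigma> N) t k - U (\<sigma> N) s k - ?g N *\<^sub>R ?w) \<le> \<eta> * ?g N"
    proof -
      have "\<forall>\<^sub>F N in sequentially. N0 \<le> N" by (rule eventually_ge_at_top)
      moreover have "\<forall>\<^sub>F N in sequentially. h (\<sigma> N) < \<rho> / 2"
        using \<rho> by (intro order_tendstoD(2)[OF h_subseq]) simp
      moreover have "\<forall>\<^sub>F N in sequentially. nat \<lceil>norm (wave k)\<rceil> \<le> N" by (rule eventually_ge_at_top)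
      ultimately show ?thesis
      proof eventually_elim
        case (elim N)
        let ?N = "\<sigma> N" and ?i = "idx (\<sigma> N) s" and ?l = "idx (\<sigma> N) t"
        have il: "?i \<le> ?l" by (rule idx_mono[OF st(3)])
        have "norm (wave k) \<le> real (nat \<lceil>norm (wave k)\<rceil>)" by (rule real_nat_ceiling_ge)
        also have "\<dots> \<le> real (\<sigma> N + 1)" using elim(3) seq_suble[OF \<sigma>, of N] by linarith
        finally have kN: "norm (wave k) \<le> real (\<sigma> N + 1)" .
        have gN: "?g N = (\<Sum>j\<in>{?i..<?l}. h ?N)"
          using il by (simp add: grid_time_def of_nat_diff algebra_simps)
        have "U ?N t k - U ?N s k - ?g N *\<^sub>R ?w
            = (\<Sum>j\<in>{?i..<?l}. h ?N *\<^sub>R (nse_rhs \<nu> f (real j * h ?N) (X ?N j) k - ?w))"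
          unfolding gN U_def X_telescope[OF il kN] scaleR_diff_right sum_subtractf scaleR_sum_left ..
        also have "norm \<dots> \<le> (\<Sum>j\<in>{?i..<?l}. h ?N * \<eta>)"
        proof (rule sum_norm_le)
          fix j assume j: "j \<in> {?i..<?l}"
          define q where "q = real j * h ?N"
          have jl: "j \<le> steps ?N" using j idx_le[OF st(2), of ?N] by simp
          have "real ?i * h ?N \<le> q" "q \<le> real ?l * h ?N"
            unfolding q_def using j h_pos[of ?N] by (auto intro!: mult_right_mono)
          \<comment> \<open>The first grid point may precede \<open>s\<close> by up to one step;
            this is why \<open>\<rho>\<close> is halved and the step is kept below
            \<open>\<rho> / 2\<close>.\<close>
          then have "s - h ?N < q" "q \<le> t"
            using grid_time_bounds[OF s0, of ?N] grid_time_bounds[OF t0, of ?N] by (auto simp: grid_time_def)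
          then have "\<bar>q - r\<bar> < \<rho>" using st(4,5) elim(2) by linarith
          moreover have "q \<in> {0..\<tau>}" unfolding q_def by (rule step_time[OF jl])
          ultimately have "norm (nse_rhs \<nu> f (grid_time ?N q) (U ?N q) k - ?w) \<le> \<eta>"
            using close[OF elim(1)] by blast
          then have "norm (nse_rhs \<nu> f (real j * h ?N) (X ?N j) k - ?w) \<le> \<eta>"
            by (simp add: grid_time_def U_def q_def idx_grid)
          then show "norm (h ?N *\<^sub>R (nse_rhs \<nu> f (real j * h ?N) (X ?N j) k - ?w)) \<le> h ?N * \<eta>"
            using h_pos[of ?N] by (simp add: mult_left_mono)
        qed
        also have "\<dots> = \<eta> * ?g N" unfolding gN by (simp add: mult_ac)
        finally show ?case .
      qed
    qed
    show "norm (v t k - v s k - (t - s) *\<^sub>R ?w) \<le> \<eta> * (t - s)"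
    proof (rule tendsto_le[OF _ _ _ ev])
      show "(\<lambda>N. \<eta> * ?g N) \<longlonglongrightarrow> \<eta> * (t - s)" by (intro tendsto_intros g)
      show "(\<lambda>N. norm (U (\<sigma> N) t k - U (\<sigma> N) s k - ?g N *\<^sub>R ?w)) \<longlonglongrightarrow> norm (v t k - v s k - (t - s) *\<^sub>R ?w)"
        by (intro tendsto_norm tendsto_diff tendsto_scaleR tendsto_const g conv st)
    qed simp
  qed
qed

lemma coefficient_derivative:
  assumes r: "r \<in> {0..\<tau>}"
  shows "((\<lambda>t. v t k) has_vector_derivative nse_rhs \<nu> f r (v r) k) (at r within {0..\<tau>})"
  unfolding has_vector_derivative_def has_derivative_within_alt
proof (intro conjI allI impI)
  show "bounded_linear (\<lambda>x. x *\<^sub>R nse_rhs \<nu> f r (v r) k)" by (rule bounded_linear_scaleR_left)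
  fix e :: real assume "0 < e"
  then obtain \<rho> where \<rho>: "0 < \<rho>" and close: "\<And>s t. s \<in> {0..\<tau>} \<Longrightarrow> t \<in> {0..\<tau>} \<Longrightarrow> s \<le> t \<Longrightarrow> \<bar>s - r\<bar> < \<rho> \<Longrightarrow> \<bar>t - r\<bar> < \<rho> \<Longrightarrow>
     norm (v t k - v s k - (t - s) *\<^sub>R nse_rhs \<nu> f r (v r) k) \<le> e * (t - s)"
    using increment_close[OF r] by blast
  show "\<exists>d>0. \<forall>y\<in>{0..\<tau>}. norm (y - r) < d \<longrightarrow>
      norm (v y k - v r k - (y - r) *\<^sub>R nse_rhs \<nu> f r (v r) k) \<le> e * norm (y - r)"
  proof (intro exI[of _ \<rho>] conjI ballI impI \<rho>)
    fix y assume y: "y \<in> {0..\<tau>}" "norm (y - r) < \<rho>"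
    show "norm (v y k - v r k - (y - r) *\<^sub>R nse_rhs \<nu> f r (v r) k) \<le> e * norm (y - r)"
    proof (cases "r \<le> y")
      case True
      then show ?thesis using close[OF r y(1)] y(2) \<rho> by simp
    next
      case False
      have "v y k - v r k - (y - r) *\<^sub>R nse_rhs \<nu> f r (v r) k = - (v r k - v y k - (r - y) *\<^sub>R nse_rhs \<nu> f r (v r) k)"
        by (simp add: algebra_simps)
      then have "norm (v y k - v r k - (y - r) *\<^sub>R nse_rhs \<nu> f r (v r) k) = norm (v r k - v y k - (r - y) *\<^sub>R nse_rhs \<nu> f r (v r) k)"
        by (simp only: norm_minus_cancel)
      also have "\<dots> \<le> e * (r - y)" using close[OF y(1) r] y(2) \<rho> False by simp
      finally show ?thesis using False by simp
    qed
  qed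
qed

lemma v_0: "v 0 = a"
proof
  fix k :: "int ^ 'd"
  have "\<forall>\<^sub>F N in sequentially. nat \<lceil>norm (wave k)\<rceil> \<le> N" by (rule eventually_ge_at_top)
  then have "\<forall>\<^sub>F N in sequentially. U (\<sigma> N) 0 k = a k"
  proof eventually_elim
    case (elim N)
    have "norm (wave k) \<le> real (nat \<lceil>norm (wave k)\<rceil>)" by (rule real_nat_ceiling_ge)
    also have "\<dots> \<le> real (\<sigma> N + 1)" using elim seq_suble[OF \<sigma>, of N] by linarith
    finally show ?case by (simp add: U_def idx_def trunc_def)
  qed
  moreover have "(\<lambda>N. U (\<sigma> N) 0 k) \<longlonglongrightarrow> v 0 k" using \<tau> by (intro conv) simp
  ultimately show "v 0 k = a k" using tendsto_eventually_const_eq[of sequentially] by simp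
qed

text \<open>The bounds \<open>R p\<close>, uniform in the index and the time, pass to the limit
  along \<open>near s\<close>; they are what \<open>has_time_deriv_of_coeff\<close> requires beyond
  the derivatives of the coefficients.\<close>

lemma limit_solves:
  assumes r: "r \<in> {0..\<tau>}"
  shows "has_time_deriv {0..\<tau>} v (nse_rhs \<nu> f r (v r)) r"
proof (rule has_time_deriv_of_coeff[where F = "\<lambda>t. nse_rhs \<nu> f t (v t)"])
  show "at r within {0..\<tau>} \<noteq> bot"
    using r \<tau> by (simp add: trivial_limit_within islimpt_Icc)
  show "\<exists>C. \<forall>s\<in>{0..\<tau>}. sob_norm p (nse_rhs \<nu> f s (v s)) \<le> C" for p
  proof (intro exI[of _ "R p"] ballI)
    fix s assume s: "s \<in> {0..\<tau>}"
    have lim: "((\<lambda>x. sob_norm p (nse_rhs \<nu> f (grid_time (\<sigma> (fst x)) (snd x)) (U (\<sigma> (fst x)) (snd x))))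
        \<longlongrightarrow> sob_norm p (nse_rhs \<nu> f s (v s))) (near s)"
      by (rule limitin_frechet_sob_norm[OF rhs_limit[OF s]])
    have ev: "\<forall>\<^sub>F x in near s. sob_norm p (nse_rhs \<nu> f (grid_time (\<sigma> (fst x)) (snd x)) (U (\<sigma> (fst x)) (snd x))) \<le> R p"
      using near_snd
    proof eventually_elim
      case (elim x)
      then show ?case unfolding grid_time_def U_def by (intro R idx_le)
    qed
    have "inf (nhds s) (principal {0..\<tau>}) \<noteq> bot"
    proof
      assume "inf (nhds s) (principal {0..\<tau>}) = bot"
      then have "\<forall>\<^sub>F x in inf (nhds s) (principal {0..\<tau>}). False" by simp
      then have "\<forall>\<^sub>F x in nhds s. x \<notin> {0..\<tau>}" by (simp add: eventually_inf_principal)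
      then show False using s eventually_nhds_x_imp_x by blast
    qed
    then have "near s \<noteq> bot" by (simp add: prod_filter_eq_bot)
    then show "sob_norm p (nse_rhs \<nu> f s (v s)) \<le> R p" by (rule tendsto_upperbound[OF lim ev])
  qed
  show "nse_rhs \<nu> f s (v s) \<in> smooth_fields" if "s \<in> {0..\<tau>}" for s
    using that by (intro rhs_smooth v_smooth) auto
qed (use r in \<open>auto intro: v_smooth coefficient_derivative\<close>)

end

context nse_constants
begin

lemma growth_rate_nonneg: "0 \<le> \<Phi> \<Longrightarrow> 0 \<le> growth_rate M0 \<Phi>"
  using GG_pos[of n] unfolding growth_rate_def by (intro add_nonneg_nonneg mult_nonneg_nonneg) auto

lemma nse_local_existence:
  fixes f :: "real \<Rightarrow> 'd field"
  assumes f: "time_Ck 0 {0..} f" and a: "a \<in> smooth_fields" "sob_norm n a \<le> M0"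
    and f\<Phi>: "\<And>t. t \<in> {0..1} \<Longrightarrow> sob_norm n (f t) \<le> \<Phi>"
  defines "\<tau> \<equiv> 1 / (1 + growth_rate M0 \<Phi>)"
  obtains v where "v 0 = a" "\<And>t. t \<in> {0..\<tau>} \<Longrightarrow> v t \<in> smooth_fields"
    "\<And>t. t \<in> {0..\<tau>} \<Longrightarrow> has_time_deriv {0..\<tau>} v (nse_rhs \<nu> f t (v t)) t"
proof -
  have "0 \<le> \<Phi>" using order_trans[OF sob_norm_nonneg f\<Phi>[of 0]] by simp
  then have g: "0 \<le> growth_rate M0 \<Phi>" by (rule growth_rate_nonneg)
  interpret euler_scheme K G GG \<nu> n dim f a M0 \<Phi> \<tau>
    by unfold_locales (use f a f\<Phi> g in \<open>auto simp: \<tau>_def divide_simps simp del: time_Ck.simps\<close>)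
  obtain M R where MR: "\<And>p. 0 \<le> M p" "\<And>p N j. j \<le> steps N \<Longrightarrow> sob_norm p (X N j) \<le> M p"
    "\<And>p. 0 \<le> R p" "\<And>p N j. j \<le> steps N \<Longrightarrow> sob_norm p (nse_rhs \<nu> f (real j * h N) (X N j)) \<le> R p"
    using X_bounds by blast
  interpret euler_bounds K G GG \<nu> n dim f a M0 \<Phi> \<tau> M R
    by unfold_locales (use MR in auto)
  obtain \<sigma> v where \<sigma>: "strict_mono \<sigma>" "\<And>t k. t \<in> {0..\<tau>} \<Longrightarrow> (\<lambda>N. U (\<sigma> N) t k) \<longlonglongrightarrow> v t k"
    using convergent_subsequence by blast
  interpret euler_limit K G GG \<nu> n dim f a M0 \<Phi> \<tau> M R \<sigma> v
    by unfold_locales (use \<sigma> in auto)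
  show ?thesis by (rule that[of v]) (use v_0 v_smooth limit_solves in auto)
qed

end

subsection \<open>Continuation of solutions\<close>

lemma has_time_deriv_shift:
  assumes "has_time_deriv I u u' (c + t)" "\<And>s. s \<in> J \<Longrightarrow> c + s \<in> I"
  shows "has_time_deriv J (\<lambda>s. u (c + s)) u' t"
proof -
  have "filterlim (\<lambda>s. c + s) (at (c + t) within I) (at t within J)"
    unfolding filterlim_at
  proof
    show "\<forall>\<^sub>F s in at t within J. c + s \<in> I \<and> c + s \<noteq> c + t"
      using assms(2) by (simp add: eventually_at_filter)
    show "((\<lambda>s. c + s) \<longlongrightarrow> c + t) (at t within J)" by (intro tendsto_intros)
  qed
  from limitin_filterlim_compose[OF assms(1)[unfolded has_time_deriv_eq] this]
  show ?thesis by (simp add: has_time_deriv_eq)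
qed

text \<open>For gluing: a function put together from two solutions inherits the derivative wherever
  it agrees with one of them near \<open>t\<close>.\<close>

lemma has_time_deriv_local:
  assumes "has_time_deriv I u u' t" "open W" "t \<in> W" "J \<inter> W \<subseteq> I"
    and eq: "\<And>s. s \<in> W \<Longrightarrow> s \<in> J \<or> s = t \<Longrightarrow> w s = u s"
  shows "has_time_deriv J w u' t"
proof -
  have at: "at t within J = at t within (J \<inter> W)"
    by (rule at_within_nhd[OF assms(3,2)]) auto
  have lim: "limitin frechet (\<lambda>s k. (1 / (s - t)) *\<^sub>R (u s k - u t k)) u' (at t within (J \<inter> W))"
    using has_time_deriv_subset[OF assms(1,4)] by (simp add: has_time_deriv_eq)
  have "\<forall>\<^sub>F s in at t within (J \<inter> W). (\<lambda>k. (1 / (s - t)) *\<^sub>R (u s k - u t k)) = (\<lambda>k. (1 / (s - t)) *\<^sub>R (w s k - w t k))"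
    using eq assms(3) by (simp add: eventually_at_filter)
  from limitin_transform_eventually[OF this lim] show ?thesis
    by (simp add: has_time_deriv_eq at)
qed

lemma time_ivl_infinity: "time_ivl \<infinity> = {0..}"
  by (auto simp: time_ivl_def)

lemma time_ivl_ereal: "time_ivl (ereal T) = {0..<T}"
  by (auto simp: time_ivl_def)

context nse_constants
begin

text \<open>The existence time of the local solution depends only on a bound for the norm of order \<open>n\<close> of
  the datum, so that a solution bounded in this norm can be restarted shortly before its final time.\<close>

lemma nse_continuation:
  fixes u :: "real \<Rightarrow> 'd field" and f :: "real \<Rightarrow> 'd field"
  assumes T: "0 < T" and f: "time_Ck 0 {0..} f"
    and u: "\<And>t. t \<in> {0..<T} \<Longrightarrow> u t \<in> smooth_fields"
      "\<And>t. t \<in> {0..<T} \<Longrightarrow> has_time_deriv {0..<T} u (nse_rhs \<nu> f t (u t)) t"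
    and bd: "\<And>t. t \<in> {0..<T} \<Longrightarrow> sob_norm n (u t) \<le> M0"
  obtains T2 u2 where "T < T2" "\<And>t. t \<in> {0..<T} \<Longrightarrow> u2 t = u t"
    "\<And>t. t \<in> {0..<T2} \<Longrightarrow> u2 t \<in> smooth_fields"
    "\<And>t. t \<in> {0..<T2} \<Longrightarrow> has_time_deriv {0..<T2} u2 (nse_rhs \<nu> f t (u2 t)) t"
proof -
  \<comment> \<open>The bound up to \<open>T + 1\<close> covers a unit of time after any restart
    before \<open>T\<close>, so \<open>\<tau>\<close> is fixed independently of
    \<open>t0\<close>.\<close>
  obtain \<Phi> where \<Phi>: "0 \<le> \<Phi>" "\<And>t. t \<in> {0..T + 1} \<Longrightarrow> sob_norm n (f t) \<le> \<Phi>"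
    using time_Ck_bounded[OF f, of "{0..T + 1}" n] by auto
  define \<tau> where "\<tau> = 1 / (1 + growth_rate M0 \<Phi>)"
  have \<tau>: "0 < \<tau>" using growth_rate_nonneg[OF \<Phi>(1), of M0] by (simp add: \<tau>_def)
  \<comment> \<open>At most \<open>\<tau> / 2\<close> before \<open>T\<close>, so that a solution
    living for time \<open>\<tau>\<close> passes \<open>T\<close>.\<close>
  define t0 where "t0 = max 0 (T - \<tau> / 2)"
  have t0: "0 \<le> t0" "t0 < T" "T < t0 + \<tau>" using T \<tau> by (auto simp: t0_def)
  define fs where "fs = (\<lambda>t. f (t0 + t))"
  have fs: "time_Ck 0 {0..} fs"
    unfolding time_Ck_0_iff fs_def
  proof
    fix t :: real assume t: "t \<in> {0..}"
    have "filterlim (\<lambda>s. t0 + s) (at (t0 + t) within {0..}) (at t within {0..})"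
      unfolding filterlim_at using t0 by (auto simp: eventually_at_filter intro!: tendsto_intros)
    from limitin_filterlim_compose[OF time_Ck_limit[OF f] this] t t0
    show "limitin frechet (\<lambda>s. f (t0 + s)) (f (t0 + t)) (at t within {0..})" by simp
  qed
  have rhs_fs: "nse_rhs \<nu> fs s x = nse_rhs \<nu> f (t0 + s) x" for s x
    by (simp add: nse_rhs_def fs_def)
  have "sob_norm n (fs t) \<le> \<Phi>" if "t \<in> {0..1}" for t
    using \<Phi>(2)[of "t0 + t"] that t0 by (simp add: fs_def)
  then obtain v where v: "v 0 = u t0" "\<And>t. t \<in> {0..\<tau>} \<Longrightarrow> v t \<in> smooth_fields"
    "\<And>t. t \<in> {0..\<tau>} \<Longrightarrow> has_time_deriv {0..\<tau>} v (nse_rhs \<nu> fs t (v t)) t"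
    using nse_local_existence[OF fs u(1)[of t0] bd[of t0], of \<Phi>] t0 unfolding \<tau>_def[symmetric] by auto
  have agree: "u (t0 + s) = v s" if s: "0 \<le> s" "t0 + s < T" for s
  proof (rule nse_uniqueness[where S = "ereal (T - t0)" and f = fs and u = "\<lambda>s. u (t0 + s)"])
    fix t assume "t \<in> time_ivl (ereal (T - t0))"
    then have t: "0 \<le> t" "t0 + t < T" "t \<in> {0..\<tau>}" "t0 + t \<in> {0..<T}" using t0 by (auto simp: time_ivl_ereal)
    show "u (t0 + t) \<in> smooth_fields" using u(1) t by auto
    show "v t \<in> smooth_fields" using v(2) t by auto
    show "has_time_deriv (time_ivl (ereal (T - t0))) v (nse_rhs \<nu> fs t (v t)) t"
      by (rule has_time_deriv_subset[OF v(3)[OF t(3)]]) (use t0 in \<open>auto simp: time_ivl_ereal\<close>)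
    show "has_time_deriv (time_ivl (ereal (T - t0))) (\<lambda>s. u (t0 + s)) (nse_rhs \<nu> fs t (u (t0 + t))) t"
      unfolding rhs_fs by (rule has_time_deriv_shift[OF u(2)[OF t(4)]]) (use t0 in \<open>auto simp: time_ivl_ereal\<close>)
    show "fs t \<in> smooth_fields" using time_Ck_smooth[OF fs] t by simp
  next
    show "s \<in> time_ivl (ereal (T - t0))" using s by (simp add: time_ivl_ereal)
  qed (simp add: v(1))
  \<comment> \<open>Both branches agree between \<open>t0\<close> and \<open>T\<close>. Hence
    \<open>u2\<close> coincides near every time with one of the two solutions, and the switch at
    \<open>T\<close> is interior to the second.\<close>
  define u2 where "u2 = (\<lambda>t. if t < T then u t else v (- t0 + t))"
  have u2v: "u2 t = v (- t0 + t)" if "t0 \<le> t" for t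
    using agree[of "- t0 + t"] that by (auto simp: u2_def)
  show ?thesis
  proof (rule that[of "t0 + \<tau>" u2])
    show "T < t0 + \<tau>" by (rule t0)
    show "u2 t = u t" if "t \<in> {0..<T}" for t using that by (simp add: u2_def)
    fix t assume t: "t \<in> {0..<t0 + \<tau>}"
    show "u2 t \<in> smooth_fields"
      using u(1)[of t] v(2)[of "- t0 + t"] t t0 by (auto simp: u2_def)
    show "has_time_deriv {0..<t0 + \<tau>} u2 (nse_rhs \<nu> f t (u2 t)) t"
    proof (cases "t < T")
      case True
      have "has_time_deriv {0..<T} u (nse_rhs \<nu> f t (u2 t)) t" using u(2)[of t] t True by (simp add: u2_def)
      then show ?thesis
        by (rule has_time_deriv_local[where W = "{..<T}"]) (use True in \<open>auto simp: u2_def\<close>)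
    next
      case False
      then have tt: "t0 < t" "- t0 + t \<in> {0..\<tau>}" using t t0 by auto
      have "has_time_deriv {t0..t0 + \<tau>} (\<lambda>s. v (- t0 + s)) (nse_rhs \<nu> fs (- t0 + t) (v (- t0 + t))) t"
        by (rule has_time_deriv_shift[OF v(3)[OF tt(2)]]) auto
      then have "has_time_deriv {t0..t0 + \<tau>} (\<lambda>s. v (- t0 + s)) (nse_rhs \<nu> f t (u2 t)) t"
        using u2v[of t] tt by (simp add: rhs_fs)
      then show ?thesis
        by (rule has_time_deriv_local[where W = "{t0<..}"]) (use tt u2v in auto)
    qed
  qed
qed

subsection \<open>The control inequalities\<close>

text \<open>Common to (i) and (ii): \<open>p = n\<close> with \<open>X\<close> the norm itself makes
  \<open>g\<close> quadratic, \<open>p > n\<close> with \<open>X\<close> the control function of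
  order \<open>n\<close> makes it linear. The difference quotient \<open>m\<close> takes the norm as
  an argument because in the quadratic case it depends on it.\<close>

lemma control_comparison:
  fixes u v v' :: "real \<Rightarrow> 'd field" and f :: "real \<Rightarrow> 'd field"
  defines "\<phi> \<equiv> \<lambda>p t. sob_norm p (\<lambda>k. u t k - v t k)"
  assumes u: "\<And>t. t \<in> time_ivl S \<Longrightarrow> u t \<in> smooth_fields"
      "\<And>t. t \<in> time_ivl S \<Longrightarrow> has_time_deriv (time_ivl S) u (nse_rhs \<nu> f t (u t)) t"
    and v: "\<And>t. t \<in> time_ivl S \<Longrightarrow> v t \<in> smooth_fields"
      "\<And>t. t \<in> time_ivl S \<Longrightarrow> has_time_deriv (time_ivl S) v (v' t) t"
    and f: "\<And>t. t \<in> time_ivl S \<Longrightarrow> f t \<in> smooth_fields"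
    and e: "\<And>t. t \<in> time_ivl S \<Longrightarrow> sob_norm p (\<lambda>k. v' t k - nse_rhs \<nu> f t (v t) k) \<le> \<epsilon> t"
    and D: "\<And>t. t \<in> time_ivl S \<Longrightarrow> sob_norm p (v t) \<le> Dp t" "\<And>t. t \<in> time_ivl S \<Longrightarrow> sob_norm (p + 1) (v t) \<le> Dq t"
    and p: "n \<le> p"
    and X: "\<And>t. t \<in> time_ivl S \<Longrightarrow> \<phi> n t \<le> X t"
    and g: "\<And>t. t \<in> time_ivl S \<Longrightarrow>
      - \<nu> * \<phi> p t + (G p * Dp t + K p * Dq t + GG p n * X t) * \<phi> p t + \<epsilon> t = g t (\<phi> p t)"
    and m: "continuous_on (time_ivl S) (\<phi> p) \<Longrightarrow> continuous_on (time_ivl S) (m (\<phi> p))"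
      "\<And>t. t \<in> time_ivl S \<Longrightarrow> g t (R t) - g t (\<phi> p t) = m (\<phi> p) t * (R t - \<phi> p t)"
    and R: "continuous_on (time_ivl S) R" "\<And>t. t \<in> time_ivl S \<Longrightarrow> ereal (g t (R t)) \<le> dini R t"
    and init: "\<phi> p 0 \<le> R 0" and b: "b \<in> time_ivl S"
  shows "\<phi> p b \<le> R b"
proof -
  have c: "time_Ck 0 (time_ivl S) u" "time_Ck 0 (time_ivl S) v"
    unfolding time_Ck_0_iff using has_time_deriv_imp_limit u v by blast+
  then have "time_Ck 0 (time_ivl S) (\<lambda>t k. u t k - v t k)"
    using time_Ck_add[OF c(1) time_Ck_scale[OF c(2), of "-1"]] by simp
  then have c\<phi>: "continuous_on (time_ivl S) (\<phi> p)"
    unfolding \<phi>_def by (rule time_Ck_sob_norm_continuous)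
  note sub = time_ivl_atLeastAtMost[OF b]
  show ?thesis
  proof (rule dini_comparison[where b = b and \<phi> = "\<phi> p" and R = R and m = "m (\<phi> p)" and g = g and ?t1.0 = b])
    fix t assume "0 \<le> t" "t < b"
    then have t: "t \<in> time_ivl S" using sub by auto
    show "ereal (g t (R t)) \<le> dini R t" by (rule R(2)[OF t])
    show "g t (R t) - g t (\<phi> p t) = m (\<phi> p) t * (R t - \<phi> p t)" by (rule m(2)[OF t])
    fix \<eta> :: real assume \<eta>: "0 < \<eta>"
    show "\<forall>\<^sub>F h in at_right 0. \<phi> p (t + h) \<le> \<phi> p t + h * (g t (\<phi> p t) + \<eta>)"
      unfolding g[OF t, symmetric] unfolding \<phi>_def
      by (rule perturbation_growth[OF t u(1,2)[OF t] v(1,2)[OF t] f[OF t] e[OF t] D(1,2)[OF t] p \<eta> X[OF t, unfolded \<phi>_def]])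
  qed (use time_ivl_nonneg[OF b] init in \<open>auto intro!: continuous_on_subset[OF _ sub] c\<phi> R(1) m(1)\<close>)
qed

end

lemma time_deriv_eq:
  fixes u :: "real \<Rightarrow> 'd::finite field"
  assumes "has_time_deriv (time_ivl T) u u' t" "t \<in> time_ivl T"
  shows "time_deriv (time_ivl T) u t = u'"
  unfolding time_deriv_def
proof (rule the_equality)
  show "has_time_deriv (time_ivl T) u u' t" by (rule assms(1))
  show "u'' = u'" if "has_time_deriv (time_ivl T) u u'' t" for u''
    using that assms(1) at_within_time_ivl_neq_bot[OF assms(2)]
    unfolding has_time_deriv_eq by (rule limitin_frechet_unique)
qed

theorem proposition4p4:
  fixes \<nu> :: real
    and f u ua :: "real \<Rightarrow> ('d::finite) field" and u0 :: "'d field"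
    and T Ta :: ereal
    and \<epsilon> D :: "real \<Rightarrow> real \<Rightarrow> real" and \<delta> :: "real \<Rightarrow> real"
    and K G :: "real \<Rightarrow> real" and GG :: "real \<Rightarrow> real \<Rightarrow> real"
    and n :: real
  assumes "CARD('d) \<ge> 2" and "\<nu> \<ge> 0"
    and "time_smooth (time_ivl \<infinity>) f" and "u0 \<in> smooth_fields"
    and "nse_maximal_solution \<nu> f u0 T u"
    and "approx_solution Ta ua"
    and "\<And>p. p > real CARD('d) / 2 + 1 \<Longrightarrow> diff_error_estimator \<nu> f Ta ua p (\<epsilon> p)"
    and "\<And>p. p > real CARD('d) / 2 + 1 \<Longrightarrow> datum_error_estimator u0 ua p (\<delta> p)"
    and "\<And>p. p > real CARD('d) / 2 + 1 \<Longrightarrow> growth_estimator Ta ua p (D p)"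
    and "basic_consts TYPE('d) K" and "kato_consts TYPE('d) G" and "tame_kato_consts TYPE('d) GG"
    and "\<And>m. m > real CARD('d) / 2 + 1 \<Longrightarrow> GG m m = G m"
    and "n > real CARD('d) / 2 + 1"
  shows
    "\<comment> \<open>the control inequalities are fulfilled as equalities by a unique \<open>C\<^sup>1\<close> function,
        for a suitable \<open>Tc\<close>\<close>
     (\<exists>Tc R. 0 < Tc \<and> Tc \<le> Ta \<and> real_C1 (time_ivl Tc) R \<and> R 0 = \<delta> n \<and>
        (\<forall>t \<in> time_ivl Tc. dini R t = ereal (control_rhs \<nu> K G \<epsilon> D n R t)) \<and>
        (\<forall>S. real_C1 (time_ivl Tc) S \<and> S 0 = \<delta> n \<and>
             (\<forall>t \<in> time_ivl Tc. dini S t = ereal (control_rhs \<nu> K G \<epsilon> D n S t))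
           \<longrightarrow> (\<forall>t \<in> time_ivl Tc. S t = R t)))
     \<and>
     (\<forall>Tc Rn. 0 < Tc \<and> Tc \<le> Ta \<and> continuous_on (time_ivl Tc) Rn \<and>
        (\<forall>t \<in> time_ivl Tc. dini Rn t \<ge> ereal (control_rhs \<nu> K G \<epsilon> D n Rn t)) \<and> Rn 0 \<ge> \<delta> n \<longrightarrow>
        \<comment> \<open>(i)\<close>
        T \<ge> Tc \<and>
        (\<forall>t \<in> time_ivl Tc. sob_norm n (\<lambda>k. u t k - ua t k) \<le> Rn t) \<and>
        (Tc = \<infinity> \<longrightarrow> T = \<infinity>) \<and>
        \<comment> \<open>(ii)\<close>
        (\<forall>p > n.
           (\<forall>Rp. continuous_on (time_ivl Tc) Rp \<and>
              (\<forall>t \<in> time_ivl Tc. dini Rp t \<ge> ereal (lin_control_rhs \<nu> K G GG \<epsilon> D n p Rn Rp t)) \<and> Rp 0 \<ge> \<delta> p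
              \<longrightarrow> (\<forall>t \<in> time_ivl Tc. sob_norm p (\<lambda>k. u t k - ua t k) \<le> Rp t)) \<and>
           (let A = \<lambda>t. integral {0..t} (\<lambda>s. G p * D p s + K p * D (p + 1) s + GG p n * Rn s);
                R = \<lambda>t. exp (- \<nu> * t + A t) *
                      (\<delta> p + integral {0..t} (\<lambda>s. exp (\<nu> * s - A s) * \<epsilon> p s))
            in real_C1 (time_ivl Tc) R \<and> R 0 = \<delta> p \<and>
               (\<forall>t \<in> time_ivl Tc. dini R t = ereal (lin_control_rhs \<nu> K G GG \<epsilon> D n p Rn R t)) \<and>
               (\<forall>S. real_C1 (time_ivl Tc) S \<and> S 0 = \<delta> p \<and>
                    (\<forall>t \<in> time_ivl Tc. dini S t = ereal (lin_control_rhs \<nu> K G GG \<epsilon> D n p Rn S t))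
                  \<longrightarrow> (\<forall>t \<in> time_ivl Tc. S t = R t)))))"
    (is "?existence \<and> (\<forall>Tc Rn. ?control Tc Rn \<longrightarrow>
      ?time Tc Rn \<and> ?bound Tc Rn \<and> ?global Tc Rn \<and> (\<forall>p > n. ?linear Tc Rn p))")
proof -
  interpret nse_constants K G GG \<nu> n "TYPE('d)"
    using assms by unfold_locales auto
  have cD: "continuous_on (time_ivl Ta) (D p)" and D: "\<And>t. t \<in> time_ivl Ta \<Longrightarrow> sob_norm p (ua t) \<le> D p t"
    and c\<epsilon>: "continuous_on (time_ivl Ta) (\<epsilon> p)"
    and \<epsilon>: "\<And>t. t \<in> time_ivl Ta \<Longrightarrow> sob_norm p (diff_error \<nu> f Ta ua t) \<le> \<epsilon> p t"
    and \<delta>: "sob_norm p (\<lambda>k. ua 0 k - u0 k) \<le> \<delta> p" if "n \<le> p" for p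
    using assms(7)[of p] assms(8)[of p] assms(9)[of p] that assms(14)
    by (auto simp: growth_estimator_def diff_error_estimator_def datum_error_estimator_def)
  have sol: "nse_solution \<nu> f u0 T u"
    and maximal: "\<And>T' u'. nse_solution \<nu> f u0 T' u' \<Longrightarrow> T \<le> T' \<Longrightarrow> (\<And>t. t \<in> time_ivl T \<Longrightarrow> u' t = u t) \<Longrightarrow> T' = T"
    using assms(5) unfolding nse_maximal_solution_def by blast+
  have T0: "0 < T" and us: "time_smooth (time_ivl T) u" and u_init: "u 0 = u0"
    and du: "\<And>t. t \<in> time_ivl T \<Longrightarrow> has_time_deriv (time_ivl T) u (nse_rhs \<nu> f t (u t)) t"
    using sol unfolding nse_solution_def nse_rhs_def by blast+
  have uS: "u t \<in> smooth_fields" if "t \<in> time_ivl T" for t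
    using us that unfolding time_smooth_def by (blast intro: time_Ck_smooth)
  have Ta0: "0 < Ta" and ua1: "time_Ck (Suc 0) (time_ivl Ta) ua"
    using assms(6) by (auto simp: approx_solution_def simp del: time_Ck.simps)
  obtain ua' where dua: "\<And>t. t \<in> time_ivl Ta \<Longrightarrow> has_time_deriv (time_ivl Ta) ua (ua' t) t"
    using ua1 unfolding time_Ck_Suc_iff by blast
  have uaS: "ua t \<in> smooth_fields" if "t \<in> time_ivl Ta" for t
    by (rule time_Ck_smooth[OF ua1 that])
  have err: "sob_norm p (\<lambda>k. ua' t k - nse_rhs \<nu> f t (ua t) k) \<le> \<epsilon> p t" if "t \<in> time_ivl Ta" "n \<le> p" for t p
  proof -
    have "(\<lambda>k. ua' t k - nse_rhs \<nu> f t (ua t) k) = diff_error \<nu> f Ta ua t"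
      by (simp add: diff_error_def time_deriv_eq[OF dua[OF that(1)] that(1)] nse_rhs_def fun_eq_iff algebra_simps)
    then show ?thesis using \<epsilon>[OF that(2,1)] by simp
  qed
  have fC: "time_Ck 0 {0..} f"
    using assms(3) unfolding time_smooth_def time_ivl_infinity by blast
  have fS: "f t \<in> smooth_fields" if "0 \<le> t" for t using time_Ck_smooth[OF fC] that by simp
  define quad where "quad = (\<lambda>t x. - \<nu> * x + (G n * D n t + K n * D (n + 1) t) * x + G n * x\<^sup>2 + \<epsilon> n t)"
  have quad: "control_rhs \<nu> K G \<epsilon> D n R t = quad t (R t)" for R t
    by (simp add: control_rhs_def quad_def)
  \<comment> \<open>The difference quotient of \<open>quad\<close> in its second argument; it is
    continuous in time together with \<open>R\<close> and \<open>S\<close>.\<close>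
  define mq where "mq = (\<lambda>R S t. - \<nu> + (G n * D n t + K n * D (n + 1) t) + G n * (R t + S t))"
  have mq: "quad t (R t) - quad t (S t) = mq R S t * (R t - S t)" for R S t
    by (simp add: quad_def mq_def algebra_simps power2_eq_square)
  have cmq: "continuous_on (time_ivl Tc) (mq R S)"
    if "Tc \<le> Ta" "continuous_on (time_ivl Tc) R" "continuous_on (time_ivl Tc) S" for Tc R S
    unfolding mq_def
    by (intro continuous_intros that continuous_on_subset[OF cD time_ivl_mono[OF that(1)]]) auto

  have ?existence
  proof -
    obtain b where b: "0 < b" "b \<in> time_ivl Ta"
      using time_ivl_right[OF zero_in_time_ivl[OF Ta0]] by blast
    have sub: "{0..b} \<subseteq> time_ivl Ta" by (rule time_ivl_atLeastAtMost[OF b(2)])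
    have "continuous_on {0..b} (\<lambda>t. - \<nu> + (G n * D n t + K n * D (n + 1) t))"
      by (intro continuous_intros continuous_on_subset[OF cD sub]) auto
    then obtain \<tau> R where \<tau>: "0 < \<tau>" "\<tau> \<le> b" and R0: "R 0 = \<delta> n"
      and dR: "\<And>t. t \<in> {0..\<tau>} \<Longrightarrow> (R has_real_derivative ((- \<nu> + (G n * D n t + K n * D (n + 1) t)) * R t + G n * (R t)\<^sup>2 + \<epsilon> n t)) (at t within {0..\<tau>})"
      using riccati_local_existence[OF b(1) _ continuous_on_subset[OF c\<epsilon>[OF order_refl] sub]] by blast
    have Tc: "0 < ereal \<tau>" "ereal \<tau> \<le> Ta"
      using \<tau> b(2) by (auto simp: time_ivl_def less_imp_le intro: order_trans[of _ "ereal b"])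
    have dR': "(R has_real_derivative quad t (R t)) (at t within time_ivl (ereal \<tau>))" if "t \<in> time_ivl (ereal \<tau>)" for t
      using has_field_derivative_subset[OF dR[of t], of "time_ivl (ereal \<tau>)"] that
      by (simp add: quad_def time_ivl_ereal subset_iff algebra_simps)
    have cR: "continuous_on (time_ivl (ereal \<tau>)) R"
      using dR' unfolding continuous_on_eq_continuous_within by (metis DERIV_continuous)
    have C1: "real_C1 (time_ivl (ereal \<tau>)) R"
      unfolding real_C1_def
    proof (intro exI[of _ "\<lambda>t. quad t (R t)"] conjI ballI dR')
      show "continuous_on (time_ivl (ereal \<tau>)) (\<lambda>t. quad t (R t))"
        unfolding quad_def
        by (intro continuous_intros cR continuous_on_subset[OF cD time_ivl_mono[OF Tc(2)]]
            continuous_on_subset[OF c\<epsilon> time_ivl_mono[OF Tc(2)]]) auto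
    qed
    have dini: "dini R t = ereal (quad t (R t))" if "t \<in> time_ivl (ereal \<tau>)" for t
      by (rule dini_eq_derivative[OF dR'[OF that] that])
    have "S t = R t" if S: "real_C1 (time_ivl (ereal \<tau>)) S" "S 0 = \<delta> n"
      "\<And>t. t \<in> time_ivl (ereal \<tau>) \<Longrightarrow> dini S t = ereal (quad t (S t))" and t: "t \<in> time_ivl (ereal \<tau>)" for S t
    proof (rule dini_equation_unique[where g = quad and R = S and S = R and T = "ereal \<tau>"])
      show "\<exists>m. continuous_on (time_ivl (ereal \<tau>)) m \<and> (\<forall>t\<in>time_ivl (ereal \<tau>). quad t (P t) - quad t (Q t) = m t * (P t - Q t))"
        if "continuous_on (time_ivl (ereal \<tau>)) P" "continuous_on (time_ivl (ereal \<tau>)) Q" for P Q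
        by (intro exI[of _ "mq P Q"] conjI ballI cmq Tc that mq)
      show "S 0 = R 0" using S(2) R0 by simp
    qed (fact S C1 dini t)+
    then show ?thesis
      unfolding quad by (intro exI[of _ "ereal \<tau>"] exI[of _ R] conjI Tc C1 R0 ballI dini allI impI) blast+
  qed
  moreover have "?time Tc Rn \<and> ?bound Tc Rn \<and> ?global Tc Rn \<and> (\<forall>p > n. ?linear Tc Rn p)"
    if control: "?control Tc Rn" for Tc Rn
  proof -
    have Tc0: "0 < Tc" and TcTa: "Tc \<le> Ta" and cRn: "continuous_on (time_ivl Tc) Rn"
      and Rn: "\<And>t. t \<in> time_ivl Tc \<Longrightarrow> ereal (quad t (Rn t)) \<le> dini Rn t" and Rn0: "\<delta> n \<le> Rn 0"
      using control unfolding quad by blast+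
    \<comment> \<open>The comparison is first made on the common interval, since the proof of
      \<open>Tc \<le> T\<close> relies on the bound obtained there.\<close>
    define S where "S = min T Tc"
    have sub: "time_ivl S \<subseteq> time_ivl T" "time_ivl S \<subseteq> time_ivl Tc" "time_ivl S \<subseteq> time_ivl Ta"
      unfolding S_def by (intro time_ivl_mono min.cobounded1 min.cobounded2 min.coboundedI2[OF TcTa])+
    have initial: "sob_norm p (\<lambda>k. u 0 k - ua 0 k) \<le> \<delta> p" if "n \<le> p" for p
      using \<delta>[OF that] by (simp add: u_init sob_norm_minus_commute[of p u0])
    have hyps: "u t \<in> smooth_fields" "has_time_deriv (time_ivl S) u (nse_rhs \<nu> f t (u t)) t"
      "ua t \<in> smooth_fields" "has_time_deriv (time_ivl S) ua (ua' t) t" "f t \<in> smooth_fields"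
      if "t \<in> time_ivl S" for t
    proof -
      have t: "t \<in> time_ivl T" "t \<in> time_ivl Ta" using that sub by auto
      show "has_time_deriv (time_ivl S) u (nse_rhs \<nu> f t (u t)) t"
        by (rule has_time_deriv_subset[OF du[OF t(1)] sub(1)])
      show "has_time_deriv (time_ivl S) ua (ua' t) t"
        by (rule has_time_deriv_subset[OF dua[OF t(2)] sub(3)])
    qed (use that sub uS uaS fS time_ivl_nonneg in auto)
    have bound_n: "sob_norm n (\<lambda>k. u t k - ua t k) \<le> Rn t" if t: "t \<in> time_ivl S" for t
    proof (rule control_comparison[where g = quad and m = "mq Rn" and X = "\<lambda>t. sob_norm n (\<lambda>k. u t k - ua t k)"
          and S = S and \<epsilon> = "\<epsilon> n" and Dp = "D n" and Dq = "D (n + 1)" and f = f and v' = ua', OF hyps])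
      show "continuous_on (time_ivl S) (\<lambda>t. sob_norm n (\<lambda>k. u t k - ua t k)) \<Longrightarrow>
          continuous_on (time_ivl S) (mq Rn (\<lambda>t. sob_norm n (\<lambda>k. u t k - ua t k)))"
        using TcTa by (intro cmq continuous_on_subset[OF cRn sub(2)]) (auto simp: S_def intro: min.coboundedI2)
      show "sob_norm n (\<lambda>k. u 0 k - ua 0 k) \<le> Rn 0" using initial[of n] Rn0 by simp
      \<comment> \<open>The tame constant on the diagonal equals the Kato constant, so the term with
        \<open>GG n n\<close> is the quadratic term of the control inequality.\<close>
      show "- \<nu> * sob_norm n (\<lambda>k. u t k - ua t k) + (G n * D n t + K n * D (n + 1) t + GG n n * sob_norm n (\<lambda>k. u t k - ua t k))
          * sob_norm n (\<lambda>k. u t k - ua t k) + \<epsilon> n t = quad t (sob_norm n (\<lambda>k. u t k - ua t k))" for t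
        by (simp add: quad_def assms(13)[OF assms(14)] algebra_simps power2_eq_square)
    qed (use t sub in \<open>auto intro: err D Rn mq continuous_on_subset[OF cRn]\<close>)

    have TTc: "Tc \<le> T"
    proof (rule ccontr)
      assume "\<not> Tc \<le> T"
      then have less: "T < Tc" by simp
      then obtain T' where T': "T = ereal T'" using T0 by (cases T) auto
      have ST: "S = T" using less by (simp add: S_def)
      have T'0: "0 < T'" using T0 T' by simp
      have "T' \<in> time_ivl Tc" using less T'0 T' by (simp add: time_ivl_def)
      then have subc: "{0..T'} \<subseteq> time_ivl Tc" by (rule time_ivl_atLeastAtMost)
      \<comment> \<open>Since \<open>T' < Tc\<close>, the control function and the growth estimator
        are continuous up to and including \<open>T'\<close>, which bounds \<open>u\<close>
        uniformly on the half-open interval.\<close>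
      have "continuous_on {0..T'} (\<lambda>t. Rn t + D n t)"
        using TcTa by (intro continuous_intros continuous_on_subset[OF cRn subc]
            continuous_on_subset[OF cD order_trans[OF subc time_ivl_mono]]) auto
      then have "bounded ((\<lambda>t. Rn t + D n t) ` {0..T'})"
        by (intro compact_imp_bounded compact_continuous_image compact_Icc)
      then obtain M0 where M0: "\<forall>t\<in>{0..T'}. \<bar>Rn t + D n t\<bar> \<le> M0"
        unfolding bounded_iff by auto
      have uM: "sob_norm n (u t) \<le> M0" if t: "t \<in> {0..<T'}" for t
      proof -
        have tS: "t \<in> time_ivl S" using t by (simp add: ST T' time_ivl_ereal)
        have "sob_norm n (\<lambda>k. (u t k - ua t k) + ua t k) \<le> sob_norm n (\<lambda>k. u t k - ua t k) + sob_norm n (ua t)"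
          by (intro sob_norm_triangle smooth_fields_finite smooth_fields_diff hyps tS)
        also have "\<dots> \<le> Rn t + D n t" using tS sub by (intro add_mono bound_n D) auto
        also have "\<dots> \<le> M0" using bspec[OF M0, of t] t by auto
        finally show ?thesis by simp
      qed
      have uT: "u t \<in> smooth_fields" "has_time_deriv {0..<T'} u (nse_rhs \<nu> f t (u t)) t" if "t \<in> {0..<T'}" for t
        using uS du that unfolding T' time_ivl_ereal by auto
      obtain T2 u2 where T2: "T' < T2" "\<And>t. t \<in> {0..<T'} \<Longrightarrow> u2 t = u t"
        and u2: "\<And>t. t \<in> {0..<T2} \<Longrightarrow> u2 t \<in> smooth_fields"
          "\<And>t. t \<in> {0..<T2} \<Longrightarrow> has_time_deriv {0..<T2} u2 (nse_rhs \<nu> f t (u2 t)) t"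
        using nse_continuation[OF T'0 fC uT uM] by blast
      \<comment> \<open>Maximality concerns solutions that are smooth in time, while the
        continuation is only known to be differentiable; the equation and the smooth force supply
        the higher derivatives.\<close>
      have "time_smooth {0..<T2} f"
        using assms(3) unfolding time_smooth_def time_ivl_infinity by (auto intro: time_Ck_subset simp del: time_Ck.simps)
      then have "time_smooth {0..<T2} u2" by (rule time_smooth_of_equation[OF K _ u2])
      then have "nse_solution \<nu> f u0 (ereal T2) u2"
        unfolding nse_solution_def time_ivl_ereal nse_rhs_def[symmetric]
        using u2 T2 T'0 u_init by auto
      then have "ereal T2 = T"
        by (rule maximal) (use T2 in \<open>auto simp: T' time_ivl_ereal\<close>)
      with T2 T' show False by simp
    qed
    then have ST: "S = Tc" by (simp add: S_def)

    have part_ii: "?linear Tc Rn p" if np: "n < p" for p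
    proof -
      define \<alpha> where "\<alpha> = (\<lambda>s. G p * D p s + K p * D (p + 1) s + GG p n * Rn s)"
      define lin where "lin = (\<lambda>t x. - \<nu> * x + \<alpha> t * x + \<epsilon> p t)"
      have lin: "lin_control_rhs \<nu> K G GG \<epsilon> D n p Rn R t = lin t (R t)" for R t
        by (simp add: lin_control_rhs_def lin_def \<alpha>_def)
      have c\<alpha>: "continuous_on (time_ivl Tc) \<alpha>"
        unfolding \<alpha>_def using np TcTa
        by (intro continuous_intros cRn continuous_on_subset[OF cD time_ivl_mono]) auto
      have c\<epsilon>': "continuous_on (time_ivl Tc) (\<epsilon> p)"
        using np TcTa by (intro continuous_on_subset[OF c\<epsilon> time_ivl_mono]) auto
      \<comment> \<open>For a linear right-hand side the difference quotient is the same for every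
        pair of functions.\<close>
      define ml where "ml = (\<lambda>R :: real \<Rightarrow> real. \<lambda>t. - \<nu> + \<alpha> t)"
      have ml: "lin t (R t) - lin t (S t) = ml S t * (R t - S t)" for R S t
        by (simp add: lin_def ml_def algebra_simps)
      have cml: "continuous_on (time_ivl Tc) (ml S)" for S
        unfolding ml_def by (intro continuous_intros c\<alpha>)
      have bound_p: "sob_norm p (\<lambda>k. u t k - ua t k) \<le> Rp t"
        if Rp: "continuous_on (time_ivl Tc) Rp" "\<And>t. t \<in> time_ivl Tc \<Longrightarrow> ereal (lin t (Rp t)) \<le> dini Rp t" "\<delta> p \<le> Rp 0"
          and t: "t \<in> time_ivl Tc" for Rp t
      proof (rule control_comparison[where g = lin and m = ml and X = Rn
            and S = S and \<epsilon> = "\<epsilon> p" and Dp = "D p" and Dq = "D (p + 1)" and f = f and v' = ua' and p = p, OF hyps])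
        show "continuous_on (time_ivl S) (ml (\<lambda>t. sob_norm p (\<lambda>k. u t k - ua t k)))" unfolding ST by (rule cml)
        show "sob_norm p (\<lambda>k. u 0 k - ua 0 k) \<le> Rp 0" using initial[of p] Rp(3) np by simp
        show "- \<nu> * sob_norm p (\<lambda>k. u t k - ua t k) + (G p * D p t + K p * D (p + 1) t + GG p n * Rn t)
          * sob_norm p (\<lambda>k. u t k - ua t k) + \<epsilon> p t = lin t (sob_norm p (\<lambda>k. u t k - ua t k))" for t
          by (simp add: lin_def \<alpha>_def)
      qed (use t sub np Rp ST in \<open>auto intro: err D bound_n ml\<close>)
      define A where "A = (\<lambda>t. integral {0..t} \<alpha>)"
      define R where "R = (\<lambda>t. exp (- \<nu> * t + A t) * (\<delta> p + integral {0..t} (\<lambda>s. exp (\<nu> * s - A s) * \<epsilon> p s)))"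
      have R: "real_C1 (time_ivl Tc) R" "R 0 = \<delta> p"
        and dR: "dini R t = ereal (lin t (R t))" if "t \<in> time_ivl Tc" for t
        unfolding R_def A_def lin_def
        by (rule linear_ode_solution[OF c\<alpha> c\<epsilon>'] linear_ode_solution(3)[OF c\<alpha> c\<epsilon>' that])+
      have unique: "S t = R t" if S: "real_C1 (time_ivl Tc) S" "S 0 = \<delta> p"
        "\<And>t. t \<in> time_ivl Tc \<Longrightarrow> dini S t = ereal (lin t (S t))" and t: "t \<in> time_ivl Tc" for S t
      proof (rule dini_equation_unique[where g = lin and R = S and S = R and T = Tc])
        show "\<exists>m. continuous_on (time_ivl Tc) m \<and> (\<forall>t\<in>time_ivl Tc. lin t (P t) - lin t (Q t) = m t * (P t - Q t))"
          for P Q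
          by (intro exI[of _ "ml Q"] conjI ballI cml ml)
        show "S 0 = R 0" using S(2) R(2)[OF t] by simp
      qed (fact S R[OF t] dR t)+
      have Rt: "exp (- \<nu> * t + A t) * (\<delta> p + integral {0..t} (\<lambda>s. exp (\<nu> * s - A s) * \<epsilon> p s)) = R t" for t
        by (simp add: R_def)
      show ?thesis
        unfolding lin Let_def \<alpha>_def[symmetric] A_def[symmetric] Rt
      proof (intro conjI allI impI ballI)
        show "sob_norm p (\<lambda>k. u t k - ua t k) \<le> Rp t"
          if "continuous_on (time_ivl Tc) Rp \<and> (\<forall>t\<in>time_ivl Tc. ereal (lin t (Rp t)) \<le> dini Rp t) \<and> \<delta> p \<le> Rp 0"
            "t \<in> time_ivl Tc" for Rp t
          using that by (intro bound_p) auto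
        show "S t = R t"
          if "real_C1 (time_ivl Tc) S \<and> S 0 = \<delta> p \<and> (\<forall>t\<in>time_ivl Tc. dini S t = ereal (lin t (S t)))"
            "t \<in> time_ivl Tc" for S t
          using that by (intro unique) auto
      qed (use R[OF zero_in_time_ivl[OF Tc0]] dR in auto)
    qed
    show ?thesis
    proof (intro conjI)
      show "?time Tc Rn" by (rule TTc)
      show "?bound Tc Rn" using bound_n by (simp add: ST)
      show "?global Tc Rn" using TTc by auto
    qed (use part_ii in blast)
  qed
  ultimately show ?thesis by blast
qed

end
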